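(* Let $M>-\frac14$, $0<v<1$, $w=\sqrt{(1-v)/v}$, and let $\alpha$ be the profile curve of the Twizzler $\mathfrak{T}(M,v)$. (1) $\mathfrak{T}(M,v)$ is invariant under a group of rotations about its axis of the form $\{R(n\theta):n\in\mathbb{Z}\}$, where the angle $\theta$ depends on the fundamental piece of the profile curve: $R(\theta)$ is the rotation with $\alpha(s+L)=R(\theta)\alpha(s)$ for all $s$, $L$ being the length of the fundamental piece. (2) If $R(m\theta)=R(\theta)$ for some integer $m\ne1$, then $\mathfrak{T}(M,v)$ is properly immersed. Otherwise, it is dense in the interior of a cylinder of radius $1$ when $M=0$, and it is dense in the region bounded by two concentric cylinders of radii $$r_1(M)=\Big|\frac{\sqrt{1+4M}-1}{2}\Big|\quad\text{and}\quad r_2(M)=\frac{\sqrt{1+4M}+1}{2}$$ when $M\neq0$. (3) The set of points $(M,v)\in(-\frac14,\infty)\times(0,1)$ for which $\mathfrak{T}(M,v)$ is properly immersed is uncountable and dense in $(-\frac14,\infty)\times(0,1)$. (4) $\mathfrak{T}(M,v)$ is a properly immersed surface with profile curve consisting of $b$ fundamental pieces if and only if $$\int_0^{2\pi}\psi(u)\,du=2\pi\frac ab$$ with $a$ and $b$ relatively prime positive integers, where $$\psi(u)=\frac{-w^2\rho_2(u)+2(1+w^2\rho_1^2(u))^{3/2}}{1+w^2(\rho_1^2(u)+\rho_2^2(u))}\sqrt{\frac{\lambda(u)}{\mu(u)}}.$$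
   Context: Twizzlers: a Twizzler is an immersion $\phi(s,t)=(x(s)\cos(wt)+z(s)\sin(wt),\,t,\,-x(s)\sin(wt)+z(s)\cos(wt))$ of constant mean curvature; $\alpha(s)=(x(s),z(s))$, $s\in\mathbb{R}$, parametrized by arc length, is its profile curve. Its axis is the $y$-axis (second coordinate axis); all cylinders are centered on this axis. The mean curvature (half the sum of the principal curvatures) is taken with respect to $\nu=\frac{\phi_s\times\phi_t}{|\phi_s\times\phi_t|}$. TreadmillSled: for each $s$ let $T_s$ be the unique orientation-preserving isometry of $\mathbb{R}^2$ that takes $\alpha(s)$ to $(0,0)$ and whose linear part takes $\alpha'(s)$ to $(1,0)$; the TreadmillSled of $\alpha$ is $s\mapsto T_s(0,0)$. Equivalently it is $-(\xi_1,\xi_2)$ with $\xi_1=xx'+zz'$, $\xi_2=-xz'+zx'$. $\mathfrak{T}(M,v)$, for $M>-\frac14$ and $0<v<1$, denotes the Twizzler (unique up to rigid motions) with mean curvature $1$ and parameter $w=\sqrt{(1-v)/v}$ for which the TreadmillSled of the profile curve is $-h_w^{-1}(M)$, where $h_w(x_1,x_2)=x_1^2+x_2^2+\frac{x_2}{\sqrt{1+w^2x_1^2}}$; that is, $h_w(\xi_1(s),\xi_2(s))=M$ for all $s$. The level set $h_w^{-1}(M)$ is a regular simple closed curve. A fundamental piece of the profile curve is a connected piece of it (the restriction of $\alpha$ to an interval) whose TreadmillSled motion goes exactly once over the simple closed curve $-h_w^{-1}(M)$; $L$ is its length, i.e. the minimal period of $(\xi_1,\xi_2)$. $R(t)$ denotes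 the rotation by the angle $t$ of the $(x,z)$-plane, $R(t)=\begin{pmatrix}\cos t&-\sin t\\ \sin t&\cos t\end{pmatrix}$, also viewed as a rotation of $\mathbb{R}^3$ about the $y$-axis. "Properly immersed" means that the profile curve closes up (is periodic), so that $\phi$ factors through a proper immersion of $S^1\times\mathbb{R}$. "The profile curve consists of $b$ fundamental pieces" means that $b$ is the least positive integer with $\alpha(s+bL)=\alpha(s)$ for all $s$. Functions: with $$A=\frac{\sqrt{-1+Mw^2+\sqrt{1+(1+2M)w^2+M^2w^4}}}{\sqrt2\,w},\quad B=\frac{2+2M^2w^4+w^2+2(Mw^2-1)\sqrt{1+(1+2M)w^2+M^2w^4}}{w^2},$$ $$\rho_1(u)=A\cos u,\qquad \rho_2(u)=\frac{-1+\sqrt{1+4M+B\cos^2u}\,\sin u}{2\sqrt{1+w^2A^2\cos^2u}},$$ $$f_1(x_1,x_2)=\frac{-w^2x_2+2(1+w^2x_1^2)^{3/2}}{1+w^2(x_1^2+x_2^2)}x_2+1,\qquad f_2(x_1,x_2)=\frac{w^2x_2-2(1+w^2x_1^2)^{3/2}}{1+w^2(x_1^2+x_2^2)}x_1,$$ $$\lambda(u)=\Big(\frac{d\rho_1}{du}\Big)^2+\Big(\frac{d\rho_2}{du}\Big)^2,\qquad \mu(u)=f_1^2(\rho_1(u),\rho_2(u))+f_2^2(\rho_1(u),\rho_2(u)).$$ *)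

theory Defs
  imports "HOL-Analysis.Analysis"
begin

definition d_fst :: "(real \<Rightarrow> real \<Rightarrow> real^3) \<Rightarrow> real \<Rightarrow> real \<Rightarrow> real^3" where
  "d_fst \<phi> s t = vector_derivative (\<lambda>s. \<phi> s t) (at s)"

definition d_snd :: "(real \<Rightarrow> real \<Rightarrow> real^3) \<Rightarrow> real \<Rightarrow> real \<Rightarrow> real^3" where
  "d_snd \<phi> s t = vector_derivative (\<lambda>t. \<phi> s t) (at t)"

definition unit_normal :: "(real \<Rightarrow> real \<Rightarrow> real^3) \<Rightarrow> real \<Rightarrow> real \<Rightarrow> real^3" where
  "unit_normal \<phi> s t = sgn (cross3 (d_fst \<phi> s t) (d_snd \<phi> s t))"

definition first_form :: "(real \<Rightarrow> real \<Rightarrow> real^3) \<Rightarrow> real \<Rightarrow> real \<Rightarrow> real^2^2" where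
  "first_form \<phi> s t =
     vector [vector [d_fst \<phi> s t \<bullet> d_fst \<phi> s t, d_fst \<phi> s t \<bullet> d_snd \<phi> s t],
             vector [d_snd \<phi> s t \<bullet> d_fst \<phi> s t, d_snd \<phi> s t \<bullet> d_snd \<phi> s t]]"

definition second_form :: "(real \<Rightarrow> real \<Rightarrow> real^3) \<Rightarrow> real \<Rightarrow> real \<Rightarrow> real^2^2" where
  "second_form \<phi> s t =
     vector [vector [d_fst (d_fst \<phi>) s t \<bullet> unit_normal \<phi> s t, d_snd (d_fst \<phi>) s t \<bullet> unit_normal \<phi> s t],
             vector [d_fst (d_snd \<phi>) s t \<bullet> unit_normal \<phi> s t, d_snd (d_snd \<phi>) s t \<bullet> unit_normal \<phi> s t]]"

text \<open>The principal curvatures are the eigenvalues, with multiplicity, of the shape operator, whose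
  matrix is the inverse of the first form times the second form. Multiplying its characteristic
  polynomial by the determinant of the first form gives the equation below.\<close>

definition principal_curvatures ::
  "(real \<Rightarrow> real \<Rightarrow> real^3) \<Rightarrow> real \<Rightarrow> real \<Rightarrow> real \<Rightarrow> real \<Rightarrow> bool" where
  "principal_curvatures \<phi> s t \<kappa>\<^sub>1 \<kappa>\<^sub>2 \<longleftrightarrow>
     (\<forall>k. det (second_form \<phi> s t - k *\<^sub>R first_form \<phi> s t)
          = det (first_form \<phi> s t) * (\<kappa>\<^sub>1 - k) * (\<kappa>\<^sub>2 - k))"

definition has_mean_curvature ::
  "(real \<Rightarrow> real \<Rightarrow> real^3) \<Rightarrow> real \<Rightarrow> real \<Rightarrow> real \<Rightarrow> bool" where
  "has_mean_curvature \<phi> s t H \<longleftrightarrow>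
     (\<exists>\<kappa>\<^sub>1 \<kappa>\<^sub>2. principal_curvatures \<phi> s t \<kappa>\<^sub>1 \<kappa>\<^sub>2 \<and> H = (\<kappa>\<^sub>1 + \<kappa>\<^sub>2) / 2)"

definition treadmill_isometry :: "(real \<Rightarrow> real^2) \<Rightarrow> real \<Rightarrow> real^2 \<Rightarrow> real^2" where
  "treadmill_isometry \<alpha> s =
     (THE T. \<exists>A b. rotation_matrix A \<and> T = (\<lambda>p. A *v p + b) \<and> T (\<alpha> s) = 0 \<and>
                   A *v vector_derivative \<alpha> (at s) = vector [1, 0])"

definition treadmill_sled :: "(real \<Rightarrow> real^2) \<Rightarrow> real \<Rightarrow> real^2" where
  "treadmill_sled \<alpha> s = treadmill_isometry \<alpha> s 0"

lemma treadmill_sled_eq: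
  fixes \<alpha> :: "real \<Rightarrow> real^2"
  assumes "norm (vector_derivative \<alpha> (at s)) = 1"
  defines "d \<equiv> vector_derivative \<alpha> (at s)"
  shows "treadmill_sled \<alpha> s =
           - vector [\<alpha> s $ 1 * d $ 1 + \<alpha> s $ 2 * d $ 2, - \<alpha> s $ 1 * d $ 2 + \<alpha> s $ 2 * d $ 1]"
proof -
  define A0 :: "real^2^2" where "A0 = vector [vector [d$1, d$2], vector [- d$2, d$1]]"
  have d1: "d$1 * d$1 + d$2 * d$2 = 1"
    using assms(1) unfolding d_def[symmetric]
    by (simp add: norm_eq_1 inner_vec_def sum_2)
  have rotA0: "rotation_matrix A0"
    using d1
    by (simp add: rotation_matrix_def orthogonal_matrix A0_def det_2 matrix_matrix_mult_def
        transpose_def mat_def vec_eq_iff forall_2 sum_2 algebra_simps)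
  have A0d: "A0 *v d = vector [1, 0]"
    using d1 by (simp add: A0_def matrix_vector_mult_def vec_eq_iff forall_2 sum_2)
  have uniq: "A = A0" if A: "rotation_matrix A" "A *v d = vector [1, 0]" for A :: "real^2^2"
  proof -
    have o: "transpose A ** A = mat 1" and dt: "det A = 1"
      using A(1) by (auto simp: rotation_matrix_def orthogonal_matrix_def)
    have e: "d = transpose A *v vector [1, 0]"
      by (metis A(2) matrix_vector_mul_assoc matrix_vector_mul_lid o)
    have r: "d$1 = A$1$1" "d$2 = A$1$2"
      by (subst e; simp add: matrix_vector_mult_def sum_2 transpose_def)+
    have "A ** transpose A = mat 1"
      using A(1) by (auto simp: rotation_matrix_def orthogonal_matrix_def)
    then have "A$1$1 * A$2$1 + A$1$2 * A$2$2 = 0"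
      by (simp add: vec_eq_iff forall_2 matrix_matrix_mult_def sum_2 transpose_def mat_def)
    moreover have "A$1$1 * A$2$2 - A$1$2 * A$2$1 = 1"
      using dt by (simp add: det_2)
    ultimately have "A$2$2 = d$1" "A$2$1 = - d$2"
      using d1 r by algebra+
    then show ?thesis
      using r by (simp add: A0_def vec_eq_iff forall_2)
  qed
  have "treadmill_isometry \<alpha> s = (\<lambda>p. A0 *v p + - (A0 *v \<alpha> s))"
    unfolding treadmill_isometry_def d_def[symmetric]
  proof (rule the_equality)
    show "\<exists>A b. rotation_matrix A \<and> (\<lambda>p. A0 *v p + - (A0 *v \<alpha> s)) = (\<lambda>p. A *v p + b) \<and>
        A0 *v \<alpha> s + - (A0 *v \<alpha> s) = 0 \<and> A *v d = vector [1, 0]"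
      using rotA0 A0d by (intro exI[of _ A0] exI[of _ "- (A0 *v \<alpha> s)"]) auto
  next
    fix T assume "\<exists>A b. rotation_matrix A \<and> T = (\<lambda>p. A *v p + b) \<and> T (\<alpha> s) = 0 \<and>
        A *v d = vector [1, 0]"
    then obtain A b where T: "rotation_matrix A" "T = (\<lambda>p. A *v p + b)" "T (\<alpha> s) = 0"
        "A *v d = vector [1, 0]" by blast
    with uniq have "A = A0" by blast
    with T have "A0 *v \<alpha> s + b = 0" by simp
    then have "b = - (A0 *v \<alpha> s)" by (simp add: eq_neg_iff_add_eq_0 add.commute)
    with T \<open>A = A0\<close> show "T = (\<lambda>p. A0 *v p + - (A0 *v \<alpha> s))" by simp
  qed
  then show ?thesis
    by (simp add: treadmill_sled_def A0_def vec_eq_iff forall_2 matrix_vector_mult_def sum_2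
        algebra_simps)
qed

definition twizzler_map :: "real \<Rightarrow> (real \<Rightarrow> real^2) \<Rightarrow> real \<Rightarrow> real \<Rightarrow> real^3" where
  "twizzler_map w \<alpha> s t =
     vector [\<alpha> s $ 1 * cos (w * t) + \<alpha> s $ 2 * sin (w * t),
             t,
             - \<alpha> s $ 1 * sin (w * t) + \<alpha> s $ 2 * cos (w * t)]"

definition twizzler_surface :: "real \<Rightarrow> (real \<Rightarrow> real^2) \<Rightarrow> (real^3) set" where
  "twizzler_surface w \<alpha> = {twizzler_map w \<alpha> s t | s t. True}"

definition h :: "real \<Rightarrow> real \<Rightarrow> real \<Rightarrow> real" where
  "h w x\<^sub>1 x\<^sub>2 = x\<^sub>1\<^sup>2 + x\<^sub>2\<^sup>2 + x\<^sub>2 / sqrt (1 + w\<^sup>2 * x\<^sub>1\<^sup>2)"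

definition level_curve :: "real \<Rightarrow> real \<Rightarrow> (real^2) set" where
  "level_curve w M = {p. h w (p $ 1) (p $ 2) = M}"

definition twizzler_w :: "real \<Rightarrow> real" where
  "twizzler_w v = sqrt ((1 - v) / v)"

text \<open>The curve \<open>\<alpha>\<close> is a profile curve of the Twizzler with parameters \<open>M\<close>, \<open>v\<close>. This determines
  \<open>\<alpha>\<close> up to a rotation of the plane about the origin and a shift of the parameter. Only \<open>C\<^sup>2\<close> is
  required; constant mean curvature then makes \<open>\<alpha>\<close> smooth.\<close>

definition twizzler_profile :: "real \<Rightarrow> real \<Rightarrow> (real \<Rightarrow> real^2) \<Rightarrow> bool" where
  "twizzler_profile M v \<alpha> \<longleftrightarrow>
     (\<exists>\<alpha>' \<alpha>''. (\<forall>s. (\<alpha> has_vector_derivative \<alpha>' s) (at s)) \<and>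
              (\<forall>s. (\<alpha>' has_vector_derivative \<alpha>'' s) (at s)) \<and>
              continuous_on UNIV \<alpha>'') \<and>
     (\<forall>s. norm (vector_derivative \<alpha> (at s)) = 1) \<and>
     (\<forall>s t. cross3 (d_fst (twizzler_map (twizzler_w v) \<alpha>) s t)
                   (d_snd (twizzler_map (twizzler_w v) \<alpha>) s t) \<noteq> 0) \<and>
     (\<forall>s t. has_mean_curvature (twizzler_map (twizzler_w v) \<alpha>) s t 1) \<and>
     (\<forall>s. treadmill_sled \<alpha> s \<in> uminus ` level_curve (twizzler_w v) M)"

text \<open>The TreadmillSled of the restriction of \<open>\<alpha>\<close> to \<open>[a, b]\<close> goes exactly once over the simple
  closed curve. As \<open>\<alpha>\<close> is parametrized by arc length, the length of this piece is \<open>b - a\<close>; it is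
  the minimal period of the TreadmillSled, hence the same for all fundamental pieces.\<close>

definition fundamental_piece :: "real \<Rightarrow> real \<Rightarrow> (real \<Rightarrow> real^2) \<Rightarrow> real \<Rightarrow> real \<Rightarrow> bool" where
  "fundamental_piece w M \<alpha> a b \<longleftrightarrow>
     a < b \<and> treadmill_sled \<alpha> b = treadmill_sled \<alpha> a \<and>
     bij_betw (treadmill_sled \<alpha>) {a..<b} (uminus ` level_curve w M)"

definition fundamental_length :: "real \<Rightarrow> real \<Rightarrow> (real \<Rightarrow> real^2) \<Rightarrow> real" where
  "fundamental_length w M \<alpha> = (THE L. \<exists>a b. fundamental_piece w M \<alpha> a b \<and> L = b - a)"

text \<open>The profile curve closes up. Since the second coordinate of \<open>twizzler_map w \<alpha> s t\<close> is \<open>t\<close>,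
  the immersion of circle times line induced by a periodic \<open>\<alpha>\<close> is automatically proper.\<close>

definition properly_immersed :: "(real \<Rightarrow> real^2) \<Rightarrow> bool" where
  "properly_immersed \<alpha> \<longleftrightarrow> (\<exists>p>0. \<forall>s. \<alpha> (s + p) = \<alpha> s)"

definition consists_of_pieces :: "real \<Rightarrow> (real \<Rightarrow> real^2) \<Rightarrow> nat \<Rightarrow> bool" where
  "consists_of_pieces L \<alpha> b \<longleftrightarrow>
     b > 0 \<and> (\<forall>s. \<alpha> (s + real b * L) = \<alpha> s) \<and>
     (\<forall>c. 0 < c \<and> c < b \<longrightarrow> \<not> (\<forall>s. \<alpha> (s + real c * L) = \<alpha> s))"

definition plane_rot :: "real \<Rightarrow> real^2^2" where
  "plane_rot t = vector [vector [cos t, - sin t], vector [sin t, cos t]]"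

definition axis_rot :: "real \<Rightarrow> real^3 \<Rightarrow> real^3" where
  "axis_rot t p = vector [cos t * p $ 1 - sin t * p $ 3, p $ 2, sin t * p $ 1 + cos t * p $ 3]"

definition axis_dist :: "real^3 \<Rightarrow> real" where
  "axis_dist p = sqrt ((p $ 1)\<^sup>2 + (p $ 3)\<^sup>2)"

text \<open>The containment is in the closure of \<open>D\<close> only, because a Twizzler also touches the boundary
  cylinders.\<close>

definition dense_in :: "(real^3) set \<Rightarrow> (real^3) set \<Rightarrow> bool" where
  "dense_in S D \<longleftrightarrow> S \<subseteq> closure D \<and> D \<subseteq> closure (S \<inter> D)"

definition coeff_A :: "real \<Rightarrow> real \<Rightarrow> real" where
  "coeff_A M w = sqrt (-1 + M * w\<^sup>2 + sqrt (1 + (1 + 2 * M) * w\<^sup>2 + M\<^sup>2 * w ^ 4)) / (sqrt 2 * w)"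

definition coeff_B :: "real \<Rightarrow> real \<Rightarrow> real" where
  "coeff_B M w =
     (2 + 2 * M\<^sup>2 * w ^ 4 + w\<^sup>2
      + 2 * (M * w\<^sup>2 - 1) * sqrt (1 + (1 + 2 * M) * w\<^sup>2 + M\<^sup>2 * w ^ 4)) / w\<^sup>2"

definition \<rho>\<^sub>1 :: "real \<Rightarrow> real \<Rightarrow> real \<Rightarrow> real" where
  "\<rho>\<^sub>1 M w u = coeff_A M w * cos u"

definition \<rho>\<^sub>2 :: "real \<Rightarrow> real \<Rightarrow> real \<Rightarrow> real" where
  "\<rho>\<^sub>2 M w u =
     (-1 + sqrt (1 + 4 * M + coeff_B M w * (cos u)\<^sup>2) * sin u)
     / (2 * sqrt (1 + w\<^sup>2 * (coeff_A M w)\<^sup>2 * (cos u)\<^sup>2))"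

definition f\<^sub>1 :: "real \<Rightarrow> real \<Rightarrow> real \<Rightarrow> real" where
  "f\<^sub>1 w x\<^sub>1 x\<^sub>2 =
     (- w\<^sup>2 * x\<^sub>2 + 2 * (1 + w\<^sup>2 * x\<^sub>1\<^sup>2) powr (3 / 2)) / (1 + w\<^sup>2 * (x\<^sub>1\<^sup>2 + x\<^sub>2\<^sup>2)) * x\<^sub>2 + 1"

definition f\<^sub>2 :: "real \<Rightarrow> real \<Rightarrow> real \<Rightarrow> real" where
  "f\<^sub>2 w x\<^sub>1 x\<^sub>2 =
     (w\<^sup>2 * x\<^sub>2 - 2 * (1 + w\<^sup>2 * x\<^sub>1\<^sup>2) powr (3 / 2)) / (1 + w\<^sup>2 * (x\<^sub>1\<^sup>2 + x\<^sub>2\<^sup>2)) * x\<^sub>1"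

definition lam :: "real \<Rightarrow> real \<Rightarrow> real \<Rightarrow> real" where
  "lam M w u = (deriv (\<rho>\<^sub>1 M w) u)\<^sup>2 + (deriv (\<rho>\<^sub>2 M w) u)\<^sup>2"

definition mu :: "real \<Rightarrow> real \<Rightarrow> real \<Rightarrow> real" where
  "mu M w u = (f\<^sub>1 w (\<rho>\<^sub>1 M w u) (\<rho>\<^sub>2 M w u))\<^sup>2 + (f\<^sub>2 w (\<rho>\<^sub>1 M w u) (\<rho>\<^sub>2 M w u))\<^sup>2"

definition \<psi> :: "real \<Rightarrow> real \<Rightarrow> real \<Rightarrow> real" where
  "\<psi> M w u =
     (- w\<^sup>2 * \<rho>\<^sub>2 M w u + 2 * (1 + w\<^sup>2 * (\<rho>\<^sub>1 M w u)\<^sup>2) powr (3 / 2))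
     / (1 + w\<^sup>2 * ((\<rho>\<^sub>1 M w u)\<^sup>2 + (\<rho>\<^sub>2 M w u)\<^sup>2))
     * sqrt (lam M w u / mu M w u)"

end

theory Submission
  imports Defs
begin

text \<open>
  Let \<open>\<kappa>\<close> be the curvature of the profile curve, and write the position vector as \<open>\<xi>\<^sub>1\<close> times the
  tangent plus \<open>\<xi>\<^sub>2\<close> times the normal. The Frenet equations give \<open>\<xi>\<^sub>1' = 1 + \<kappa> \<xi>\<^sub>2\<close> and
  \<open>\<xi>\<^sub>2' = - \<kappa> \<xi>\<^sub>1\<close>, and mean curvature one expresses \<open>\<kappa>\<close> as a function of \<open>(\<xi>\<^sub>1, \<xi>\<^sub>2)\<close>
  (\<open>mean_curvature_1_iff\<close>). So \<open>(\<xi>\<^sub>1, \<xi>\<^sub>2)\<close> runs along the level curve of \<open>h\<close> as the solution of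
  an autonomous system, and one passage rotates the tangent, hence the whole profile curve, by a
  fixed angle \<open>\<Phi>\<close>, the integral of \<open>\<kappa>\<close> over a period. Everything that is claimed about one
  Twizzler then depends on \<open>\<Phi>\<close> alone: the curve closes up iff \<open>\<Phi> / (2 \<pi>)\<close> is rational, with
  the denominator as the number of pieces, and for irrational \<open>\<Phi> / (2 \<pi>)\<close> the rotated copies of
  each point of the profile curve are dense in its circle around the axis, by Kronecker's theorem.

  The computations rest on a parametrization of the level curve by an angle \<open>\<phi>\<close> such that
  \<open>\<xi>\<^sub>1\<^sup>2 + \<xi>\<^sub>2\<^sup>2 = M + q\<close> with \<open>q = 1 / 2 + sqrt (1 + 4 M) / 2 * sin \<phi>\<close>. Both coordinates are
  explicit smooth functions of \<open>\<phi>\<close>, and the flow is \<open>\<phi>' = 2 / sqrt (1 + w\<^sup>2 q\<^sup>2)\<close>. Every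
  motion along the level curve lifts to \<open>\<phi>\<close> (\<open>level_curve_lift\<close>). Applied to a profile curve, this
  replaces uniqueness for the differential equation; applied to the parametrization \<open>(\<rho>\<^sub>1, \<rho>\<^sub>2)\<close>, it
  identifies the integral of \<open>\<psi>\<close> with \<open>\<Phi>\<close> (\<open>integral_\<psi>\<close>). Conversely, inverting the arc length
  as a function of \<open>\<phi>\<close> produces a profile curve for all parameters (\<open>twizzler_profile_exists\<close>).

  What remains is to understand how \<open>\<Phi>\<close> depends on the parameters. Up to the derivative of a
  periodic function, the turning per unit of \<open>\<phi>\<close> is
  \<open>1 + w\<^sup>2 q / (2 (1 + sqrt (1 + w\<^sup>2 (M + q))))\<close> (\<open>turning_eq\<close>). In this form the integral is
  visibly continuous in \<open>w\<close> and equal to \<open>2 \<pi>\<close> for \<open>w = 0\<close>, and it is strictly increasing in \<open>w\<close>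
  (\<open>turning_strict_mono\<close>). Hence \<open>\<Phi> > 0\<close>, which is why only positive numerators occur, and for
  every fixed \<open>M\<close> each interval of values of \<open>v\<close> contains one for which \<open>\<Phi> / (2 \<pi>)\<close> is
  rational. The parameters of properly immersed Twizzlers are therefore dense, and uncountable
  because every \<open>M\<close> occurs.
\<close>

section \<open>Antiderivatives and lifts on the real line\<close>

lemma global_antiderivative:
  fixes f :: "real \<Rightarrow> real"
  assumes "continuous_on UNIV f"
  obtains F where "\<And>x. (F has_real_derivative f x) (at x)"
proof -
  have "\<exists>F. \<forall>x::real. -\<infinity> < ereal x \<longrightarrow> ereal x < \<infinity> \<longrightarrow> (F has_vector_derivative f x) (at x)"
    by (rule einterval_antiderivative)
       (use assms in \<open>auto simp: continuous_on_eq_continuous_at\<close>)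
  then show thesis
    using that by (auto simp: has_real_derivative_iff_has_vector_derivative)
qed

lemma constant_if_derivative_zero:
  fixes f :: "real \<Rightarrow> 'a::real_normed_vector"
  assumes "\<And>x. (f has_vector_derivative 0) (at x)"
  shows "f x = f y"
proof -
  have "\<And>x. x \<in> UNIV \<Longrightarrow> (f has_derivative (\<lambda>h. 0)) (at x within UNIV)"
    using assms by (simp add: has_vector_derivative_def)
  from has_derivative_zero_constant[OF convex_UNIV this] show ?thesis by force
qed

lemma equal_derivatives_difference:
  fixes f g :: "real \<Rightarrow> real"
  assumes "\<And>x. (f has_real_derivative d x) (at x)" "\<And>x. (g has_real_derivative d x) (at x)"
  shows "f x - f y = g x - g y"
proof -
  have "((\<lambda>x. f x - g x) has_vector_derivative 0) (at x)" for x
    using DERIV_diff[OF assms(1)[of x] assms(2)[of x]]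
    by (simp add: has_real_derivative_iff_has_vector_derivative)
  from constant_if_derivative_zero[OF this, of x y] show ?thesis by simp
qed

lemma antiderivative_shift_period:
  fixes F :: "real \<Rightarrow> real"
  assumes F: "\<And>x. (F has_real_derivative f x) (at x)" and p: "\<And>x. f (x + p) = f x"
  shows "F (x + p) = F x + (F p - F 0)"
proof -
  have "((\<lambda>x. F (x + p)) has_real_derivative f x) (at x)" for x
    using F[of "x + p"] p[of x] by (simp add: DERIV_shift)
  from equal_derivatives_difference[OF this F, of x 0] show ?thesis by simp
qed

lemma integral_of_derivative:
  fixes F :: "real \<Rightarrow> real"
  assumes "a \<le> b" "\<And>x. (F has_real_derivative f x) (at x)"
  shows "(f has_integral F b - F a) {a..b}"
  using assms(1)
  by (rule fundamental_theorem_of_calculus)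
     (use assms(2) in \<open>auto simp: has_real_derivative_iff_has_vector_derivative
        intro: has_vector_derivative_at_within\<close>)

text \<open>Integrating \<open>p\<close> yields the candidate for the angle; the squared distance between
  \<open>(c, s)\<close> and the point on the circle at that angle has derivative zero.\<close>
lemma angle_lift:
  fixes c s p :: "real \<Rightarrow> real"
  assumes c: "\<And>t. (c has_real_derivative - s t * p t) (at t)"
    and s: "\<And>t. (s has_real_derivative c t * p t) (at t)"
    and p: "continuous_on UNIV p" and unit: "\<And>t. (c t)\<^sup>2 + (s t)\<^sup>2 = 1"
  obtains \<phi> where "\<And>t. (\<phi> has_real_derivative p t) (at t)" "\<And>t. c t = cos (\<phi> t)" "\<And>t. s t = sin (\<phi> t)"
proof -
  obtain F where F: "\<And>t. (F has_real_derivative p t) (at t)"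
    using global_antiderivative[OF p] by blast
  obtain a where a: "c 0 = cos a" "s 0 = sin a"
    using sincos_total_2pi[OF unit[of 0]] by metis
  define \<phi> where "\<phi> t = a + (F t - F 0)" for t
  have \<phi>: "(\<phi> has_real_derivative p t) (at t)" for t
    unfolding \<phi>_def by (auto intro!: derivative_eq_intros F)
  have "((\<lambda>t. (c t - cos (\<phi> t))\<^sup>2 + (s t - sin (\<phi> t))\<^sup>2) has_vector_derivative 0) (at t)" for t
    unfolding has_real_derivative_iff_has_vector_derivative[symmetric]
    by (auto intro!: derivative_eq_intros c s \<phi>) (simp add: algebra_simps)
  from constant_if_derivative_zero[OF this, of _ 0]
  have "(c t - cos (\<phi> t))\<^sup>2 + (s t - sin (\<phi> t))\<^sup>2 = 0" for t
    using a by (simp add: \<phi>_def)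
  then have "c t = cos (\<phi> t)" "s t = sin (\<phi> t)" for t
    by simp_all
  with \<phi> that show thesis by blast
qed

text \<open>The autonomous equation \<open>\<phi>' = 1 / f(\<phi>)\<close> is solved by separation of variables. The lower
  bound on \<open>f\<close> makes its antiderivative unbounded in both directions, so that the solution exists
  for all times.\<close>
lemma inverse_flow:
  fixes f :: "real \<Rightarrow> real"
  assumes f: "continuous_on UNIV f" and b: "b > 0" "\<And>x. f x \<ge> b"
  obtains \<phi> where "\<And>t. (\<phi> has_real_derivative 1 / f (\<phi> t)) (at t)"
proof -
  obtain F where F: "\<And>t. (F has_real_derivative f t) (at t)"
    using global_antiderivative[OF f] by blast
  have gr: "F y - F x \<ge> b * (y - x)" if "x \<le> y" for x y
  proof -
    have "b * y - F y \<le> b * x - F x"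
    proof (rule DERIV_nonpos_imp_nonincreasing[OF that])
      fix t show "\<exists>d. ((\<lambda>t. b * t - F t) has_real_derivative d) (at t) \<and> d \<le> 0"
        using b(2)[of t] by (intro exI[of _ "b - f t"]) (auto intro!: derivative_eq_intros F)
    qed
    then show ?thesis by (simp add: algebra_simps)
  qed
  have inj: "inj F"
  proof (rule injI)
    fix x y assume e: "F x = F y"
    show "x = y"
      using gr[of x y] gr[of y x] e b(1) mult_pos_pos[of b "y - x"] mult_pos_pos[of b "x - y"]
      by linarith
  qed
  have contF: "isCont F x" for x
    using F DERIV_isCont by blast
  have surj: "\<exists>x. F x = y" for y
  proof -
    define N where "N = \<bar>y - F 0\<bar> / b"
    have N: "N \<ge> 0" "b * N = \<bar>y - F 0\<bar>"
      using b(1) by (auto simp: N_def)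
    have "F (- N) \<le> y" "y \<le> F N"
      using gr[of "-N" 0] gr[of 0 N] N by auto
    then show ?thesis
      using IVT[of F "-N" y N] contF N by auto
  qed
  define \<phi> where "\<phi> = inv F"
  have \<phi>: "F (\<phi> t) = t" "\<phi> (F t) = t" for t
    using surj[of t] inj unfolding \<phi>_def by (metis inv_f_f)+
  have "isCont \<phi> t" for t
    using isCont_inverse_function[where d=1 and x="\<phi> t" and g=\<phi> and f=F] \<phi> contF by simp
  moreover have "f x \<noteq> 0" for x using b(1) b(2)[of x] by linarith
  ultimately have "(\<phi> has_real_derivative inverse (f (\<phi> t))) (at t)" for t
    using DERIV_inverse_function[where f=F and g=\<phi> and x=t and D="f (\<phi> t)" and a="t - 1" and b="t + 1"] F \<phi> by auto
  then have "(\<phi> has_real_derivative 1 / f (\<phi> t)) (at t)" for t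
    by (simp add: inverse_eq_divide)
  then show thesis by (rule that)
qed

section \<open>The level curve parametrized through the distance to the origin\<close>

text \<open>Put \<open>R = x\<^sub>1\<^sup>2 + x\<^sub>2\<^sup>2\<close> and \<open>q = R - M\<close>. The equation \<open>h w x\<^sub>1 x\<^sub>2 = M\<close> says
  \<open>x\<^sub>2 = - q * sqrt (1 + w\<^sup>2 x\<^sub>1\<^sup>2)\<close>, and eliminating \<open>x\<^sub>2\<close> leaves
  \<open>x\<^sub>1\<^sup>2 (1 + w\<^sup>2 q\<^sup>2) + (q - 1 / 2)\<^sup>2 = (1 + 4 M) / 4\<close>. This is a circle in the variables
  \<open>x\<^sub>1 sqrt (1 + w\<^sup>2 q\<^sup>2)\<close> and \<open>q\<close>, and \<open>\<phi>\<close> is the angle on it: \<open>excess\<close> is \<open>q\<close>, \<open>flank\<close> is the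
  other coordinate, \<open>rsq\<close> is \<open>R\<close>, and \<open>(\<Xi>\<^sub>1, \<Xi>\<^sub>2)\<close> is the point of the level curve. Neither \<open>R\<close> nor
  \<open>q\<close> involves \<open>w\<close>, which later makes the dependence on \<open>w\<close> tractable.\<close>
definition excess :: "real \<Rightarrow> real \<Rightarrow> real" where
  "excess M \<phi> = 1 / 2 + sqrt (1 + 4 * M) / 2 * sin \<phi>"

definition flank :: "real \<Rightarrow> real \<Rightarrow> real" where
  "flank M \<phi> = sqrt (1 + 4 * M) / 2 * cos \<phi>"

definition rsq :: "real \<Rightarrow> real \<Rightarrow> real" where
  "rsq M \<phi> = M + excess M \<phi>"

definition excess_root :: "real \<Rightarrow> real \<Rightarrow> real \<Rightarrow> real" where
  "excess_root M w \<phi> = sqrt (1 + w\<^sup>2 * (excess M \<phi>)\<^sup>2)"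

definition rsq_root :: "real \<Rightarrow> real \<Rightarrow> real \<Rightarrow> real" where
  "rsq_root M w \<phi> = sqrt (1 + w\<^sup>2 * rsq M \<phi>)"

definition \<Xi>\<^sub>1 :: "real \<Rightarrow> real \<Rightarrow> real \<Rightarrow> real" where
  "\<Xi>\<^sub>1 M w \<phi> = flank M \<phi> / excess_root M w \<phi>"

definition \<Xi>\<^sub>2 :: "real \<Rightarrow> real \<Rightarrow> real \<Rightarrow> real" where
  "\<Xi>\<^sub>2 M w \<phi> = - (rsq_root M w \<phi> / excess_root M w \<phi>) * excess M \<phi>"

text \<open>The value that mean curvature one forces on the curvature of the profile curve.\<close>
definition curv :: "real \<Rightarrow> real \<Rightarrow> real \<Rightarrow> real" where
  "curv w x\<^sub>1 x\<^sub>2 = (- w\<^sup>2 * x\<^sub>2 + 2 * (1 + w\<^sup>2 * x\<^sub>1\<^sup>2) powr (3 / 2)) / (1 + w\<^sup>2 * (x\<^sub>1\<^sup>2 + x\<^sub>2\<^sup>2))"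

lemma f\<^sub>1_curv: "f\<^sub>1 w x y = 1 + curv w x y * y"
  by (simp add: f\<^sub>1_def curv_def)

lemma f\<^sub>2_curv: "f\<^sub>2 w x y = - (curv w x y * x)"
  by (simp add: f\<^sub>2_def curv_def field_simps minus_divide_left)

lemma powr_three_halves: "0 \<le> x \<Longrightarrow> x powr (3 / 2) = sqrt x ^ 3"
  by (cases "x = 0") (simp_all add: powr_half_sqrt[symmetric] powr_power)

lemma one_plus_square_pos: "0 < 1 + (w::real)\<^sup>2 * x\<^sup>2"
  by (intro add_pos_nonneg) auto

lemma curv_eq:
  "curv w x y = (2 * sqrt (1 + w\<^sup>2 * x\<^sup>2) ^ 3 - w\<^sup>2 * y) / (1 + w\<^sup>2 * (x\<^sup>2 + y\<^sup>2))"
  using one_plus_square_pos[of w x] by (simp add: curv_def powr_three_halves)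

lemma excess_root_pos: "0 < excess_root M w \<phi>" and excess_root_ge_1: "1 \<le> excess_root M w \<phi>"
  and excess_root_sq: "(excess_root M w \<phi>)\<^sup>2 = 1 + w\<^sup>2 * (excess M \<phi>)\<^sup>2"
  using one_plus_square_pos[of w "excess M \<phi>"] by (auto simp: excess_root_def)

lemma DERIV_excess [derivative_intros]: "(excess M has_real_derivative flank M \<phi>) (at \<phi>)"
  unfolding excess_def[abs_def] flank_def by (auto intro!: derivative_eq_intros)

lemma DERIV_rsq [derivative_intros]: "(rsq M has_real_derivative flank M \<phi>) (at \<phi>)"
  unfolding rsq_def[abs_def] by (auto intro!: derivative_eq_intros)

lemma DERIV_flank [derivative_intros]: "(flank M has_real_derivative 1 / 2 - excess M \<phi>) (at \<phi>)"
  unfolding excess_def flank_def[abs_def] by (auto intro!: derivative_eq_intros)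

lemma excess_periodic: "excess M (\<phi> + 2 * pi) = excess M \<phi>"
  and flank_periodic: "flank M (\<phi> + 2 * pi) = flank M \<phi>"
  and rsq_periodic: "rsq M (\<phi> + 2 * pi) = rsq M \<phi>"
  by (simp_all add: excess_def flank_def rsq_def)

lemma DERIV_excess_root [derivative_intros]:
  "(excess_root M w has_real_derivative w\<^sup>2 * excess M \<phi> * flank M \<phi> / excess_root M w \<phi>) (at \<phi>)"
  using excess_root_pos[of M w \<phi>] one_plus_square_pos[of w "excess M \<phi>"]
  unfolding excess_root_def[abs_def]
  by (auto intro!: derivative_eq_intros simp: field_simps power2_eq_square)

lemma continuous_on_factors [continuous_intros]:
  fixes f :: "'a::t2_space \<Rightarrow> real"
  assumes "continuous_on S f"
  shows "continuous_on S (\<lambda>x. excess M (f x))" "continuous_on S (\<lambda>x. flank M (f x))"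
    "continuous_on S (\<lambda>x. rsq M (f x))" "continuous_on S (\<lambda>x. excess_root M w (f x))"
    "continuous_on S (\<lambda>x. rsq_root M w (f x))"
  unfolding excess_def flank_def rsq_def excess_root_def rsq_root_def
  by (auto intro!: continuous_intros assms)

text \<open>The level equation solves for \<open>y\<close>; the other two facts are what this substitution gives for
  the curvature and for the relation between \<open>x\<close> and \<open>q\<close>.\<close>
lemma
  fixes x y w M :: real
  assumes h: "h w x y = M"
  defines "q \<equiv> x\<^sup>2 + y\<^sup>2 - M" and "d \<equiv> sqrt (1 + w\<^sup>2 * x\<^sup>2)"
  shows level_point_y: "y = - d * q"
    and level_point_curv: "curv w x y = (2 * d\<^sup>2 + w\<^sup>2 * q) / (d * (1 + w\<^sup>2 * q\<^sup>2))"
    and level_point_circle: "x\<^sup>2 * (1 + w\<^sup>2 * q\<^sup>2) + (q - 1 / 2)\<^sup>2 = (1 + 4 * M) / 4"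
proof -
  have d: "d > 0" "d\<^sup>2 = 1 + w\<^sup>2 * x\<^sup>2"
    using one_plus_square_pos[of w x] by (auto simp: d_def)
  have "q + y / d = 0"
    using h by (simp add: h_def q_def d_def)
  then show y: "y = - d * q"
    using d by (simp add: field_simps)
  have y2: "y\<^sup>2 = d\<^sup>2 * q\<^sup>2" unfolding y by (simp add: power_mult_distrib)
  have gram: "1 + w\<^sup>2 * (x\<^sup>2 + y\<^sup>2) = d\<^sup>2 * (1 + w\<^sup>2 * q\<^sup>2)"
    unfolding y2 d(2) by (simp add: algebra_simps)
  have "curv w x y = (2 * d ^ 3 + w\<^sup>2 * d * q) / (d\<^sup>2 * (1 + w\<^sup>2 * q\<^sup>2))"
    unfolding curv_eq gram d_def[symmetric] by (simp add: y)
  also have "\<dots> = (d * (2 * d\<^sup>2 + w\<^sup>2 * q)) / (d * (d * (1 + w\<^sup>2 * q\<^sup>2)))"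
    by (simp add: algebra_simps power2_eq_square power3_eq_cube)
  finally show "curv w x y = (2 * d\<^sup>2 + w\<^sup>2 * q) / (d * (1 + w\<^sup>2 * q\<^sup>2))"
    using d by simp
  have "x\<^sup>2 * (1 + w\<^sup>2 * q\<^sup>2) + q\<^sup>2 = x\<^sup>2 + y\<^sup>2"
    unfolding y2 d(2) by (simp add: algebra_simps)
  then show "x\<^sup>2 * (1 + w\<^sup>2 * q\<^sup>2) + (q - 1 / 2)\<^sup>2 = (1 + 4 * M) / 4"
    unfolding q_def by (simp add: power2_eq_square algebra_simps)
qed

locale twizzler_parameters =
  fixes M w :: real
  assumes M: "- 1 / 4 < M" and w: "0 < w"
begin

lemma amplitude_pos: "0 < sqrt (1 + 4 * M)" "(sqrt (1 + 4 * M))\<^sup>2 = 1 + 4 * M"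
  using M by auto

lemma flank_sq: "(flank M \<phi>)\<^sup>2 + (excess M \<phi>)\<^sup>2 = rsq M \<phi>"
proof -
  define a where "a = sqrt (1 + 4 * M)"
  have "a\<^sup>2 = 1 + 4 * M" unfolding a_def by (rule amplitude_pos)
  moreover have "(a / 2 * cos \<phi>)\<^sup>2 + (1 / 2 + a / 2 * sin \<phi>)\<^sup>2
      = 1 / 4 + a\<^sup>2 / 4 * ((sin \<phi>)\<^sup>2 + (cos \<phi>)\<^sup>2) + a / 2 * sin \<phi>"
    by (simp add: power2_eq_square algebra_simps del: sin_cos_squared_add2 sin_cos_squared_add3)
  ultimately show ?thesis
    unfolding flank_def excess_def rsq_def a_def[symmetric] by (simp add: field_simps)
qed

lemma rsq_nonneg: "0 \<le> rsq M \<phi>"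
  unfolding flank_sq[symmetric] by simp

lemma rsq_root_pos: "0 < rsq_root M w \<phi>" and rsq_root_sq: "(rsq_root M w \<phi>)\<^sup>2 = 1 + w\<^sup>2 * rsq M \<phi>"
proof -
  have "0 < 1 + w\<^sup>2 * rsq M \<phi>" using rsq_nonneg by (intro add_pos_nonneg) auto
  then show "0 < rsq_root M w \<phi>" "(rsq_root M w \<phi>)\<^sup>2 = 1 + w\<^sup>2 * rsq M \<phi>"
    by (simp_all add: rsq_root_def)
qed

lemma DERIV_rsq_root:
  "(rsq_root M w has_real_derivative w\<^sup>2 * flank M \<phi> / (2 * rsq_root M w \<phi>)) (at \<phi>)"
  using rsq_root_pos[of \<phi>] unfolding rsq_root_def[abs_def]
  by (auto intro!: derivative_eq_intros simp: field_simps)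

lemma \<Xi>_root: "sqrt (1 + w\<^sup>2 * (\<Xi>\<^sub>1 M w \<phi>)\<^sup>2) = rsq_root M w \<phi> / excess_root M w \<phi>"
proof (rule real_sqrt_unique)
  show "(rsq_root M w \<phi> / excess_root M w \<phi>)\<^sup>2 = 1 + w\<^sup>2 * (\<Xi>\<^sub>1 M w \<phi>)\<^sup>2"
  proof -
    have "(rsq_root M w \<phi>)\<^sup>2 = (excess_root M w \<phi>)\<^sup>2 + w\<^sup>2 * (flank M \<phi>)\<^sup>2"
      unfolding rsq_root_sq excess_root_sq flank_sq[symmetric] by (simp add: algebra_simps)
    then show ?thesis
      using excess_root_pos[of M w \<phi>] by (simp add: \<Xi>\<^sub>1_def power_divide add_divide_distrib)
  qed
  show "0 \<le> rsq_root M w \<phi> / excess_root M w \<phi>"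
    using excess_root_pos[of M w \<phi>] rsq_root_pos[of \<phi>] by simp
qed

lemma \<Xi>_norm: "(\<Xi>\<^sub>1 M w \<phi>)\<^sup>2 + (\<Xi>\<^sub>2 M w \<phi>)\<^sup>2 = rsq M \<phi>"
proof -
  have "(\<Xi>\<^sub>1 M w \<phi>)\<^sup>2 + (\<Xi>\<^sub>2 M w \<phi>)\<^sup>2
      = ((flank M \<phi>)\<^sup>2 + (rsq_root M w \<phi>)\<^sup>2 * (excess M \<phi>)\<^sup>2) / (excess_root M w \<phi>)\<^sup>2"
    unfolding \<Xi>\<^sub>1_def \<Xi>\<^sub>2_def by (simp add: power_divide power_mult_distrib add_divide_distrib)
  also have "\<dots> = (rsq M \<phi> * (excess_root M w \<phi>)\<^sup>2) / (excess_root M w \<phi>)\<^sup>2"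
    unfolding rsq_root_sq excess_root_sq flank_sq[of \<phi>, symmetric] by (simp add: algebra_simps)
  finally show ?thesis using excess_root_pos[of M w \<phi>] by simp
qed

lemma \<Xi>_level: "h w (\<Xi>\<^sub>1 M w \<phi>) (\<Xi>\<^sub>2 M w \<phi>) = M"
  using excess_root_pos[of M w \<phi>] rsq_root_pos[of \<phi>]
  unfolding h_def \<Xi>_root \<Xi>_norm by (simp add: \<Xi>\<^sub>2_def rsq_def)

text \<open>The angle by which the tangent turns per unit of \<open>\<phi>\<close>; the factor between arc length and \<open>\<phi>\<close> is
  \<open>excess_root M w \<phi> / 2\<close>.\<close>
definition turn_rate :: "real \<Rightarrow> real" where
  "turn_rate \<phi> = rsq_root M w \<phi> / (excess_root M w \<phi>)\<^sup>2 + w\<^sup>2 * excess M \<phi> / (2 * rsq_root M w \<phi>)"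

lemma curv_\<Xi>: "curv w (\<Xi>\<^sub>1 M w \<phi>) (\<Xi>\<^sub>2 M w \<phi>) * (excess_root M w \<phi> / 2) = turn_rate \<phi>"
proof -
  have q: "(\<Xi>\<^sub>1 M w \<phi>)\<^sup>2 + (\<Xi>\<^sub>2 M w \<phi>)\<^sup>2 - M = excess M \<phi>"
    unfolding \<Xi>_norm by (simp add: rsq_def)
  show ?thesis
    unfolding level_point_curv[OF \<Xi>_level] \<Xi>_root q excess_root_sq[symmetric] turn_rate_def
    using excess_root_pos[of M w \<phi>] rsq_root_pos[of \<phi>] by (simp add: field_simps power2_eq_square)
qed

lemma DERIV_\<Xi>:
  shows "(\<Xi>\<^sub>1 M w has_real_derivative
           excess_root M w \<phi> / 2 * f\<^sub>1 w (\<Xi>\<^sub>1 M w \<phi>) (\<Xi>\<^sub>2 M w \<phi>)) (at \<phi>)" (is ?A)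
    and "(\<Xi>\<^sub>2 M w has_real_derivative
           excess_root M w \<phi> / 2 * f\<^sub>2 w (\<Xi>\<^sub>1 M w \<phi>) (\<Xi>\<^sub>2 M w \<phi>)) (at \<phi>)" (is ?B)
proof -
  let ?P = "excess_root M w \<phi>" and ?g = "rsq_root M w \<phi>" and ?q = "excess M \<phi>" and ?X = "flank M \<phi>"
  note pos = excess_root_pos[of M w \<phi>] rsq_root_pos[of \<phi>]
  have X2: "?X\<^sup>2 = M + ?q - ?q\<^sup>2" using flank_sq[of \<phi>] by (simp add: rsq_def)
  have "(\<Xi>\<^sub>1 M w has_real_derivative ((1 / 2 - ?q) * ?P - ?X * (w\<^sup>2 * ?q * ?X / ?P)) / (?P * ?P)) (at \<phi>)"
    unfolding \<Xi>\<^sub>1_def[abs_def] using pos by (auto intro!: derivative_eq_intros)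
  moreover have "((1 / 2 - ?q) * ?P - ?X * (w\<^sup>2 * ?q * ?X / ?P)) / (?P * ?P)
      = ?P / 2 + turn_rate \<phi> * \<Xi>\<^sub>2 M w \<phi>"
  proof -
    have "((1 / 2 - ?q) * ?P\<^sup>2 - w\<^sup>2 * ?q * ?X\<^sup>2) = ?P\<^sup>2 * ?P\<^sup>2 / 2 - (?g\<^sup>2 + w\<^sup>2 * ?q / 2 * ?P\<^sup>2) * ?q"
      unfolding X2 excess_root_sq rsq_root_sq rsq_def by (simp add: field_simps power2_eq_square)
    then have "((1 / 2 - ?q) * ?P\<^sup>2 - w\<^sup>2 * ?q * ?X\<^sup>2) / ?P ^ 3
        = (?P\<^sup>2 * ?P\<^sup>2 / 2 - (?g\<^sup>2 + w\<^sup>2 * ?q / 2 * ?P\<^sup>2) * ?q) / ?P ^ 3"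
      by simp
    moreover have "((1 / 2 - ?q) * ?P - ?X * (w\<^sup>2 * ?q * ?X / ?P)) / (?P * ?P)
        = ((1 / 2 - ?q) * ?P\<^sup>2 - w\<^sup>2 * ?q * ?X\<^sup>2) / ?P ^ 3"
      using pos by (simp add: field_simps power2_eq_square power3_eq_cube)
    moreover have "(?P\<^sup>2 * ?P\<^sup>2 / 2 - (?g\<^sup>2 + w\<^sup>2 * ?q / 2 * ?P\<^sup>2) * ?q) / ?P ^ 3
        = ?P / 2 + turn_rate \<phi> * \<Xi>\<^sub>2 M w \<phi>"
      using pos unfolding turn_rate_def \<Xi>\<^sub>2_def
      by (simp add: field_simps power2_eq_square power3_eq_cube)
    ultimately show ?thesis by argo
  qed
  ultimately show ?A
    unfolding f\<^sub>1_curv curv_\<Xi>[symmetric] by (simp add: algebra_simps)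
  have "(\<Xi>\<^sub>2 M w has_real_derivative
      - (((w\<^sup>2 * ?X / (2 * ?g)) * ?P - ?g * (w\<^sup>2 * ?q * ?X / ?P)) / (?P * ?P)) * ?q + ?X * - (?g / ?P)) (at \<phi>)"
    unfolding \<Xi>\<^sub>2_def[abs_def] using pos
    by (intro DERIV_mult DERIV_minus DERIV_divide DERIV_rsq_root DERIV_excess_root DERIV_excess) auto
  moreover have "- (((w\<^sup>2 * ?X / (2 * ?g)) * ?P - ?g * (w\<^sup>2 * ?q * ?X / ?P)) / (?P * ?P)) * ?q + ?X * - (?g / ?P)
      = - (turn_rate \<phi> * \<Xi>\<^sub>1 M w \<phi>)"
  proof -
    have "((w\<^sup>2 * ?X / (2 * ?g)) * ?P - ?g * (w\<^sup>2 * ?q * ?X / ?P)) / (?P * ?P) * ?q + ?g / ?P * ?X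
      = ?X / ?P * (w\<^sup>2 * ?q / (2 * ?g) + ?g * (?P\<^sup>2 - w\<^sup>2 * ?q\<^sup>2) / ?P\<^sup>2)"
      using pos by (simp add: field_simps power2_eq_square)
    moreover have "?P\<^sup>2 - w\<^sup>2 * ?q\<^sup>2 = 1" by (simp add: excess_root_sq)
    ultimately show ?thesis
      by (simp add: turn_rate_def \<Xi>\<^sub>1_def mult.commute add.commute)
  qed
  ultimately have "(\<Xi>\<^sub>2 M w has_real_derivative - (turn_rate \<phi> * \<Xi>\<^sub>1 M w \<phi>)) (at \<phi>)"
    by (simp only:)
  then show ?B
    unfolding f\<^sub>2_curv curv_\<Xi>[symmetric] by (simp add: algebra_simps)
qed

lemma \<Xi>_eqI:
  assumes h: "h w x y = M" and e: "excess M \<phi> = x\<^sup>2 + y\<^sup>2 - M" and X: "flank M \<phi> = x * excess_root M w \<phi>"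
  shows "x = \<Xi>\<^sub>1 M w \<phi>" "y = \<Xi>\<^sub>2 M w \<phi>"
proof -
  note P = excess_root_pos[of M w \<phi>]
  show x: "x = \<Xi>\<^sub>1 M w \<phi>" using X P by (simp add: \<Xi>\<^sub>1_def)
  show "y = \<Xi>\<^sub>2 M w \<phi>"
    using level_point_y[OF h] unfolding e[symmetric] \<Xi>\<^sub>2_def \<Xi>_root[symmetric] x[symmetric] .
qed

lemma level_angle_circle:
  assumes h: "h w x y = M"
  shows "(x * sqrt (1 + w\<^sup>2 * (x\<^sup>2 + y\<^sup>2 - M)\<^sup>2) / (sqrt (1 + 4 * M) / 2))\<^sup>2
       + ((x\<^sup>2 + y\<^sup>2 - M - 1 / 2) / (sqrt (1 + 4 * M) / 2))\<^sup>2 = 1"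
proof -
  define q where "q = x\<^sup>2 + y\<^sup>2 - M"
  define P where "P = sqrt (1 + w\<^sup>2 * q\<^sup>2)"
  define a where "a = sqrt (1 + 4 * M) / 2"
  have a: "a \<noteq> 0" "a\<^sup>2 = (1 + 4 * M) / 4"
    using amplitude_pos by (simp_all add: a_def power_divide)
  have "P\<^sup>2 = 1 + w\<^sup>2 * q\<^sup>2"
    using one_plus_square_pos[of w q] by (simp add: P_def)
  then have "x\<^sup>2 * P\<^sup>2 + (q - 1 / 2)\<^sup>2 = a\<^sup>2"
    using level_point_circle[OF h] unfolding q_def[symmetric] a by simp
  then show ?thesis
    unfolding q_def[symmetric] P_def[symmetric] a_def[symmetric]
    using a(1) by (simp add: power_divide power_mult_distrib add_divide_distrib[symmetric])
qed

lemma level_surj: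
  assumes h: "h w x y = M"
  obtains \<phi> where "0 \<le> \<phi>" "\<phi> < 2 * pi" "x = \<Xi>\<^sub>1 M w \<phi>" "y = \<Xi>\<^sub>2 M w \<phi>"
proof -
  from sincos_total_2pi[OF level_angle_circle[OF h]] obtain \<phi> where \<phi>: "0 \<le> \<phi>" "\<phi> < 2 * pi"
    "x * sqrt (1 + w\<^sup>2 * (x\<^sup>2 + y\<^sup>2 - M)\<^sup>2) / (sqrt (1 + 4 * M) / 2) = cos \<phi>"
    "(x\<^sup>2 + y\<^sup>2 - M - 1 / 2) / (sqrt (1 + 4 * M) / 2) = sin \<phi>" .
  have e: "excess M \<phi> = x\<^sup>2 + y\<^sup>2 - M"
    using \<phi>(4) amplitude_pos by (simp add: excess_def field_simps)
  have X: "flank M \<phi> = x * excess_root M w \<phi>"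
    using \<phi>(3) amplitude_pos by (simp add: flank_def excess_root_def e field_simps)
  show thesis using that \<phi>(1,2) \<Xi>_eqI[OF h e X] by blast
qed

lemma \<Xi>_periodic: "\<Xi>\<^sub>1 M w (\<phi> + 2 * pi) = \<Xi>\<^sub>1 M w \<phi>" "\<Xi>\<^sub>2 M w (\<phi> + 2 * pi) = \<Xi>\<^sub>2 M w \<phi>"
  by (simp_all add: \<Xi>\<^sub>1_def \<Xi>\<^sub>2_def flank_periodic excess_periodic rsq_periodic excess_root_def rsq_root_def)

lemma \<Xi>_eq_iff:
  "\<Xi>\<^sub>1 M w \<phi> = \<Xi>\<^sub>1 M w \<phi>' \<and> \<Xi>\<^sub>2 M w \<phi> = \<Xi>\<^sub>2 M w \<phi>' \<longleftrightarrow> (\<exists>n::int. \<phi> = \<phi>' + 2 * pi * n)"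
proof
  assume e: "\<Xi>\<^sub>1 M w \<phi> = \<Xi>\<^sub>1 M w \<phi>' \<and> \<Xi>\<^sub>2 M w \<phi> = \<Xi>\<^sub>2 M w \<phi>'"
  then have "rsq M \<phi> = rsq M \<phi>'" by (simp flip: \<Xi>_norm)
  then have q: "excess M \<phi> = excess M \<phi>'" by (simp add: rsq_def)
  then have "flank M \<phi> = flank M \<phi>'"
    using e excess_root_pos[of M w \<phi>] by (simp add: \<Xi>\<^sub>1_def excess_root_def)
  with q have "sin \<phi> = sin \<phi>' \<and> cos \<phi> = cos \<phi>'"
    using amplitude_pos by (simp add: excess_def flank_def)
  then show "\<exists>n::int. \<phi> = \<phi>' + 2 * pi * n" 
    unfolding sin_cos_eq_iff by (auto simp: mult.commute mult.left_commute)
next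
  assume "\<exists>n::int. \<phi> = \<phi>' + 2 * pi * n"
  then have "sin \<phi> = sin \<phi>'" "cos \<phi> = cos \<phi>'"
    using sin_cos_eq_iff[of \<phi> \<phi>'] by (auto simp: mult.commute mult.left_commute)
  then show "\<Xi>\<^sub>1 M w \<phi> = \<Xi>\<^sub>1 M w \<phi>' \<and> \<Xi>\<^sub>2 M w \<phi> = \<Xi>\<^sub>2 M w \<phi>'"
    by (simp add: \<Xi>\<^sub>1_def \<Xi>\<^sub>2_def flank_def excess_def rsq_def excess_root_def rsq_root_def)
qed

text \<open>The rate \<open>r\<close> is left free so that the lemma serves both for arc length (\<open>r = 1\<close>) and for
  parametrizations that run along the curve backwards with variable speed. The two coordinates of
  the circle above satisfy the equations of a rotation with angular speed \<open>2 r / sqrt (1 + w\<^sup>2 q\<^sup>2)\<close>,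
  so that \<open>angle_lift\<close> applies.\<close>
lemma level_curve_lift:
  fixes x y r :: "real \<Rightarrow> real"
  assumes h: "\<And>t. h w (x t) (y t) = M" and r: "continuous_on UNIV r"
    and dx: "\<And>t. (x has_real_derivative r t * f\<^sub>1 w (x t) (y t)) (at t)"
    and dy: "\<And>t. (y has_real_derivative r t * f\<^sub>2 w (x t) (y t)) (at t)"
  obtains \<phi> where "\<And>t. x t = \<Xi>\<^sub>1 M w (\<phi> t)" "\<And>t. y t = \<Xi>\<^sub>2 M w (\<phi> t)"
    "\<And>t. (\<phi> has_real_derivative 2 * r t / excess_root M w (\<phi> t)) (at t)"
proof -
  define a where "a = sqrt (1 + 4 * M) / 2"
  define q where "q t = (x t)\<^sup>2 + (y t)\<^sup>2 - M" for t
  define P where "P t = sqrt (1 + w\<^sup>2 * (q t)\<^sup>2)" for t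
  define d where "d t = sqrt (1 + w\<^sup>2 * (x t)\<^sup>2)" for t
  define c where "c t = x t * P t / a" for t
  define s where "s t = (q t - 1 / 2) / a" for t
  have a: "a > 0" using amplitude_pos by (simp add: a_def)
  have P: "P t > 0" "(P t)\<^sup>2 = 1 + w\<^sup>2 * (q t)\<^sup>2" for t
    using one_plus_square_pos[of w "q t"] by (auto simp: P_def)
  have d: "d t > 0" "(d t)\<^sup>2 = 1 + w\<^sup>2 * (x t)\<^sup>2" for t
    using one_plus_square_pos[of w "x t"] by (auto simp: d_def)
  have dq: "(q has_real_derivative 2 * r t * x t) (at t)" for t
  proof -
    have "(q has_real_derivative 2 * x t * (r t * f\<^sub>1 w (x t) (y t)) + 2 * y t * (r t * f\<^sub>2 w (x t) (y t))) (at t)"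
      unfolding q_def[abs_def] by (auto intro!: derivative_eq_intros dx dy)
    then show ?thesis by (simp add: f\<^sub>1_curv f\<^sub>2_curv algebra_simps)
  qed
  have dP: "(P has_real_derivative w\<^sup>2 * q t * (2 * r t * x t) / P t) (at t)" for t
    unfolding P_def[abs_def] using one_plus_square_pos[of w "q t"]
    by (auto intro!: derivative_eq_intros dq simp: field_simps)
  have ds: "(s has_real_derivative c t * (2 * r t / P t)) (at t)" for t
    unfolding s_def[abs_def] c_def using a P(1)[of t]
    by (auto intro!: derivative_eq_intros dq)
  have key: "f\<^sub>1 w (x t) (y t) * (P t)\<^sup>2 + 2 * w\<^sup>2 * (x t)\<^sup>2 * q t = 1 - 2 * q t" for t
  proof -
    have y: "y t = - d t * q t"
      unfolding d_def q_def by (rule level_point_y[OF h])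
    have "curv w (x t) (y t) = (2 * (d t)\<^sup>2 + w\<^sup>2 * q t) / (d t * (P t)\<^sup>2)"
      unfolding P d_def q_def by (rule level_point_curv[OF h])
    then have "curv w (x t) (y t) * y t * (P t)\<^sup>2 = - (q t * (2 * (d t)\<^sup>2 + w\<^sup>2 * q t))"
      using d(1)[of t] P(1)[of t] y by simp
    then have "f\<^sub>1 w (x t) (y t) * (P t)\<^sup>2 = (P t)\<^sup>2 - q t * (2 * (d t)\<^sup>2 + w\<^sup>2 * q t)"
      by (simp add: f\<^sub>1_curv distrib_right)
    then show ?thesis
      unfolding P d by (simp add: algebra_simps power2_eq_square)
  qed
  have dc: "(c has_real_derivative - s t * (2 * r t / P t)) (at t)" for t
  proof -
    have "(c has_real_derivative (r t * f\<^sub>1 w (x t) (y t) * P t + w\<^sup>2 * q t * (2 * r t * x t) / P t * x t) / a) (at t)"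
      unfolding c_def[abs_def] using a by (auto intro!: derivative_eq_intros dx dP)
    moreover have "(r t * f\<^sub>1 w (x t) (y t) * P t + w\<^sup>2 * q t * (2 * r t * x t) / P t * x t)
        = r t / P t * (f\<^sub>1 w (x t) (y t) * (P t)\<^sup>2 + 2 * w\<^sup>2 * (x t)\<^sup>2 * q t)"
      using P(1)[of t] by (simp add: field_simps power2_eq_square)
    moreover have "r t / P t * (1 - 2 * q t) / a = - s t * (2 * r t / P t)"
      unfolding s_def using a P(1)[of t] by (simp add: field_simps)
    ultimately show ?thesis
      by (simp only: key)
  qed
  have cont: "continuous_on UNIV (\<lambda>t. 2 * r t / P t)"
    using r P(1) DERIV_isCont[OF dP]
    by (intro continuous_intros) (auto intro: continuous_at_imp_continuous_on simp: less_imp_neq[THEN not_sym])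
  have unit: "(c t)\<^sup>2 + (s t)\<^sup>2 = 1" for t
    using level_angle_circle[OF h[of t]] by (simp add: c_def s_def P_def q_def a_def)
  from angle_lift[OF dc ds cont unit] obtain \<phi> where
    \<phi>: "\<And>t. (\<phi> has_real_derivative 2 * r t / P t) (at t)" "\<And>t. c t = cos (\<phi> t)" "\<And>t. s t = sin (\<phi> t)"
    by blast
  have e: "excess M (\<phi> t) = q t" for t
    unfolding excess_def a_def[symmetric] using \<phi>(3)[of t] a by (simp add: s_def field_simps)
  then have p: "excess_root M w (\<phi> t) = P t" for t by (simp add: excess_root_def P_def)
  have X: "flank M (\<phi> t) = x t * excess_root M w (\<phi> t)" for t
    unfolding flank_def a_def[symmetric] using \<phi>(2)[of t] a by (simp add: c_def p field_simps)
  show thesis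
  proof (rule that)
    show "x t = \<Xi>\<^sub>1 M w (\<phi> t)" "y t = \<Xi>\<^sub>2 M w (\<phi> t)" for t
      using \<Xi>_eqI[OF h[of t] _ X] e by (simp_all add: q_def)
    show "(\<phi> has_real_derivative 2 * r t / excess_root M w (\<phi> t)) (at t)" for t
      using \<phi>(1) by (simp add: p)
  qed
qed

end

section \<open>The turning of the tangent along a fundamental piece\<close>

text \<open>The integrand is not the rate of turning itself but a simplification of it with the same
  integral over a period.\<close>
definition turning :: "real \<Rightarrow> real \<Rightarrow> real" where
  "turning M w = integral {0..2 * pi} (\<lambda>\<phi>. 1 + w\<^sup>2 * excess M \<phi> / (2 * (1 + rsq_root M w \<phi>)))"

context twizzler_parameters begin

text \<open>The arctangent is the angle between the vectors \<open>(flank, - q)\<close> and \<open>(flank, - g q)\<close> with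
  \<open>g = rsq_root M w \<phi>\<close>, that is, between the directions of \<open>(\<Xi>\<^sub>1, \<Xi>\<^sub>2)\<close> for \<open>w = 0\<close> and for the given
  \<open>w\<close>. The tangent turns as the position vector does, minus the turning of \<open>(\<Xi>\<^sub>1, \<Xi>\<^sub>2)\<close>; the
  polar angle of the position vector contributes \<open>q g / (2 R)\<close> per unit of \<open>\<phi>\<close>, and comparing with
  \<open>w = 0\<close>, where the tangent turns at rate one, leaves
  \<open>1 + q (g - 1) / (2 R) = 1 + w\<^sup>2 q / (2 (1 + g))\<close>. In the formula for the arctangent a factor \<open>R\<close> has
  been cancelled between the cross and the dot product of the two vectors, so that it stays
  meaningful where the level curve of \<open>M = 0\<close> passes through the origin.\<close>
lemma DERIV_\<Xi>_angle:
  "((\<lambda>\<phi>. arctan (w\<^sup>2 * flank M \<phi> * excess M \<phi> / (1 + rsq_root M w \<phi> + w\<^sup>2 * (excess M \<phi>)\<^sup>2)))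
     has_real_derivative
     turn_rate \<phi> - (1 + w\<^sup>2 * excess M \<phi> / (2 * (1 + rsq_root M w \<phi>)))) (at \<phi>)"
proof -
  let ?P = "excess_root M w \<phi>" and ?g = "rsq_root M w \<phi>" and ?q = "excess M \<phi>" and ?X = "flank M \<phi>"
    and ?W = "w\<^sup>2"
  define N where "N = ?W * ?X * ?q"
  define E where "E = 1 + ?g + ?W * ?q\<^sup>2"
  define N' where "N' = ?W * (1 / 2 - ?q) * ?q + ?X * (?W * ?X)"
  define E' where "E' = ?W * ?X / (2 * ?g) + ?W * (2 * ?q * ?X)"
  have g: "?g > 0" by (rule rsq_root_pos)
  have E: "E > 0" unfolding E_def using g by (intro add_pos_nonneg) auto
  have WR: "?W * rsq M \<phi> = ?g\<^sup>2 - 1" by (simp add: rsq_root_sq)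
  have WX: "?W * ?X\<^sup>2 = ?g\<^sup>2 - 1 - ?W * ?q\<^sup>2"
    unfolding WR[symmetric] flank_sq[of \<phi>, symmetric] by (simp add: algebra_simps)
  have num: "(N' * E - N * E') * (2 * ?g)
      = (?W * ?q / 2 - 2 * ?W * ?q\<^sup>2 + ?g\<^sup>2 - 1) * (1 + ?g + ?W * ?q\<^sup>2) * (2 * ?g)
        - (?g\<^sup>2 - 1 - ?W * ?q\<^sup>2) * ?q * (?W + 4 * ?g * ?W * ?q)"
  proof -
    have "N' = ?W * ?q / 2 - ?W * ?q\<^sup>2 + ?W * ?X\<^sup>2"
      unfolding N'_def by (simp add: algebra_simps power2_eq_square)
    then have N': "N' = ?W * ?q / 2 - 2 * ?W * ?q\<^sup>2 + ?g\<^sup>2 - 1" unfolding WX by simp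
    have "N * E' * (2 * ?g) = (?W * ?X\<^sup>2) * ?q * (?W + 4 * ?g * ?W * ?q)"
      unfolding N_def E'_def using g by (simp add: field_simps power2_eq_square)
    then have NE: "N * E' * (2 * ?g) = (?g\<^sup>2 - 1 - ?W * ?q\<^sup>2) * ?q * (?W + 4 * ?g * ?W * ?q)"
      unfolding WX .
    show ?thesis
      unfolding left_diff_distrib NE N' E_def ..
  qed
  have den: "E\<^sup>2 + N\<^sup>2 = (1 + ?g)\<^sup>2 * ?P\<^sup>2"
  proof -
    have "N\<^sup>2 = ?W * ?q\<^sup>2 * (?W * ?X\<^sup>2)" unfolding N_def by (simp add: power2_eq_square)
    then show ?thesis
      unfolding E_def WX excess_root_sq by (simp add: power2_eq_square algebra_simps)
  qed
  have arith: "(W * q / 2 - 2 * W * q\<^sup>2 + g\<^sup>2 - 1) * (1 + g + W * q\<^sup>2) * (2 * g)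
        - (g\<^sup>2 - 1 - W * q\<^sup>2) * q * (W + 4 * g * W * q)
     = (1 + g)\<^sup>2 * (2 * g\<^sup>2 + W * q * (1 + W * q\<^sup>2) - 2 * g * (1 + W * q\<^sup>2)) - g * W * q * (1 + g) * (1 + W * q\<^sup>2)"
    for W q g :: real
    by (simp add: field_simps power2_eq_square)
  have pos: "1 + ?g > 0" "?P > 0" using g excess_root_pos by (auto intro: add_pos_pos)
  have D: "((\<lambda>\<phi>. arctan (w\<^sup>2 * flank M \<phi> * excess M \<phi> / (1 + rsq_root M w \<phi> + w\<^sup>2 * (excess M \<phi>)\<^sup>2)))
     has_real_derivative inverse (1 + (N / E)\<^sup>2) * ((N' * E - N * E') / (E * E))) (at \<phi>)"
  proof -
    have dN: "((\<lambda>\<phi>. w\<^sup>2 * flank M \<phi> * excess M \<phi>) has_real_derivative N') (at \<phi>)"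
      unfolding N'_def by (auto intro!: derivative_eq_intros simp: algebra_simps)
    have dE: "((\<lambda>\<phi>. 1 + rsq_root M w \<phi> + w\<^sup>2 * (excess M \<phi>)\<^sup>2) has_real_derivative E') (at \<phi>)"
      unfolding E'_def by (auto intro!: derivative_eq_intros DERIV_rsq_root simp: algebra_simps)
    show ?thesis
      unfolding N_def E_def
      by (rule DERIV_chain2[OF DERIV_arctan DERIV_divide[OF dN dE]]) (use E in \<open>simp add: E_def\<close>)
  qed
  have "inverse (1 + (N / E)\<^sup>2) * ((N' * E - N * E') / (E * E))
      = (N' * E - N * E') * (2 * ?g) / ((E\<^sup>2 + N\<^sup>2) * (2 * ?g))"
  proof -
    have "1 + (N / E)\<^sup>2 = (E\<^sup>2 + N\<^sup>2) / (E * E)"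
      using E by (simp add: field_simps power2_eq_square)
    then show ?thesis using E g by simp
  qed
  also have "\<dots> = ((1 + ?g)\<^sup>2 * (2 * ?g\<^sup>2 + ?W * ?q * ?P\<^sup>2 - 2 * ?g * ?P\<^sup>2) - ?g * ?W * ?q * (1 + ?g) * ?P\<^sup>2)
      / ((1 + ?g)\<^sup>2 * ?P\<^sup>2 * (2 * ?g))"
    unfolding num den arith excess_root_sq ..
  also have "\<dots> = (1 + ?g)\<^sup>2 * (2 * ?g\<^sup>2 + ?W * ?q * ?P\<^sup>2 - 2 * ?g * ?P\<^sup>2) / ((1 + ?g)\<^sup>2 * ?P\<^sup>2 * (2 * ?g))
      - ?g * ?W * ?q * (1 + ?g) * ?P\<^sup>2 / ((1 + ?g)\<^sup>2 * ?P\<^sup>2 * (2 * ?g))"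
    by (rule diff_divide_distrib)
  also have "(1 + ?g)\<^sup>2 * (2 * ?g\<^sup>2 + ?W * ?q * ?P\<^sup>2 - 2 * ?g * ?P\<^sup>2) / ((1 + ?g)\<^sup>2 * ?P\<^sup>2 * (2 * ?g)) = turn_rate \<phi> - 1"
    unfolding turn_rate_def using pos g by (simp add: divide_simps) (simp add: algebra_simps power2_eq_square)
  also have "?g * ?W * ?q * (1 + ?g) * ?P\<^sup>2 / ((1 + ?g)\<^sup>2 * ?P\<^sup>2 * (2 * ?g)) = ?W * ?q / (2 * (1 + ?g))"
  proof -
    have "?g * ?W * ?q * (1 + ?g) * ?P\<^sup>2 = (?g * (1 + ?g) * ?P\<^sup>2) * (?W * ?q)"
      "(1 + ?g)\<^sup>2 * ?P\<^sup>2 * (2 * ?g) = (?g * (1 + ?g) * ?P\<^sup>2) * (2 * (1 + ?g))"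
      by (simp_all add: power2_eq_square algebra_simps)
    moreover have "?g * (1 + ?g) * ?P\<^sup>2 \<noteq> 0" using pos g by simp
    ultimately show ?thesis by (metis nonzero_mult_divide_mult_cancel_left)
  qed
  finally show ?thesis
    using D by (simp only: diff_diff_add)
qed

lemma turning_eq:
  assumes J: "\<And>\<phi>. (J has_real_derivative turn_rate \<phi>) (at \<phi>)"
  shows "J (\<phi> + 2 * pi) = J \<phi> + turning M w"
proof -
  let ?F = "\<lambda>\<phi>. J \<phi> - arctan (w\<^sup>2 * flank M \<phi> * excess M \<phi> / (1 + rsq_root M w \<phi> + w\<^sup>2 * (excess M \<phi>)\<^sup>2))"
  have "(?F has_real_derivative 1 + w\<^sup>2 * excess M \<phi> / (2 * (1 + rsq_root M w \<phi>))) (at \<phi>)" for \<phi>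
    using DERIV_diff[OF J[of \<phi>] DERIV_\<Xi>_angle[of \<phi>]] by simp
  from integral_unique[OF integral_of_derivative[OF _ this, of 0 "2 * pi"]]
  have "turning M w = ?F (0 + 2 * pi) - ?F 0"
    by (simp add: turning_def)
  also have "\<dots> = J (2 * pi) - J 0"
    unfolding rsq_root_def excess_periodic flank_periodic rsq_periodic by simp
  finally have "J (2 * pi) - J 0 = turning M w" ..
  moreover have "turn_rate (\<phi> + 2 * pi) = turn_rate \<phi>" for \<phi>
    by (simp add: turn_rate_def excess_root_def rsq_root_def excess_periodic rsq_periodic)
  ultimately show ?thesis
    using antiderivative_shift_period[OF J, of "2 * pi" \<phi>] by simp
qed

end

lemma rsq_nonneg_if: "- 1 / 4 < M \<Longrightarrow> 0 \<le> rsq M \<phi>"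
  using twizzler_parameters.rsq_nonneg[of M 1] by (simp add: twizzler_parameters_def)

lemma turning_0: "turning M 0 = 2 * pi"
  by (simp add: turning_def)

lemma continuous_on_turning:
  assumes "- 1 / 4 < M"
  shows "continuous_on UNIV (turning M)"
proof -
  have "2 * (1 + sqrt (1 + w\<^sup>2 * rsq M \<phi>)) \<noteq> 0" for w \<phi>
  proof -
    have "0 \<le> sqrt (1 + w\<^sup>2 * rsq M \<phi>)" using rsq_nonneg_if[OF assms, of \<phi>] by simp
    then have "0 < 1 + sqrt (1 + w\<^sup>2 * rsq M \<phi>)" by (rule add_pos_nonneg[OF zero_less_one])
    then show ?thesis by simp
  qed
  then have "continuous_on (UNIV \<times> cbox 0 (2 * pi)) (\<lambda>(w, \<phi>). 1 + w\<^sup>2 * excess M \<phi> / (2 * (1 + rsq_root M w \<phi>)))"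
    unfolding case_prod_beta rsq_root_def
    by (intro continuous_intros) blast
  from integral_continuous_on_param[OF this] show ?thesis
    unfolding turning_def[abs_def] by simp
qed

text \<open>This comparison is behind both monotonicity statements that follow: one concerns
  the dependence on the parameter, the other the dependence on \<open>R\<close>.\<close>
lemma square_times_root_less:
  fixes u v R :: real
  assumes "0 \<le> u" "u < v" "0 \<le> R"
  shows "u\<^sup>2 * sqrt (1 + v\<^sup>2 * R) < v\<^sup>2 * sqrt (1 + u\<^sup>2 * R)"
proof -
  have gu: "1 \<le> sqrt (1 + u\<^sup>2 * R)" using assms by simp
  have 1: "u * sqrt (1 + v\<^sup>2 * R) \<le> v * sqrt (1 + u\<^sup>2 * R)"
  proof (rule power2_le_imp_le)
    have "u\<^sup>2 \<le> v\<^sup>2" using assms by (intro power_mono) auto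
    moreover have "0 \<le> 1 + v\<^sup>2 * R" "0 \<le> 1 + u\<^sup>2 * R" using assms by auto
    ultimately show "(u * sqrt (1 + v\<^sup>2 * R))\<^sup>2 \<le> (v * sqrt (1 + u\<^sup>2 * R))\<^sup>2"
      by (simp add: power_mult_distrib algebra_simps)
    show "0 \<le> v * sqrt (1 + u\<^sup>2 * R)" using assms by auto
  qed
  have "u\<^sup>2 * sqrt (1 + v\<^sup>2 * R) = u * (u * sqrt (1 + v\<^sup>2 * R))"
    by (simp add: power2_eq_square)
  also have "\<dots> \<le> u * (v * sqrt (1 + u\<^sup>2 * R))"
    using 1 assms(1) by (rule mult_left_mono)
  also have "\<dots> < v * (v * sqrt (1 + u\<^sup>2 * R))"
    using assms less_le_trans[OF zero_less_one gu] by (intro mult_strict_right_mono mult_pos_pos)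
      (assumption | linarith)+
  finally show ?thesis by (simp add: power2_eq_square)
qed

lemma weight_strict_mono:
  fixes u v R :: real
  assumes "0 \<le> u" "u < v" "0 \<le> R"
  shows "u\<^sup>2 / (1 + sqrt (1 + u\<^sup>2 * R)) < v\<^sup>2 / (1 + sqrt (1 + v\<^sup>2 * R))"
proof -
  have "1 + sqrt (1 + u\<^sup>2 * R) > 0" "1 + sqrt (1 + v\<^sup>2 * R) > 0"
    by (rule add_pos_nonneg[OF zero_less_one], use assms in simp)+
  moreover have "u\<^sup>2 < v\<^sup>2" using assms by (intro power_strict_mono) auto
  ultimately show ?thesis
    using square_times_root_less[OF assms] by (simp add: divide_simps) (simp add: algebra_simps)
qed

lemma root_difference_strict_mono:
  fixes u v R S :: real
  assumes "0 \<le> u" "u < v" "0 \<le> R" "R < S"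
  shows "sqrt (1 + v\<^sup>2 * R) - sqrt (1 + u\<^sup>2 * R) < sqrt (1 + v\<^sup>2 * S) - sqrt (1 + u\<^sup>2 * S)"
proof -
  have e: "sqrt (1 + c\<^sup>2 * S) - sqrt (1 + c\<^sup>2 * R)
      = (S - R) * (c\<^sup>2 / (sqrt (1 + c\<^sup>2 * S) + sqrt (1 + c\<^sup>2 * R)))"
    and p: "0 < sqrt (1 + c\<^sup>2 * S) + sqrt (1 + c\<^sup>2 * R)" for c :: real
  proof -
    have n: "0 < 1 + c\<^sup>2 * S" "0 < 1 + c\<^sup>2 * R" using assms by (auto intro!: add_pos_nonneg)
    then show p: "0 < sqrt (1 + c\<^sup>2 * S) + sqrt (1 + c\<^sup>2 * R)" by (auto intro: add_pos_pos)
    have "(sqrt (1 + c\<^sup>2 * S) - sqrt (1 + c\<^sup>2 * R)) * (sqrt (1 + c\<^sup>2 * S) + sqrt (1 + c\<^sup>2 * R))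
        = (sqrt (1 + c\<^sup>2 * S))\<^sup>2 - (sqrt (1 + c\<^sup>2 * R))\<^sup>2"
      by (simp add: power2_eq_square algebra_simps)
    also have "\<dots> = (S - R) * c\<^sup>2" using n by (simp add: algebra_simps)
    finally show "sqrt (1 + c\<^sup>2 * S) - sqrt (1 + c\<^sup>2 * R)
      = (S - R) * (c\<^sup>2 / (sqrt (1 + c\<^sup>2 * S) + sqrt (1 + c\<^sup>2 * R)))"
      using p by (simp add: field_simps)
  qed
  have "u\<^sup>2 / (sqrt (1 + u\<^sup>2 * S) + sqrt (1 + u\<^sup>2 * R)) < v\<^sup>2 / (sqrt (1 + v\<^sup>2 * S) + sqrt (1 + v\<^sup>2 * R))"
    using square_times_root_less[of u v S] square_times_root_less[of u v R] assms p[of u] p[of v]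
    by (simp add: divide_simps) (simp add: algebra_simps)
  then have "sqrt (1 + u\<^sup>2 * S) - sqrt (1 + u\<^sup>2 * R) < sqrt (1 + v\<^sup>2 * S) - sqrt (1 + v\<^sup>2 * R)"
    unfolding e using assms by (intro mult_strict_left_mono) auto
  then show ?thesis by simp
qed

text \<open>Up to a quarter turn of the parameter, \<open>q / R = 2 Re (1 / (1 + m e\<^sup>i\<^sup>\<phi>))\<close> with \<open>m = sqrt (1 + 4 M)\<close>.
  For \<open>m > 1\<close> this is, up to sign and the factor two, the derivative of the argument of
  \<open>1 + e\<^sup>-\<^sup>i\<^sup>\<phi> / m\<close>, which does not wind around the origin.\<close>
lemma integral_excess_over_rsq:
  assumes "0 < M"
  shows "((\<lambda>\<phi>. excess M \<phi> / rsq M \<phi>) has_integral 0) {0..2 * pi}"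
proof -
  define m where "m = sqrt (1 + 4 * M)"
  have m: "m > 1" "m\<^sup>2 = 1 + 4 * M" using assms by (auto simp: m_def)
  let ?F = "\<lambda>\<phi>. - 2 * arctan (cos \<phi> / (m + sin \<phi>))"
  have "(?F has_real_derivative excess M \<phi> / rsq M \<phi>) (at \<phi>)" for \<phi>
  proof -
    define s c where "s = sin \<phi>" and "c = cos \<phi>"
    have sc: "c\<^sup>2 = 1 - s\<^sup>2" by (simp add: s_def c_def cos_squared_eq)
    have p: "m + s > 0" unfolding s_def using m(1) sin_ge_minus_one[of \<phi>] by linarith
    have q: "1 + m\<^sup>2 + 2 * m * s > 0"
    proof -
      have "1 + m\<^sup>2 + 2 * m * s = (m + s)\<^sup>2 + c\<^sup>2" unfolding sc by (simp add: power2_eq_square algebra_simps)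
      then show ?thesis using p by (simp add: add_pos_nonneg)
    qed
    have "(?F has_real_derivative - 2 * (inverse (1 + (c / (m + s))\<^sup>2) * ((- s * (m + s) - c * c) / ((m + s) * (m + s))))) (at \<phi>)"
      using p unfolding s_def c_def by (auto intro!: derivative_eq_intros)
    moreover have "1 + (c / (m + s))\<^sup>2 = (1 + m\<^sup>2 + 2 * m * s) / ((m + s) * (m + s))"
    proof -
      have "1 + (c / (m + s))\<^sup>2 = ((m + s) * (m + s) + c\<^sup>2) / ((m + s) * (m + s))"
        using p by (simp add: add_divide_distrib power_divide power2_eq_square)
      then show ?thesis unfolding sc by (simp add: power2_eq_square algebra_simps)
    qed
    moreover have "- s * (m + s) - c * c = - (1 + m * s)"
      using sc by (simp add: power2_eq_square algebra_simps)
    moreover have "excess M \<phi> = (1 + m * s) / 2" "rsq M \<phi> = (1 + m\<^sup>2 + 2 * m * s) / 4"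
      unfolding m(2) by (simp_all add: rsq_def excess_def m_def s_def field_simps)
    moreover have "- 2 * (inverse ((1 + m\<^sup>2 + 2 * m * s) / ((m + s) * (m + s))) * (- (1 + m * s) / ((m + s) * (m + s))))
        = (1 + m * s) / 2 / ((1 + m\<^sup>2 + 2 * m * s) / 4)"
      using p q by (simp add: divide_simps) (simp add: algebra_simps)
    ultimately show ?thesis by (simp only:)
  qed
  from integral_of_derivative[OF _ this, of 0 "2 * pi"] show ?thesis by simp
qed

lemma integral_pos_if_pos_somewhere:
  fixes f :: "real \<Rightarrow> real"
  assumes "continuous_on {a..b} f" "a < b" "\<And>x. x \<in> {a..b} \<Longrightarrow> 0 \<le> f x" "c \<in> {a..b}" "0 < f c"
  shows "0 < integral {a..b} f"
proof -
  have "0 \<le> integral {a..b} f" using assms(3) by (rule integral_nonneg[OF integrable_continuous_real[OF assms(1)]])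
  moreover have "integral {a..b} f \<noteq> 0" using integral_eq_0_iff[OF assms(1-3)] assms(4,5) by fastforce
  ultimately show ?thesis by simp
qed

text \<open>With \<open>k c R = c\<^sup>2 / (1 + sqrt (1 + c\<^sup>2 R))\<close> the difference of the integrands for \<open>u < v\<close> is half of
  \<open>q (k v R - k u R)\<close>, where the bracket is positive. For \<open>M \<le> 0\<close> also \<open>q = R - M\<close> is nonnegative. For
  \<open>M > 0\<close> it changes sign, but \<open>R (k v R - k u R) = \<delta> R\<close> with an increasing \<open>\<delta>\<close>, and subtracting
  \<open>\<delta> M * q / R\<close>, whose integral vanishes, turns the integrand into the nonnegative function
  \<open>(R - M) (\<delta> R - \<delta> M) / R\<close>.\<close>
lemma turning_strict_mono:
  assumes M: "- 1 / 4 < M" and uv: "0 \<le> u" "u < v"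
  shows "turning M u < turning M v"
proof -
  define k where "k c R = c\<^sup>2 / (1 + sqrt (1 + c\<^sup>2 * R))" for c R :: real
  define f where "f \<phi> = excess M \<phi> * (k v (rsq M \<phi>) - k u (rsq M \<phi>))" for \<phi>
  have R0: "0 \<le> rsq M \<phi>" for \<phi> using M by (rule rsq_nonneg_if)
  have kpos: "1 + sqrt (1 + c\<^sup>2 * rsq M \<phi>) \<noteq> 0" for c \<phi>
  proof -
    have "0 \<le> sqrt (1 + c\<^sup>2 * rsq M \<phi>)" using R0[of \<phi>] by simp
    then show ?thesis by linarith
  qed
  have contk: "continuous_on {0..2 * pi} (\<lambda>\<phi>. k c (rsq M \<phi>))" for c
    unfolding k_def using kpos by (auto intro!: continuous_intros)
  have contf: "continuous_on {0..2 * pi} f"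
    unfolding f_def by (intro continuous_intros contk)
  have conti: "continuous_on {0..2 * pi} (\<lambda>\<phi>. 1 + excess M \<phi> * k c (rsq M \<phi>) / 2)" for c
    by (intro continuous_intros contk) auto
  have tur: "turning M c = integral {0..2 * pi} (\<lambda>\<phi>. 1 + excess M \<phi> * k c (rsq M \<phi>) / 2)" for c
    unfolding turning_def k_def rsq_root_def
    by (intro arg_cong[where f="integral {0..2 * pi}"]) (auto simp: field_simps)
  have "turning M v - turning M u = integral {0..2 * pi} (\<lambda>\<phi>. f \<phi> / 2)"
    unfolding tur integral_diff[OF integrable_continuous_real[OF conti] integrable_continuous_real[OF conti], symmetric]
    by (simp add: f_def algebra_simps diff_divide_distrib)
  then have diff: "turning M v - turning M u = integral {0..2 * pi} f / 2" by simp
  have kk: "k u R < k v R" if "0 \<le> R" for R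
    using weight_strict_mono[OF uv that] by (simp add: k_def)
  have half: "excess M (pi / 2) > 0" using M by (simp add: excess_def add_pos_nonneg)
  have pi2: "pi / 2 \<in> {0..2 * pi}" using pi_gt_zero by auto
  have "0 < integral {0..2 * pi} f"
  proof (cases "M \<le> 0")
    case True
    show ?thesis
    proof (rule integral_pos_if_pos_somewhere[OF contf _ _ pi2])
      show "0 \<le> f \<phi>" for \<phi>
        unfolding f_def using True R0[of \<phi>] kk[OF R0[of \<phi>]]
        by (intro mult_nonneg_nonneg) (auto simp: rsq_def)
      show "0 < f (pi / 2)" using half kk[OF R0] by (simp add: f_def)
    qed simp
  next
    case False
    define \<delta> where "\<delta> R = sqrt (1 + v\<^sup>2 * R) - sqrt (1 + u\<^sup>2 * R)" for R
    have \<delta>: "\<delta> R < \<delta> S" if "0 \<le> R" "R < S" for R S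
      using root_difference_strict_mono[OF uv that] by (simp add: \<delta>_def)
    have Rpos: "0 < rsq M \<phi>" for \<phi>
    proof -
      have "(flank M \<phi>)\<^sup>2 + (excess M \<phi>)\<^sup>2 = rsq M \<phi>"
        using M by (intro twizzler_parameters.flank_sq[of M 1]) (simp add: twizzler_parameters_def)
      moreover have "excess M \<phi> = rsq M \<phi> - M" by (simp add: rsq_def)
      ultimately show ?thesis using False R0[of \<phi>] by (cases "rsq M \<phi> = 0") auto
    qed
    have kR: "k c R * R = sqrt (1 + c\<^sup>2 * R) - 1" if "0 \<le> R" for c R
    proof -
      have s: "0 \<le> 1 + c\<^sup>2 * R" using that by simp
      then have "1 + sqrt (1 + c\<^sup>2 * R) > 0" by (simp add: add_pos_nonneg)
      moreover have "(sqrt (1 + c\<^sup>2 * R) - 1) * (1 + sqrt (1 + c\<^sup>2 * R)) = (sqrt (1 + c\<^sup>2 * R))\<^sup>2 - 1"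
        by (simp add: power2_eq_square algebra_simps)
      then have "(sqrt (1 + c\<^sup>2 * R) - 1) * (1 + sqrt (1 + c\<^sup>2 * R)) = c\<^sup>2 * R"
        using s by simp
      ultimately show ?thesis by (simp add: k_def field_simps)
    qed
    have f: "f \<phi> = excess M \<phi> / rsq M \<phi> * \<delta> (rsq M \<phi>)" for \<phi>
    proof -
      have "(k v (rsq M \<phi>) - k u (rsq M \<phi>)) * rsq M \<phi> = \<delta> (rsq M \<phi>)"
        using kR[OF R0] by (simp add: \<delta>_def left_diff_distrib)
      then show ?thesis using Rpos[of \<phi>] by (simp add: f_def field_simps)
    qed
    define e where "e \<phi> = excess M \<phi> / rsq M \<phi> * (\<delta> (rsq M \<phi>) - \<delta> M)" for \<phi>
    have conte: "continuous_on {0..2 * pi} e"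
      unfolding e_def \<delta>_def using Rpos by (auto intro!: continuous_intros simp: less_imp_neq[THEN not_sym])
    have "integral {0..2 * pi} f = integral {0..2 * pi} (\<lambda>\<phi>. e \<phi> + excess M \<phi> / rsq M \<phi> * \<delta> M)"
      by (rule arg_cong[where f="integral {0..2 * pi}"], rule ext) (simp add: f e_def right_diff_distrib)
    also have "\<dots> = integral {0..2 * pi} e + 0 * \<delta> M"
      using has_integral_mult_left[OF integral_excess_over_rsq[of M], of "\<delta> M"] False
      by (intro integral_unique has_integral_add integrable_integral integrable_continuous_real conte) auto
    also have "\<dots> = integral {0..2 * pi} e" by simp
    finally have "integral {0..2 * pi} f = integral {0..2 * pi} e" .
    moreover have "0 < integral {0..2 * pi} e"
    proof (rule integral_pos_if_pos_somewhere[OF conte _ _ pi2])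
      show "0 \<le> e \<phi>" for \<phi>
      proof (cases "excess M \<phi> \<ge> 0")
        case True
        then have "\<delta> M \<le> \<delta> (rsq M \<phi>)"
          using \<delta>[of M "rsq M \<phi>"] False by (cases "excess M \<phi> = 0") (auto simp: rsq_def)
        then show ?thesis using True Rpos[of \<phi>] by (simp add: e_def)
      next
        case neg: False
        then have "\<delta> (rsq M \<phi>) < \<delta> M"
          using \<delta>[of "rsq M \<phi>" M] R0[of \<phi>] by (simp add: rsq_def)
        then show ?thesis using neg Rpos[of \<phi>]
          unfolding e_def by (intro mult_nonpos_nonpos divide_nonpos_pos) auto
      qed
      have "\<delta> M < \<delta> (rsq M (pi / 2))" using \<delta>[of M "rsq M (pi / 2)"] half False by (simp add: rsq_def)
      then show "0 < e (pi / 2)" using half Rpos[of "pi / 2"] by (simp add: e_def)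
    qed simp
    ultimately show ?thesis by simp
  qed
  with diff show ?thesis by simp
qed

lemma turning_pos:
  assumes "- 1 / 4 < M" "0 < w"
  shows "0 < turning M w"
  using turning_strict_mono[OF assms(1) order_refl assms(2)] turning_0[of M] pi_gt_zero by linarith

section \<open>The integral of \<open>\<psi>\<close>\<close>

lemma DERIV_sqrt_cos_squared:
  assumes "0 < a + b * (cos u)\<^sup>2"
  shows "((\<lambda>u. sqrt (a + b * (cos u)\<^sup>2)) has_real_derivative
           - (b * cos u * sin u / sqrt (a + b * (cos u)\<^sup>2))) (at u)"
  using assms by (auto intro!: derivative_eq_intros simp: field_simps)

context twizzler_parameters begin

text \<open>\<open>(coeff_A M w)\<^sup>2\<close> is the positive root of a quadratic equation: at \<open>x\<^sub>1 = coeff_A M w\<close> the two values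
  of \<open>x\<^sub>2\<close> on the level curve coincide. The value of \<open>coeff_B\<close> is what splits off that root from the
  discriminant.\<close>
lemma coeff_A_pos: "0 < coeff_A M w"
  and coeff_A_eq: "4 * w\<^sup>2 * (coeff_A M w) ^ 4 = 1 + 4 * M + 4 * (M * w\<^sup>2 - 1) * (coeff_A M w)\<^sup>2"
  and coeff_B_eq: "coeff_B M w = 4 * w\<^sup>2 * (coeff_A M w) ^ 4"
proof -
  define p where "p = M * w\<^sup>2 - 1"
  define S where "S = sqrt (1 + (1 + 2 * M) * w\<^sup>2 + M\<^sup>2 * w ^ 4)"
  define A where "A = coeff_A M w"
  have e: "1 + (1 + 2 * M) * w\<^sup>2 + M\<^sup>2 * w ^ 4 = p\<^sup>2 + w\<^sup>2 * (1 + 4 * M)"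
    unfolding p_def by (simp add: power2_eq_square power4_eq_xxxx algebra_simps)
  have gt: "0 < w\<^sup>2 * (1 + 4 * M)" using M w by simp
  have S2: "S\<^sup>2 = p\<^sup>2 + w\<^sup>2 * (1 + 4 * M)"
    unfolding S_def e using gt by (simp add: add_nonneg_pos less_imp_le)
  have "\<bar>p\<bar> < S"
    unfolding S_def e using gt by (simp add: real_less_rsqrt)
  then have y: "0 < p + S" by linarith
  have A: "A = sqrt (p + S) / (sqrt 2 * w)"
    by (simp add: A_def coeff_A_def p_def S_def add.commute add.assoc algebra_simps)
  then show "0 < coeff_A M w"
    using y w by (simp flip: A_def)
  have A2: "2 * w\<^sup>2 * A\<^sup>2 = p + S"
    unfolding A using y w by (simp add: power_divide power_mult_distrib)
  have "w\<^sup>2 * (4 * w\<^sup>2 * A ^ 4) = (2 * w\<^sup>2 * A\<^sup>2)\<^sup>2"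
    by (simp add: power2_eq_square power4_eq_xxxx)
  then have A4: "w\<^sup>2 * (4 * w\<^sup>2 * A ^ 4) = p\<^sup>2 + 2 * p * S + S\<^sup>2"
    unfolding A2 by (simp add: power2_eq_square algebra_simps)
  have "w\<^sup>2 * (1 + 4 * M + 4 * p * A\<^sup>2) = w\<^sup>2 * (1 + 4 * M) + 2 * p * (2 * w\<^sup>2 * A\<^sup>2)"
    by (simp add: algebra_simps)
  also have "\<dots> = w\<^sup>2 * (4 * w\<^sup>2 * A ^ 4)"
    unfolding A4 S2 A2 by (simp add: power2_eq_square algebra_simps)
  finally show "4 * w\<^sup>2 * (coeff_A M w) ^ 4 = 1 + 4 * M + 4 * (M * w\<^sup>2 - 1) * (coeff_A M w)\<^sup>2"
    using w by (simp add: p_def A_def)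
  have "w\<^sup>2 * coeff_B M w = 2 + 2 * M\<^sup>2 * w ^ 4 + w\<^sup>2 + 2 * p * S"
    using w by (simp add: coeff_B_def p_def S_def)
  also have "\<dots> = w\<^sup>2 * (4 * w\<^sup>2 * A ^ 4)"
    unfolding A4 S2 p_def by (simp add: power2_eq_square power4_eq_xxxx algebra_simps)
  finally show "coeff_B M w = 4 * w\<^sup>2 * (coeff_A M w) ^ 4"
    using w by (simp add: A_def)
qed

definition \<rho>_root :: "real \<Rightarrow> real" where
  "\<rho>_root u = sqrt (1 + w\<^sup>2 * (\<rho>\<^sub>1 M w u)\<^sup>2)"

definition \<rho>_disc :: "real \<Rightarrow> real" where
  "\<rho>_disc u = sqrt (1 + 4 * M + coeff_B M w * (cos u)\<^sup>2)"

text \<open>The arc length of the profile curve per unit of \<open>u\<close>. It is the square root of \<open>lam / mu\<close>, in a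
  form that shows its sign and its continuity.\<close>
definition \<rho>_rate :: "real \<Rightarrow> real" where
  "\<rho>_rate u = (1 + w\<^sup>2 * ((\<rho>\<^sub>1 M w u)\<^sup>2 + (\<rho>\<^sub>2 M w u)\<^sup>2)) * coeff_A M w / ((\<rho>_root u)\<^sup>2 * \<rho>_disc u)"

lemma \<rho>_root_pos: "0 < \<rho>_root u" and \<rho>_root_sq: "(\<rho>_root u)\<^sup>2 = 1 + w\<^sup>2 * (coeff_A M w)\<^sup>2 * (cos u)\<^sup>2"
  using one_plus_square_pos[of w "\<rho>\<^sub>1 M w u"]
  by (simp_all add: \<rho>_root_def) (simp add: \<rho>\<^sub>1_def power_mult_distrib)

lemma \<rho>_disc_pos: "0 < \<rho>_disc u" and \<rho>_disc_sq: "(\<rho>_disc u)\<^sup>2 = 1 + 4 * M + coeff_B M w * (cos u)\<^sup>2"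
proof -
  have "0 < 1 + 4 * M + coeff_B M w * (cos u)\<^sup>2"
    unfolding coeff_B_eq by (rule add_pos_nonneg) (use M in auto)
  then show "0 < \<rho>_disc u" "(\<rho>_disc u)\<^sup>2 = 1 + 4 * M + coeff_B M w * (cos u)\<^sup>2"
    by (simp_all add: \<rho>_disc_def)
qed

lemma \<rho>\<^sub>2_eq: "\<rho>\<^sub>2 M w u = (- 1 + \<rho>_disc u * sin u) / (2 * \<rho>_root u)"
  by (simp add: \<rho>\<^sub>2_def \<rho>_disc_def \<rho>_root_def \<rho>\<^sub>1_def power_mult_distrib mult.assoc)

lemma \<rho>_gram_pos: "0 < 1 + w\<^sup>2 * ((\<rho>\<^sub>1 M w u)\<^sup>2 + (\<rho>\<^sub>2 M w u)\<^sup>2)"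
  by (intro add_pos_nonneg) auto

lemma \<rho>_rate_pos: "0 < \<rho>_rate u"
  unfolding \<rho>_rate_def by (intro divide_pos_pos mult_pos_pos zero_less_power \<rho>_gram_pos coeff_A_pos \<rho>_root_pos \<rho>_disc_pos)

lemma \<rho>_level: "h w (\<rho>\<^sub>1 M w u) (\<rho>\<^sub>2 M w u) = M"
proof -
  define A c s D Q where "A = coeff_A M w" "c = cos u" "s = sin u" "D = \<rho>_root u" "Q = \<rho>_disc u"
  note defs = this
  have D: "D > 0" "D\<^sup>2 = 1 + w\<^sup>2 * A\<^sup>2 * c\<^sup>2" using \<rho>_root_pos \<rho>_root_sq by (simp_all add: defs)
  have Q: "Q\<^sup>2 = 1 + 4 * M + 4 * w\<^sup>2 * A ^ 4 * c\<^sup>2" using \<rho>_disc_sq coeff_B_eq by (simp add: defs)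
  have s: "s\<^sup>2 = 1 - c\<^sup>2" by (simp add: defs sin_squared_eq)
  have A: "4 * w\<^sup>2 * A ^ 4 = 1 + 4 * M + 4 * (M * w\<^sup>2 - 1) * A\<^sup>2"
    using coeff_A_eq by (simp add: defs)
  have "Q\<^sup>2 * s\<^sup>2 - 1 - 4 * D\<^sup>2 * (M - A\<^sup>2 * c\<^sup>2)
      = (4 * w\<^sup>2 * A ^ 4 - (1 + 4 * M + 4 * (M * w\<^sup>2 - 1) * A\<^sup>2)) * c\<^sup>2"
    unfolding Q D s by (simp add: power2_eq_square power4_eq_xxxx algebra_simps)
  then have key: "Q\<^sup>2 * s\<^sup>2 - 1 = 4 * D\<^sup>2 * (M - A\<^sup>2 * c\<^sup>2)" unfolding A by simp
  have "h w (\<rho>\<^sub>1 M w u) (\<rho>\<^sub>2 M w u)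
      = A\<^sup>2 * c\<^sup>2 + (((- 1 + Q * s) / (2 * D))\<^sup>2 + (- 1 + Q * s) / (2 * D) / D)"
    unfolding h_def \<rho>_root_def[symmetric] \<rho>\<^sub>2_eq by (simp add: defs \<rho>\<^sub>1_def power_mult_distrib)
  also have "((- 1 + Q * s) / (2 * D))\<^sup>2 + (- 1 + Q * s) / (2 * D) / D = (Q\<^sup>2 * s\<^sup>2 - 1) / (4 * D\<^sup>2)"
    using D(1) by (simp add: field_simps power2_eq_square)
  also have "A\<^sup>2 * c\<^sup>2 + (Q\<^sup>2 * s\<^sup>2 - 1) / (4 * D\<^sup>2) = M"
    unfolding key using D(1) by simp
  finally show ?thesis .
qed

lemma \<rho>_f\<^sub>1:
  "f\<^sub>1 w (\<rho>\<^sub>1 M w u) (\<rho>\<^sub>2 M w u) * (1 + w\<^sup>2 * ((\<rho>\<^sub>1 M w u)\<^sup>2 + (\<rho>\<^sub>2 M w u)\<^sup>2))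
     = (\<rho>_root u)\<^sup>2 * (\<rho>_disc u * sin u)"
proof -
  let ?x = "\<rho>\<^sub>1 M w u" and ?y = "\<rho>\<^sub>2 M w u"
  let ?G = "1 + w\<^sup>2 * (?x\<^sup>2 + ?y\<^sup>2)"
  have c: "curv w ?x ?y * ?G = 2 * (\<rho>_root u) ^ 3 - w\<^sup>2 * ?y"
    using \<rho>_gram_pos[of u] by (simp add: curv_eq \<rho>_root_def)
  have D2: "1 + w\<^sup>2 * ?x\<^sup>2 = (\<rho>_root u)\<^sup>2"
    using one_plus_square_pos[of w ?x] by (simp add: \<rho>_root_def)
  have y: "2 * \<rho>_root u * ?y = - 1 + \<rho>_disc u * sin u"
    using \<rho>_root_pos[of u] by (simp add: \<rho>\<^sub>2_eq)
  have "f\<^sub>1 w ?x ?y * ?G = ?G + ?y * (curv w ?x ?y * ?G)"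
    by (simp add: f\<^sub>1_curv algebra_simps)
  also have "\<dots> = (1 + w\<^sup>2 * ?x\<^sup>2) + 2 * \<rho>_root u * ?y * (\<rho>_root u)\<^sup>2"
    unfolding c by (simp add: power2_eq_square power3_eq_cube algebra_simps)
  also have "\<dots> = (\<rho>_root u)\<^sup>2 * (\<rho>_disc u * sin u)"
    unfolding D2 y by (simp add: algebra_simps)
  finally show ?thesis .
qed

text \<open>The minus signs record that \<open>(\<rho>\<^sub>1, \<rho>\<^sub>2)\<close> runs counterclockwise, against the flow
  \<open>(f\<^sub>1, f\<^sub>2)\<close>. For the second coordinate the claim reduces to a polynomial identity modulo the
  quadratic equation for \<open>(coeff_A M w)\<^sup>2\<close>.\<close>
lemma DERIV_\<rho>:
  shows "(\<rho>\<^sub>1 M w has_real_derivative - \<rho>_rate u * f\<^sub>1 w (\<rho>\<^sub>1 M w u) (\<rho>\<^sub>2 M w u)) (at u)"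
    and "(\<rho>\<^sub>2 M w has_real_derivative - \<rho>_rate u * f\<^sub>2 w (\<rho>\<^sub>1 M w u) (\<rho>\<^sub>2 M w u)) (at u)"
proof -
  define A c s D Q where "A = coeff_A M w" "c = cos u" "s = sin u" "D = \<rho>_root u" "Q = \<rho>_disc u"
  note defs = this
  define G where "G = 1 + w\<^sup>2 * ((\<rho>\<^sub>1 M w u)\<^sup>2 + (\<rho>\<^sub>2 M w u)\<^sup>2)"
  have D: "D > 0" "D\<^sup>2 = 1 + w\<^sup>2 * A\<^sup>2 * c\<^sup>2" using \<rho>_root_pos \<rho>_root_sq by (simp_all add: defs)
  have Q: "Q > 0" "Q\<^sup>2 = 1 + 4 * M + 4 * w\<^sup>2 * A ^ 4 * c\<^sup>2"
    using \<rho>_disc_pos \<rho>_disc_sq coeff_B_eq by (simp_all add: defs)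
  have s: "s\<^sup>2 = 1 - c\<^sup>2" by (simp add: defs sin_squared_eq)
  have A: "4 * w\<^sup>2 * A ^ 4 = 1 + 4 * M + 4 * (M * w\<^sup>2 - 1) * A\<^sup>2"
    using coeff_A_eq by (simp add: defs)
  have G: "G > 0" unfolding G_def by (rule \<rho>_gram_pos)
  have rate: "\<rho>_rate u = G * A / (D\<^sup>2 * Q)"
    by (simp add: \<rho>_rate_def G_def defs)
  have "f\<^sub>1 w (\<rho>\<^sub>1 M w u) (\<rho>\<^sub>2 M w u) = D\<^sup>2 * (Q * s) / G"
    using \<rho>_f\<^sub>1[of u] G unfolding G_def[symmetric] defs[symmetric] by (simp add: nonzero_eq_divide_eq)
  then have "- \<rho>_rate u * f\<^sub>1 w (\<rho>\<^sub>1 M w u) (\<rho>\<^sub>2 M w u) = - (A * s)"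
    unfolding rate using G D(1) Q(1) by simp
  moreover have "(\<rho>\<^sub>1 M w has_real_derivative - (A * s)) (at u)"
    unfolding \<rho>\<^sub>1_def[abs_def] defs by (auto intro!: derivative_eq_intros)
  ultimately show "(\<rho>\<^sub>1 M w has_real_derivative - \<rho>_rate u * f\<^sub>1 w (\<rho>\<^sub>1 M w u) (\<rho>\<^sub>2 M w u)) (at u)"
    by (simp only:)
  have dD: "(\<rho>_root has_real_derivative - (w\<^sup>2 * A\<^sup>2 * c * s / D)) (at u)"
  proof -
    have e: "\<rho>_root = (\<lambda>u. sqrt (1 + w\<^sup>2 * A\<^sup>2 * (cos u)\<^sup>2))"
      by (auto simp: \<rho>_root_def \<rho>\<^sub>1_def defs power_mult_distrib mult.assoc)
    have "0 < 1 + w\<^sup>2 * A\<^sup>2 * (cos u)\<^sup>2" by (intro add_pos_nonneg) auto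
    from DERIV_sqrt_cos_squared[OF this, folded e] show ?thesis by (simp add: defs e)
  qed
  have dQ: "(\<rho>_disc has_real_derivative - (4 * w\<^sup>2 * A ^ 4 * c * s / Q)) (at u)"
  proof -
    have e: "\<rho>_disc = (\<lambda>u. sqrt (1 + 4 * M + 4 * w\<^sup>2 * A ^ 4 * (cos u)\<^sup>2))"
      by (auto simp: \<rho>_disc_def coeff_B_eq defs)
    have "0 < 1 + 4 * M + 4 * w\<^sup>2 * A ^ 4 * (cos u)\<^sup>2" by (rule add_pos_nonneg) (use M in auto)
    from DERIV_sqrt_cos_squared[OF this, folded e] show ?thesis by (simp add: defs e)
  qed
  define y where "y = - 1 + Q * s"
  have "(\<rho>\<^sub>2 M w has_real_derivative
      ((- (4 * w\<^sup>2 * A ^ 4 * c * s / Q) * s + c * Q) * (2 * D) - y * (2 * - (w\<^sup>2 * A\<^sup>2 * c * s / D))) / ((2 * D) * (2 * D))) (at u)"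
  proof -
    have num: "((\<lambda>u. - 1 + \<rho>_disc u * sin u) has_real_derivative - (4 * w\<^sup>2 * A ^ 4 * c * s / Q) * s + c * Q) (at u)"
      using DERIV_add[OF DERIV_const[of "-1"] DERIV_mult[OF dQ DERIV_sin]] by (simp add: defs)
    have den: "((\<lambda>u. 2 * \<rho>_root u) has_real_derivative 2 * - (w\<^sup>2 * A\<^sup>2 * c * s / D)) (at u)"
      by (rule DERIV_cmult[OF dD])
    have r2: "\<rho>\<^sub>2 M w = (\<lambda>u. (- 1 + \<rho>_disc u * sin u) / (2 * \<rho>_root u))"
      by (rule ext) (rule \<rho>\<^sub>2_eq)
    have "2 * \<rho>_root u \<noteq> 0" using \<rho>_root_pos[of u] by simp
    from DERIV_divide[OF num den this] show ?thesis
      unfolding r2 y_def by (simp only: defs)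
  qed
  moreover have "((- (4 * w\<^sup>2 * A ^ 4 * c * s / Q) * s + c * Q) * (2 * D) - y * (2 * - (w\<^sup>2 * A\<^sup>2 * c * s / D))) / ((2 * D) * (2 * D))
      = c * (D\<^sup>2 * (Q\<^sup>2 - 4 * w\<^sup>2 * A ^ 4 * s\<^sup>2) + y * w\<^sup>2 * A\<^sup>2 * s * Q) / (2 * D ^ 3 * Q)"
    using D(1) Q(1) by (simp add: field_simps power2_eq_square power3_eq_cube)
  moreover have "- \<rho>_rate u * f\<^sub>2 w (\<rho>\<^sub>1 M w u) (\<rho>\<^sub>2 M w u) = c * (A\<^sup>2 * (4 * D ^ 4 - w\<^sup>2 * y)) / (2 * D ^ 3 * Q)"
  proof -
    have y2: "\<rho>\<^sub>2 M w u = y / (2 * D)" by (simp add: \<rho>\<^sub>2_eq y_def defs)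
    have "curv w (\<rho>\<^sub>1 M w u) (\<rho>\<^sub>2 M w u) = (2 * D ^ 3 - w\<^sup>2 * \<rho>\<^sub>2 M w u) / G"
      by (simp add: curv_eq G_def defs \<rho>_root_def)
    then have "- \<rho>_rate u * f\<^sub>2 w (\<rho>\<^sub>1 M w u) (\<rho>\<^sub>2 M w u) = G * A / (D\<^sup>2 * Q) * ((2 * D ^ 3 - w\<^sup>2 * (y / (2 * D))) / G * (A * c))"
      unfolding f\<^sub>2_curv rate y2 by (simp add: \<rho>\<^sub>1_def defs)
    also have "\<dots> = c * (A\<^sup>2 * (4 * D ^ 4 - w\<^sup>2 * y)) / (2 * D ^ 3 * Q)"
      using D(1) Q(1) G by (simp add: field_simps power2_eq_square power3_eq_cube power4_eq_xxxx)
    finally show ?thesis .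
  qed
  moreover have "D\<^sup>2 * (Q\<^sup>2 - 4 * w\<^sup>2 * A ^ 4 * s\<^sup>2) + y * w\<^sup>2 * A\<^sup>2 * s * Q = A\<^sup>2 * (4 * D ^ 4 - w\<^sup>2 * y)"
  proof -
    have "D\<^sup>2 * (Q\<^sup>2 - 4 * w\<^sup>2 * A ^ 4 * s\<^sup>2) + y * w\<^sup>2 * A\<^sup>2 * s * Q - A\<^sup>2 * (4 * D ^ 4 - w\<^sup>2 * y)
      = D\<^sup>2 * (Q\<^sup>2 - 4 * w\<^sup>2 * A ^ 4 * s\<^sup>2) + w\<^sup>2 * A\<^sup>2 * (Q\<^sup>2 * s\<^sup>2) - w\<^sup>2 * A\<^sup>2 - 4 * A\<^sup>2 * (D\<^sup>2)\<^sup>2"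
      unfolding y_def by (simp add: power2_eq_square power4_eq_xxxx algebra_simps)
    also have "\<dots> = 1 + 4 * M + 4 * (M * w\<^sup>2 - 1) * A\<^sup>2 - 4 * w\<^sup>2 * A ^ 4"
      unfolding D(2) Q(2) s by (simp add: power2_eq_square power4_eq_xxxx algebra_simps)
    also have "\<dots> = 0" unfolding A by simp
    finally show ?thesis by simp
  qed
  ultimately show "(\<rho>\<^sub>2 M w has_real_derivative - \<rho>_rate u * f\<^sub>2 w (\<rho>\<^sub>1 M w u) (\<rho>\<^sub>2 M w u)) (at u)"
    by (simp only:)
qed

text \<open>The field \<open>(f\<^sub>1, f\<^sub>2)\<close> has no zeros on the level curve: its first component vanishes only at the
  extreme values of \<open>x\<^sub>1\<close>, and there \<open>x\<^sub>2 < 0\<close> makes the curvature positive.\<close>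
lemma mu_pos: "0 < mu M w u"
proof (cases "sin u = 0")
  case False
  then have "f\<^sub>1 w (\<rho>\<^sub>1 M w u) (\<rho>\<^sub>2 M w u) \<noteq> 0"
    using \<rho>_f\<^sub>1[of u] \<rho>_root_pos[of u] \<rho>_disc_pos[of u] by auto
  then show ?thesis by (simp add: mu_def add_pos_nonneg)
next
  case True
  then have "\<rho>\<^sub>1 M w u \<noteq> 0"
    using coeff_A_pos sin_cos_squared_add[of u] by (auto simp: \<rho>\<^sub>1_def)
  moreover have "\<rho>\<^sub>2 M w u < 0"
    using True \<rho>_root_pos[of u] by (simp add: \<rho>\<^sub>2_eq)
  then have "w\<^sup>2 * \<rho>\<^sub>2 M w u \<le> 0" by (simp add: mult_nonneg_nonpos)
  then have "0 < 2 * \<rho>_root u ^ 3 - w\<^sup>2 * \<rho>\<^sub>2 M w u"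
    using zero_less_power[OF \<rho>_root_pos[of u], of 3] by linarith
  then have "0 < curv w (\<rho>\<^sub>1 M w u) (\<rho>\<^sub>2 M w u)"
    using \<rho>_gram_pos[of u] by (simp add: curv_eq flip: \<rho>_root_def)
  ultimately show ?thesis by (simp add: mu_def f\<^sub>2_curv add_nonneg_pos)
qed

lemma \<psi>_eq: "\<psi> M w u = curv w (\<rho>\<^sub>1 M w u) (\<rho>\<^sub>2 M w u) * \<rho>_rate u"
proof -
  have "lam M w u = (\<rho>_rate u)\<^sup>2 * mu M w u"
    unfolding lam_def mu_def DERIV_imp_deriv[OF DERIV_\<rho>(1)] DERIV_imp_deriv[OF DERIV_\<rho>(2)]
    by (simp add: power_mult_distrib algebra_simps)
  then have "sqrt (lam M w u / mu M w u) = \<rho>_rate u"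
    using mu_pos[of u] \<rho>_rate_pos[of u] by simp
  then show ?thesis by (simp add: \<psi>_def curv_def)
qed

lemma turn_rate_antiderivative: obtains J where "\<And>\<phi>. (J has_real_derivative turn_rate \<phi>) (at \<phi>)"
proof -
  have "continuous_on UNIV turn_rate"
    unfolding turn_rate_def[abs_def] using excess_root_pos rsq_root_pos
    by (auto intro!: continuous_intros simp: less_imp_neq[THEN not_sym])
  from global_antiderivative[OF this] show thesis using that by blast
qed

text \<open>Along \<open>(\<rho>\<^sub>1, \<rho>\<^sub>2)\<close> the lift \<open>\<phi>\<close> decreases and its total change over \<open>[0, 2 \<pi>]\<close> is a multiple of
  \<open>2 \<pi>\<close>. A larger multiple than \<open>- 2 \<pi>\<close> in size would make \<open>(\<rho>\<^sub>1, \<rho>\<^sub>2)\<close> return to its starting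
  point in between, where \<open>\<rho>\<^sub>1\<close> is maximal; but the cosine has its maximum at the end points only.\<close>
lemma integral_\<psi>: "integral {0..2 * pi} (\<psi> M w) = turning M w"
proof -
  obtain J where J: "\<And>\<phi>. (J has_real_derivative turn_rate \<phi>) (at \<phi>)"
    using turn_rate_antiderivative by blast
  have cont\<rho>: "continuous_on UNIV (\<rho>\<^sub>1 M w)" "continuous_on UNIV (\<rho>\<^sub>2 M w)"
    using DERIV_\<rho>[THEN DERIV_isCont] by (auto intro!: continuous_at_imp_continuous_on)
  have "continuous_on UNIV (\<lambda>u. - \<rho>_rate u)"
    unfolding \<rho>_rate_def \<rho>_root_def \<rho>_disc_def using \<rho>_root_pos \<rho>_disc_pos
    by (intro continuous_intros cont\<rho>)
       (auto simp: \<rho>_root_def \<rho>_disc_def less_imp_neq[THEN not_sym])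
  from level_curve_lift[OF \<rho>_level this DERIV_\<rho>] obtain \<phi> where \<phi>:
    "\<And>u. \<rho>\<^sub>1 M w u = \<Xi>\<^sub>1 M w (\<phi> u)" "\<And>u. \<rho>\<^sub>2 M w u = \<Xi>\<^sub>2 M w (\<phi> u)"
    "\<And>u. (\<phi> has_real_derivative 2 * - \<rho>_rate u / excess_root M w (\<phi> u)) (at u)" by blast
  have decr: "\<phi> b < \<phi> a" if "a < b" for a b
    using that
  proof (rule DERIV_neg_imp_decreasing)
    show "\<exists>y. (\<phi> has_real_derivative y) (at u) \<and> y < 0" for u
      using \<phi>(3)[of u] \<rho>_rate_pos[of u] excess_root_pos[of M w "\<phi> u"] 
      by (intro exI[of _ "2 * - \<rho>_rate u / excess_root M w (\<phi> u)"]) simp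
  qed
  have "\<Xi>\<^sub>1 M w (\<phi> (2 * pi)) = \<Xi>\<^sub>1 M w (\<phi> 0) \<and> \<Xi>\<^sub>2 M w (\<phi> (2 * pi)) = \<Xi>\<^sub>2 M w (\<phi> 0)"
    unfolding \<phi>(1,2)[symmetric] by (simp add: \<rho>\<^sub>1_def \<rho>\<^sub>2_def)
  then obtain n :: int where n: "\<phi> (2 * pi) = \<phi> 0 + 2 * pi * n"
    unfolding \<Xi>_eq_iff by blast
  have "2 * pi * n < 0" using decr[of 0 "2 * pi"] n by simp
  then have "n < 0" by (simp add: mult_less_0_iff)
  moreover have "\<not> n \<le> - 2"
    \<comment> \<open>otherwise \<open>\<phi>\<close> has completed a full turn strictly before \<open>u = 2 \<pi>\<close>\<close>
  proof
    assume "n \<le> - 2"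
    then have "2 * pi * n \<le> 2 * pi * - 2" by (intro mult_left_mono) (simp_all del: of_int_le_iff add: of_int_le_iff[of n "-2", simplified])
    then have lt: "\<phi> (2 * pi) < \<phi> 0 - 2 * pi" using n pi_gt_zero by linarith
    have "\<exists>u\<ge>0. u \<le> 2 * pi \<and> \<phi> u = \<phi> 0 - 2 * pi"
      by (rule IVT2) (use lt DERIV_isCont[OF \<phi>(3)] in auto)
    then obtain u where u: "0 \<le> u" "u \<le> 2 * pi" "\<phi> u = \<phi> 0 - 2 * pi" by blast
    have "u \<noteq> 0" "u \<noteq> 2 * pi" using u lt by auto
    with u have u': "0 < u" "u < 2 * pi" by auto
    have "\<Xi>\<^sub>1 M w (\<phi> 0) = \<Xi>\<^sub>1 M w (\<phi> u)" using \<Xi>_periodic(1)[of "\<phi> u"] u(3) by simp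
    then have "cos u = 1" unfolding \<phi>(1)[symmetric] using coeff_A_pos by (simp add: \<rho>\<^sub>1_def)
    then obtain k :: int where "u = 2 * pi * k" using cos_one_2pi_int by (metis mult.assoc mult.commute)
    with u' have "0 < real_of_int k" "real_of_int k < 1" by (simp_all add: zero_less_mult_iff)
    then show False by simp
  qed
  ultimately have "n = - 1" by linarith
  with n have n': "\<phi> 0 = \<phi> (2 * pi) + 2 * pi" by simp
  have "((\<lambda>u. - J (\<phi> u)) has_real_derivative \<psi> M w u) (at u)" for u
  proof -
    have "((\<lambda>u. - J (\<phi> u)) has_real_derivative - (turn_rate (\<phi> u) * (2 * - \<rho>_rate u / excess_root M w (\<phi> u)))) (at u)"
      by (intro DERIV_minus DERIV_chain2[OF J \<phi>(3)])
    moreover have "- (turn_rate (\<phi> u) * (2 * - \<rho>_rate u / excess_root M w (\<phi> u))) = \<psi> M w u"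
      unfolding curv_\<Xi>[symmetric] \<psi>_eq \<phi>(1,2) using excess_root_pos[of M w "\<phi> u"] by simp
    ultimately show ?thesis by simp
  qed
  from integral_unique[OF integral_of_derivative[OF _ this, of 0 "2 * pi"]]
  have "integral {0..2 * pi} (\<psi> M w) = J (\<phi> 0) - J (\<phi> (2 * pi))" by simp
  also have "\<dots> = turning M w" unfolding n' turning_eq[OF J] by simp
  finally show ?thesis .
qed

end

section \<open>Mean curvature of a Twizzler\<close>

lemma has_vector_derivative_vector_3:
  fixes f g k :: "real \<Rightarrow> real"
  assumes "(f has_real_derivative f') (at t)" "(g has_real_derivative g') (at t)"
    "(k has_real_derivative k') (at t)"
  shows "((\<lambda>t. vector [f t, g t, k t] :: real^3) has_vector_derivative vector [f', g', k']) (at t)"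
proof -
  have e: "(vector [a, b, c] :: real^3) = a *\<^sub>R axis 1 1 + b *\<^sub>R axis 2 1 + c *\<^sub>R axis 3 1" for a b c :: real
    by (simp add: vec_eq_iff forall_3 axis_def)
  show ?thesis
    unfolding e using assms
    by (auto intro!: derivative_eq_intros simp: has_real_derivative_iff_has_vector_derivative)
qed

lemma has_vector_derivative_vector_2:
  fixes f g :: "real \<Rightarrow> real"
  assumes "(f has_real_derivative f') (at t)" "(g has_real_derivative g') (at t)"
  shows "((\<lambda>t. vector [f t, g t] :: real^2) has_vector_derivative vector [f', g']) (at t)"
proof -
  have e: "(vector [a, b] :: real^2) = a *\<^sub>R axis 1 1 + b *\<^sub>R axis 2 1" for a b :: real
    by (simp add: vec_eq_iff forall_2 axis_def)
  show ?thesis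
    unfolding e using assms
    by (auto intro!: derivative_eq_intros simp: has_real_derivative_iff_has_vector_derivative)
qed

lemma has_vector_derivative_nth:
  fixes f :: "real \<Rightarrow> real^'n"
  assumes "(f has_vector_derivative f') (at t)"
  shows "((\<lambda>t. f t $ i) has_real_derivative f' $ i) (at t)"
  using bounded_linear.has_vector_derivative[OF bounded_linear_vec_nth assms]
  by (simp add: has_real_derivative_iff_has_vector_derivative)

text \<open>The polynomial in \<open>k\<close> has leading coefficient \<open>E G - F\<^sup>2 > 0\<close>, and its linear coefficient gives the
  sum of the roots. That the roots are real follows from its value \<open>- (f - k F)\<^sup>2 \<le> 0\<close> at
  \<open>k = e / E\<close>; the identity for the discriminant below is this observation without division.\<close>
lemma curvature_sum_of_forms:
  fixes E F G e f g H :: real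
  assumes "0 < E" and D: "0 < E * G - F * F"
  shows "(\<exists>k1 k2. (\<forall>k. (e - k * E) * (g - k * G) - (f - k * F) * (f - k * F)
            = (E * G - F * F) * (k1 - k) * (k2 - k)) \<and> H = (k1 + k2) / 2)
     \<longleftrightarrow> e * G - 2 * f * F + g * E = 2 * H * (E * G - F * F)" (is "?L \<longleftrightarrow> ?R")
proof
  assume ?L
  then obtain k1 k2 where k: "\<And>k. (e - k * E) * (g - k * G) - (f - k * F) * (f - k * F)
            = (E * G - F * F) * (k1 - k) * (k2 - k)" and H: "H = (k1 + k2) / 2" by blast
  have "(e - 1 * E) * (g - 1 * G) - (f - 1 * F) * (f - 1 * F)
     - ((e - - 1 * E) * (g - - 1 * G) - (f - - 1 * F) * (f - - 1 * F))
     = (E * G - F * F) * (k1 - 1) * (k2 - 1) - (E * G - F * F) * (k1 - - 1) * (k2 - - 1)"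
    unfolding k ..
  then show ?R unfolding H by (simp add: algebra_simps)
next
  assume R: ?R
  define \<Delta> where "\<Delta> = E * G - F * F"
  define X where "X = e * G - 2 * f * F + g * E"
  have \<Delta>: "\<Delta> > 0" using D by (simp add: \<Delta>_def)
  have X: "X = 2 * H * \<Delta>" using R by (simp add: X_def \<Delta>_def)
  have disc: "0 \<le> X\<^sup>2 - 4 * \<Delta> * (e * g - f * f)"
  proof -
    have "E\<^sup>2 * (X\<^sup>2 - 4 * \<Delta> * (e * g - f * f)) = (2 * \<Delta> * e - E * X)\<^sup>2 + 4 * \<Delta> * (f * E - e * F)\<^sup>2"
      unfolding X_def \<Delta>_def by (simp add: power2_eq_square algebra_simps)
    also have "\<dots> \<ge> 0" using \<Delta> by simp
    finally show ?thesis using assms(1) by (simp add: zero_le_mult_iff)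
  qed
  define d where "d = sqrt (X\<^sup>2 - 4 * \<Delta> * (e * g - f * f)) / (2 * \<Delta>)"
  have d2: "\<Delta> * (4 * \<Delta> * d\<^sup>2) = \<Delta> * (4 * \<Delta> * H\<^sup>2 - 4 * (e * g - f * f))"
    using disc \<Delta> unfolding d_def X by (simp add: power_divide field_simps power2_eq_square)
  then have d2: "\<Delta> * d\<^sup>2 = \<Delta> * H\<^sup>2 - (e * g - f * f)" using \<Delta> by simp
  show ?L
  proof (intro exI conjI allI)
    show "H = ((H + d) + (H - d)) / 2" by simp
    fix k
    have "(e - k * E) * (g - k * G) - (f - k * F) * (f - k * F) = (e * g - f * f) - k * X + \<Delta> * k\<^sup>2"
      unfolding X_def \<Delta>_def by (simp add: power2_eq_square algebra_simps)
    also have "\<dots> = \<Delta> * (H + d - k) * (H - d - k)"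
    proof -
      have "\<Delta> * (H + d - k) * (H - d - k) = \<Delta> * H\<^sup>2 - \<Delta> * d\<^sup>2 - k * X + \<Delta> * k\<^sup>2"
        unfolding X by (simp add: power2_eq_square algebra_simps)
      then show ?thesis unfolding d2 by simp
    qed
    finally show "(e - k * E) * (g - k * G) - (f - k * F) * (f - k * F)
            = (E * G - F * F) * (H + d - k) * (H - d - k)" by (simp add: \<Delta>_def)
  qed
qed

locale arc_length_curve =
  fixes \<alpha> \<alpha>' \<alpha>'' :: "real \<Rightarrow> real^2"
  assumes d1: "\<And>s. (\<alpha> has_vector_derivative \<alpha>' s) (at s)"
    and d2: "\<And>s. (\<alpha>' has_vector_derivative \<alpha>'' s) (at s)"
    and unit: "\<And>s. norm (\<alpha>' s) = 1"
begin

definition \<xi>\<^sub>1 :: "real \<Rightarrow> real" where "\<xi>\<^sub>1 s = \<alpha> s $ 1 * \<alpha>' s $ 1 + \<alpha> s $ 2 * \<alpha>' s $ 2"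
definition \<xi>\<^sub>2 :: "real \<Rightarrow> real" where "\<xi>\<^sub>2 s = - \<alpha> s $ 1 * \<alpha>' s $ 2 + \<alpha> s $ 2 * \<alpha>' s $ 1"
definition \<kappa> :: "real \<Rightarrow> real" where "\<kappa> s = \<alpha>' s $ 1 * \<alpha>'' s $ 2 - \<alpha>' s $ 2 * \<alpha>'' s $ 1"

lemma unit_components: "(\<alpha>' s $ 1)\<^sup>2 + (\<alpha>' s $ 2)\<^sup>2 = 1"
  using unit[of s] by (simp add: norm_eq_1 inner_vec_def sum_2 power2_eq_square)

lemmas DERIV_\<alpha> = has_vector_derivative_nth[OF d1] and DERIV_\<alpha>' = has_vector_derivative_nth[OF d2]

text \<open>Differentiating \<open>\<bar>\<alpha>'\<bar>\<^sup>2 = 1\<close> shows that \<open>\<alpha>''\<close> is a multiple of the normal.\<close>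
lemma frenet: "\<alpha>'' s $ 1 = - \<kappa> s * \<alpha>' s $ 2" "\<alpha>'' s $ 2 = \<kappa> s * \<alpha>' s $ 1"
proof -
  define a b p q where "a = \<alpha>' s $ 1" "b = \<alpha>' s $ 2" "p = \<alpha>'' s $ 1" "q = \<alpha>'' s $ 2"
  note defs = this
  have "((\<lambda>s. (\<alpha>' s $ 1)\<^sup>2 + (\<alpha>' s $ 2)\<^sup>2) has_real_derivative 2 * (a * p + b * q)) (at s)"
    unfolding defs by (auto intro!: derivative_eq_intros DERIV_\<alpha>' simp: algebra_simps)
  moreover have "((\<lambda>s. (\<alpha>' s $ 1)\<^sup>2 + (\<alpha>' s $ 2)\<^sup>2) has_real_derivative 0) (at s)"
    unfolding unit_components by (rule DERIV_const)
  ultimately have o: "a * p + b * q = 0" using DERIV_unique by fastforce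
  have n: "a\<^sup>2 + b\<^sup>2 = 1" using unit_components[of s] by (simp add: defs)
  have "p = - (a * q - b * p) * b" "q = (a * q - b * p) * a"
    using o n by algebra+
  then show "\<alpha>'' s $ 1 = - \<kappa> s * \<alpha>' s $ 2" "\<alpha>'' s $ 2 = \<kappa> s * \<alpha>' s $ 1"
    by (simp_all add: \<kappa>_def defs)
qed

lemma DERIV_\<xi>\<^sub>1: "(\<xi>\<^sub>1 has_real_derivative 1 + \<kappa> s * \<xi>\<^sub>2 s) (at s)"
proof -
  have "(\<xi>\<^sub>1 has_real_derivative (\<alpha>' s $ 1)\<^sup>2 + (\<alpha>' s $ 2)\<^sup>2 + (\<alpha> s $ 1 * \<alpha>'' s $ 1 + \<alpha> s $ 2 * \<alpha>'' s $ 2)) (at s)"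
    unfolding \<xi>\<^sub>1_def[abs_def]
    by (auto intro!: derivative_eq_intros DERIV_\<alpha> DERIV_\<alpha>' simp: power2_eq_square algebra_simps)
  then show ?thesis unfolding unit_components by (simp add: frenet \<xi>\<^sub>2_def algebra_simps)
qed

lemma DERIV_\<xi>\<^sub>2: "(\<xi>\<^sub>2 has_real_derivative - (\<kappa> s * \<xi>\<^sub>1 s)) (at s)"
proof -
  have "(\<xi>\<^sub>2 has_real_derivative - \<alpha> s $ 1 * \<alpha>'' s $ 2 + \<alpha> s $ 2 * \<alpha>'' s $ 1) (at s)"
    unfolding \<xi>\<^sub>2_def[abs_def]
    by (auto intro!: derivative_eq_intros DERIV_\<alpha> DERIV_\<alpha>' simp: algebra_simps)
  then show ?thesis by (simp add: frenet \<xi>\<^sub>1_def algebra_simps)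
qed

lemma norm_\<xi>: "(\<xi>\<^sub>1 s)\<^sup>2 + (\<xi>\<^sub>2 s)\<^sup>2 = (\<alpha> s $ 1)\<^sup>2 + (\<alpha> s $ 2)\<^sup>2"
proof -
  have "(\<xi>\<^sub>1 s)\<^sup>2 + (\<xi>\<^sub>2 s)\<^sup>2 = ((\<alpha> s $ 1)\<^sup>2 + (\<alpha> s $ 2)\<^sup>2) * ((\<alpha>' s $ 1)\<^sup>2 + (\<alpha>' s $ 2)\<^sup>2)"
    by (simp add: \<xi>\<^sub>1_def \<xi>\<^sub>2_def power2_eq_square algebra_simps)
  then show ?thesis by (simp add: unit_components)
qed

lemma treadmill_sled: "treadmill_sled \<alpha> s = - vector [\<xi>\<^sub>1 s, \<xi>\<^sub>2 s]"
  using treadmill_sled_eq[of \<alpha> s] unit[of s]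
  by (simp add: vector_derivative_at[OF d1] \<xi>\<^sub>1_def \<xi>\<^sub>2_def)

lemma d_fst_twizzler: "d_fst (twizzler_map w \<alpha>) = (\<lambda>s t. vector
   [\<alpha>' s $ 1 * cos (w * t) + \<alpha>' s $ 2 * sin (w * t), 0, - \<alpha>' s $ 1 * sin (w * t) + \<alpha>' s $ 2 * cos (w * t)])"
  unfolding d_fst_def twizzler_map_def
  by (intro ext vector_derivative_at has_vector_derivative_vector_3)
     (auto intro!: derivative_eq_intros DERIV_\<alpha>)

lemma d_snd_twizzler: "d_snd (twizzler_map w \<alpha>) = (\<lambda>s t. vector
   [w * (- \<alpha> s $ 1 * sin (w * t) + \<alpha> s $ 2 * cos (w * t)), 1,
    w * (- \<alpha> s $ 1 * cos (w * t) - \<alpha> s $ 2 * sin (w * t))])"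
  unfolding d_snd_def twizzler_map_def
  by (intro ext vector_derivative_at has_vector_derivative_vector_3)
     (auto intro!: derivative_eq_intros simp: algebra_simps)

lemma d_fst_fst_twizzler: "d_fst (d_fst (twizzler_map w \<alpha>)) s t = vector
   [\<alpha>'' s $ 1 * cos (w * t) + \<alpha>'' s $ 2 * sin (w * t), 0, - \<alpha>'' s $ 1 * sin (w * t) + \<alpha>'' s $ 2 * cos (w * t)]"
  unfolding d_fst_twizzler unfolding d_fst_def
  by (intro vector_derivative_at has_vector_derivative_vector_3)
     (auto intro!: derivative_eq_intros DERIV_\<alpha>')

lemma d_snd_fst_twizzler: "d_snd (d_fst (twizzler_map w \<alpha>)) s t = vector
   [w * (- \<alpha>' s $ 1 * sin (w * t) + \<alpha>' s $ 2 * cos (w * t)), 0,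
    w * (- \<alpha>' s $ 1 * cos (w * t) - \<alpha>' s $ 2 * sin (w * t))]"
  unfolding d_fst_twizzler unfolding d_snd_def
  by (intro vector_derivative_at has_vector_derivative_vector_3)
     (auto intro!: derivative_eq_intros simp: algebra_simps)

lemma d_fst_snd_twizzler: "d_fst (d_snd (twizzler_map w \<alpha>)) s t = vector
   [w * (- \<alpha>' s $ 1 * sin (w * t) + \<alpha>' s $ 2 * cos (w * t)), 0,
    w * (- \<alpha>' s $ 1 * cos (w * t) - \<alpha>' s $ 2 * sin (w * t))]"
  unfolding d_snd_twizzler unfolding d_fst_def
  by (intro vector_derivative_at has_vector_derivative_vector_3)
     (auto intro!: derivative_eq_intros DERIV_\<alpha> simp: algebra_simps)

lemma d_snd_snd_twizzler: "d_snd (d_snd (twizzler_map w \<alpha>)) s t = vector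
   [w * (w * (- \<alpha> s $ 1 * cos (w * t) - \<alpha> s $ 2 * sin (w * t))), 0,
    w * (w * (\<alpha> s $ 1 * sin (w * t) - \<alpha> s $ 2 * cos (w * t)))]"
  unfolding d_snd_twizzler unfolding d_snd_def
  by (intro vector_derivative_at has_vector_derivative_vector_3)
     (auto intro!: derivative_eq_intros simp: algebra_simps)

lemma twizzler_cross: "cross3 (d_fst (twizzler_map w \<alpha>) s t) (d_snd (twizzler_map w \<alpha>) s t) = vector
   [\<alpha>' s $ 1 * sin (w * t) - \<alpha>' s $ 2 * cos (w * t), w * \<xi>\<^sub>1 s,
    \<alpha>' s $ 1 * cos (w * t) + \<alpha>' s $ 2 * sin (w * t)]"
proof -
  define a b x z c d where "a = \<alpha>' s $ 1" "b = \<alpha>' s $ 2" "x = \<alpha> s $ 1" "z = \<alpha> s $ 2"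
    "c = cos (w * t)" "d = sin (w * t)"
  note defs = this
  have cd: "c * c + d * d = 1" by (simp add: defs)
  have "(- a * d + b * c) * (w * (- x * d + z * c)) - (a * c + b * d) * (w * (- x * c - z * d))
      = w * (x * a + z * b) * (c * c + d * d)"
    by (simp add: algebra_simps)
  then have "(- a * d + b * c) * (w * (- x * d + z * c)) - (a * c + b * d) * (w * (- x * c - z * d))
      = w * (x * a + z * b)" unfolding cd by simp
  then show ?thesis
    unfolding d_fst_twizzler d_snd_twizzler defs cross3_def \<xi>\<^sub>1_def
    by (simp add: vec_eq_iff forall_3)
qed

lemma twizzler_cross_norm: 
  "norm (cross3 (d_fst (twizzler_map w \<alpha>) s t) (d_snd (twizzler_map w \<alpha>) s t)) = sqrt (1 + w\<^sup>2 * (\<xi>\<^sub>1 s)\<^sup>2)"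
proof -
  define a b c d where "a = \<alpha>' s $ 1" "b = \<alpha>' s $ 2" "c = cos (w * t)" "d = sin (w * t)"
  note defs = this
  have cd: "c * c + d * d = 1" "a * a + b * b = 1"
    using unit_components[of s] by (simp_all add: defs power2_eq_square)
  have "(a * d - b * c)\<^sup>2 + (a * c + b * d)\<^sup>2 = (c * c + d * d) * (a * a + b * b)"
    by (simp add: power2_eq_square algebra_simps)
  then have "(a * d - b * c)\<^sup>2 + (a * c + b * d)\<^sup>2 = 1" unfolding cd by simp
  then show ?thesis
    unfolding twizzler_cross defs norm_eq_sqrt_inner
    by (simp add: inner_vec_def sum_3 power2_eq_square)
qed

lemma twizzler_cross_nonzero:
  "cross3 (d_fst (twizzler_map w \<alpha>) s t) (d_snd (twizzler_map w \<alpha>) s t) \<noteq> 0"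
proof -
  have "norm (cross3 (d_fst (twizzler_map w \<alpha>) s t) (d_snd (twizzler_map w \<alpha>) s t)) > 0"
    unfolding twizzler_cross_norm using one_plus_square_pos[of w "\<xi>\<^sub>1 s"] by simp
  then show ?thesis by (metis norm_zero less_irrefl)
qed

text \<open>With \<open>D = sqrt (1 + w\<^sup>2 \<xi>\<^sub>1\<^sup>2)\<close> the first fundamental form is \<open>E = 1\<close>, \<open>F = w \<xi>\<^sub>2\<close>,
  \<open>G = 1 + w\<^sup>2 (\<xi>\<^sub>1\<^sup>2 + \<xi>\<^sub>2\<^sup>2)\<close> with determinant \<open>D\<^sup>2\<close>, and the second is \<open>e = \<kappa> / D\<close>, \<open>f = - w / D\<close>,
  \<open>g = - w\<^sup>2 \<xi>\<^sub>2 / D\<close>. None of them depends on \<open>t\<close>, the surface being invariant under screw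
  motions.\<close>
lemma mean_curvature_iff:
  "has_mean_curvature (twizzler_map w \<alpha>) s t H \<longleftrightarrow>
     \<kappa> s * (1 + w\<^sup>2 * ((\<xi>\<^sub>1 s)\<^sup>2 + (\<xi>\<^sub>2 s)\<^sup>2)) + w\<^sup>2 * \<xi>\<^sub>2 s = 2 * H * sqrt (1 + w\<^sup>2 * (\<xi>\<^sub>1 s)\<^sup>2) ^ 3"
proof -
  define a b x z c d k D where defs: "a = \<alpha>' s $ 1" "b = \<alpha>' s $ 2" "x = \<alpha> s $ 1" "z = \<alpha> s $ 2"
    "c = cos (w * t)" "d = sin (w * t)" "k = \<kappa> s" "D = sqrt (1 + w\<^sup>2 * (\<xi>\<^sub>1 s)\<^sup>2)"
  define G where "G = 1 + w\<^sup>2 * ((\<xi>\<^sub>1 s)\<^sup>2 + (\<xi>\<^sub>2 s)\<^sup>2)"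
  have D: "D > 0" "D\<^sup>2 = 1 + w\<^sup>2 * (\<xi>\<^sub>1 s)\<^sup>2"
    using one_plus_square_pos[of w "\<xi>\<^sub>1 s"] by (auto simp: defs)
  have cd: "c * c + d * d = 1" "a * a + b * b = 1"
    using unit_components[of s] by (simp_all add: defs power2_eq_square)
  let ?\<phi> = "twizzler_map w \<alpha>"
  have normal: "unit_normal ?\<phi> s t = (1 / D) *\<^sub>R vector [a * d - b * c, w * \<xi>\<^sub>1 s, a * c + b * d]"
    unfolding unit_normal_def sgn_div_norm twizzler_cross_norm unfolding twizzler_cross
    by (simp add: defs divide_inverse)
  have E1: "d_fst ?\<phi> s t \<bullet> d_fst ?\<phi> s t = 1"
  proof -
    have "(a * c + b * d) * (a * c + b * d) + (- a * d + b * c) * (- a * d + b * c) = (c * c + d * d) * (a * a + b * b)"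
      by (simp add: algebra_simps)
    then show ?thesis unfolding d_fst_twizzler cd by (simp add: inner_vec_def sum_3 defs)
  qed
  have F1: "d_fst ?\<phi> s t \<bullet> d_snd ?\<phi> s t = w * \<xi>\<^sub>2 s"
  proof -
    have "(a * c + b * d) * (w * (- x * d + z * c)) + (- a * d + b * c) * (w * (- x * c - z * d))
       = w * (- x * b + z * a) * (c * c + d * d)"
      by (simp add: algebra_simps)
    then show ?thesis unfolding d_fst_twizzler d_snd_twizzler cd \<xi>\<^sub>2_def by (simp add: inner_vec_def sum_3 defs)
  qed
  have G1: "d_snd ?\<phi> s t \<bullet> d_snd ?\<phi> s t = G"
  proof -
    have "w * (- x * d + z * c) * (w * (- x * d + z * c)) + 1 + w * (- x * c - z * d) * (w * (- x * c - z * d))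
       = 1 + w\<^sup>2 * ((x\<^sup>2 + z\<^sup>2) * (c * c + d * d))"
      by (simp add: algebra_simps power2_eq_square)
    then show ?thesis unfolding d_snd_twizzler cd G_def norm_\<xi> by (simp add: inner_vec_def sum_3 defs)
  qed
  have e2: "d_fst (d_fst ?\<phi>) s t \<bullet> unit_normal ?\<phi> s t = k / D"
  proof -
    have "((- k * b) * c + (k * a) * d) * (a * d - b * c) + (- (- k * b) * d + (k * a) * c) * (a * c + b * d)
       = k * ((c * c + d * d) * (a * a + b * b))"
      by (simp add: algebra_simps)
    then have "d_fst (d_fst ?\<phi>) s t \<bullet> vector [a * d - b * c, w * \<xi>\<^sub>1 s, a * c + b * d] = k"
      unfolding d_fst_fst_twizzler frenet cd by (simp add: inner_vec_def sum_3 defs)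
    then show ?thesis by (simp add: normal)
  qed
  have f2: "w * (- a * d + b * c) * (a * d - b * c) + w * (- a * c - b * d) * (a * c + b * d) = - w"
  proof -
    have "w * (- a * d + b * c) * (a * d - b * c) + w * (- a * c - b * d) * (a * c + b * d)
       = - w * ((c * c + d * d) * (a * a + b * b))"
      by (simp add: algebra_simps)
    then show ?thesis unfolding cd by simp
  qed
  have f3: "d_fst (d_snd ?\<phi>) s t \<bullet> unit_normal ?\<phi> s t = - w / D"
     "d_snd (d_fst ?\<phi>) s t \<bullet> unit_normal ?\<phi> s t = - w / D"
    unfolding d_fst_snd_twizzler d_snd_fst_twizzler normal f2[symmetric]
    by (simp_all add: inner_vec_def sum_3 defs add_divide_distrib)
  have g2: "d_snd (d_snd ?\<phi>) s t \<bullet> unit_normal ?\<phi> s t = - (w\<^sup>2 * \<xi>\<^sub>2 s) / D"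
  proof -
    have "w * (w * (- x * c - z * d)) * (a * d - b * c) + w * (w * (x * d - z * c)) * (a * c + b * d)
       = - (w\<^sup>2 * (- x * b + z * a)) * (c * c + d * d)"
      by (simp add: algebra_simps power2_eq_square)
    then have "w * (w * (- x * c - z * d)) * (a * d - b * c) + w * (w * (x * d - z * c)) * (a * c + b * d)
       = - (w\<^sup>2 * \<xi>\<^sub>2 s)" unfolding cd by (simp add: \<xi>\<^sub>2_def defs)
    then show ?thesis unfolding d_snd_snd_twizzler normal
      by (simp add: inner_vec_def sum_3 defs add_divide_distrib[symmetric])
  qed
  let ?F = "w * \<xi>\<^sub>2 s"
  have gram: "1 * G - ?F * ?F = D\<^sup>2"
    unfolding G_def D by (simp add: power2_eq_square algebra_simps)
  have "has_mean_curvature ?\<phi> s t H \<longleftrightarrow>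
     (\<exists>k1 k2. (\<forall>l. (k / D - l * 1) * (- (w\<^sup>2 * \<xi>\<^sub>2 s) / D - l * G) - (- w / D - l * ?F) * (- w / D - l * ?F)
            = (1 * G - ?F * ?F) * (k1 - l) * (k2 - l)) \<and> H = (k1 + k2) / 2)"
    unfolding has_mean_curvature_def principal_curvatures_def first_form_def second_form_def
      inner_commute[of "d_snd ?\<phi> s t" "d_fst ?\<phi> s t"] E1 F1 G1 e2 f3 g2 det_2
    by simp
  also have "\<dots> \<longleftrightarrow> k / D * G - 2 * (- w / D) * ?F + - (w\<^sup>2 * \<xi>\<^sub>2 s) / D * 1 = 2 * H * (1 * G - ?F * ?F)"
    by (rule curvature_sum_of_forms) (use gram D(1) in auto)
  also have "\<dots> \<longleftrightarrow> (k * G + w\<^sup>2 * \<xi>\<^sub>2 s) / D = 2 * H * D ^ 3 / D"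
  proof -
    have "k / D * G - 2 * (- w / D) * ?F + - (w\<^sup>2 * \<xi>\<^sub>2 s) / D * 1 = (k * G + w\<^sup>2 * \<xi>\<^sub>2 s) / D"
      using D(1) by (simp add: field_simps power2_eq_square)
    moreover have "2 * H * D\<^sup>2 = 2 * H * D ^ 3 / D"
      using D(1) by (simp add: power2_eq_square power3_eq_cube)
    ultimately show ?thesis unfolding gram by (simp only:)
  qed
  also have "\<dots> \<longleftrightarrow> k * G + w\<^sup>2 * \<xi>\<^sub>2 s = 2 * H * D ^ 3"
    using D(1) by simp
  finally show ?thesis by (simp add: G_def defs)
qed

lemma mean_curvature_1_iff:
  "has_mean_curvature (twizzler_map w \<alpha>) s t 1 \<longleftrightarrow> \<kappa> s = curv w (\<xi>\<^sub>1 s) (\<xi>\<^sub>2 s)"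
proof -
  have "1 + w\<^sup>2 * ((\<xi>\<^sub>1 s)\<^sup>2 + (\<xi>\<^sub>2 s)\<^sup>2) > 0" by (intro add_pos_nonneg) auto
  then show ?thesis
    unfolding mean_curvature_iff curv_eq by (auto simp: eq_divide_eq)
qed

end

section \<open>Plane rotations\<close>

lemma plane_rot_mult: "plane_rot t *v p = vector [cos t * p $ 1 - sin t * p $ 2, sin t * p $ 1 + cos t * p $ 2]"
  by (simp add: plane_rot_def matrix_vector_mult_def vec_eq_iff forall_2 sum_2)

lemma plane_rot_nth:
  "(plane_rot t *v p) $ 1 = cos t * p $ 1 - sin t * p $ 2"
  "(plane_rot t *v p) $ 2 = sin t * p $ 1 + cos t * p $ 2"
  by (simp_all add: plane_rot_mult)

lemma plane_rot_add: "plane_rot (a + b) *v p = plane_rot a *v (plane_rot b *v p)"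
  by (simp add: vec_eq_iff forall_2 plane_rot_nth cos_add sin_add algebra_simps)

lemma plane_rot_0: "plane_rot 0 *v p = p"
  by (simp add: vec_eq_iff forall_2 plane_rot_nth)

lemma plane_rot_eq_iff: "plane_rot a = plane_rot b \<longleftrightarrow> (\<exists>n::int. a = b + 2 * pi * n)"
proof -
  have "plane_rot a = plane_rot b \<longleftrightarrow> sin a = sin b \<and> cos a = cos b"
    by (auto simp: plane_rot_def vec_eq_iff forall_2)
  also have "\<dots> \<longleftrightarrow> (\<exists>n::int. a = b + 2 * pi * n)"
    unfolding sin_cos_eq_iff by (auto simp: mult.commute mult.left_commute)
  finally show ?thesis .
qed

lemma plane_rot_fixes:
  assumes "plane_rot a *v p = p" "p \<noteq> 0"
  obtains n :: int where "a = 2 * pi * n"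
proof -
  define x y where "x = p $ 1" "y = p $ 2"
  have e: "cos a * x - sin a * y = x" "sin a * x + cos a * y = y"
    using assms(1) by (simp_all add: vec_eq_iff forall_2 plane_rot_nth x_y_def)
  have nz: "x\<^sup>2 + y\<^sup>2 \<noteq> 0" using assms(2) by (auto simp: vec_eq_iff forall_2 x_y_def)
  have "(cos a - 1) * (x\<^sup>2 + y\<^sup>2) = (cos a * x - sin a * y - x) * x + (sin a * x + cos a * y - y) * y"
    by (simp add: power2_eq_square algebra_simps)
  then have "(cos a - 1) * (x\<^sup>2 + y\<^sup>2) = 0" unfolding e by simp
  with nz have "cos a = 1" by (metis eq_iff_diff_eq_0 mult_eq_0_iff)
  then show thesis using that cos_one_2pi_int by (metis mult.assoc mult.commute)
qed

lemma plane_rot_exists: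
  fixes p q :: "real^2"
  assumes "(p $ 1)\<^sup>2 + (p $ 2)\<^sup>2 = (q $ 1)\<^sup>2 + (q $ 2)\<^sup>2"
  obtains b where "q = plane_rot b *v p"
proof (cases "p = 0")
  case True
  then have "q = 0" using assms by (simp add: vec_eq_iff forall_2)
  with True that[of 0] show thesis by (simp add: plane_rot_0)
next
  case False
  define x y u v where "x = p $ 1" "y = p $ 2" "u = q $ 1" "v = q $ 2"
  note defs = this
  define r where "r = x\<^sup>2 + y\<^sup>2"
  have r: "r \<noteq> 0" "u\<^sup>2 + v\<^sup>2 = r" using False assms by (auto simp: r_def defs vec_eq_iff forall_2)
  have "((x * u + y * v) / r)\<^sup>2 + ((x * v - y * u) / r)\<^sup>2 = ((x\<^sup>2 + y\<^sup>2) * (u\<^sup>2 + v\<^sup>2)) / r\<^sup>2"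
    by (simp add: power_divide add_divide_distrib[symmetric]) (simp add: power2_eq_square algebra_simps)
  then have "((x * u + y * v) / r)\<^sup>2 + ((x * v - y * u) / r)\<^sup>2 = 1"
    using r(1) unfolding r(2) r_def[symmetric] by (simp add: power2_eq_square)
  from sincos_total_2pi[OF this] obtain b where b: "(x * u + y * v) / r = cos b" "(x * v - y * u) / r = sin b"
    by metis
  have "cos b * x - sin b * y = u" "sin b * x + cos b * y = v"
  proof -
    have "cos b * x - sin b * y = ((x * u + y * v) * x - (x * v - y * u) * y) / r"
      "sin b * x + cos b * y = ((x * v - y * u) * x + (x * u + y * v) * y) / r"
      unfolding b[symmetric] by (simp_all add: diff_divide_distrib add_divide_distrib distrib_right left_diff_distrib)
    moreover have "(x * u + y * v) * x - (x * v - y * u) * y = u * r"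
      "(x * v - y * u) * x + (x * u + y * v) * y = v * r"
      by (simp_all add: r_def power2_eq_square algebra_simps)
    ultimately have "cos b * x - sin b * y = u * r / r" "sin b * x + cos b * y = v * r / r"
      by (simp_all only:)
    then show "cos b * x - sin b * y = u" "sin b * x + cos b * y = v" using r by simp_all
  qed
  then have "q = plane_rot b *v p" by (simp add: vec_eq_iff forall_2 plane_rot_nth defs)
  then show thesis by (rule that)
qed

lemma shift_int_multiple:
  fixes f :: "real \<Rightarrow> real"
  assumes "\<And>s. f (s + L) = f s + d"
  shows "f (s + of_int n * L) = f s + of_int n * d"
proof (induction n rule: int_induct[of _ 0])
  case (step1 n)
  then show ?case using assms[of "s + of_int n * L"] by (simp add: algebra_simps)
next
  case (step2 n)
  then show ?case using assms[of "s + of_int (n - 1) * L"] by (simp add: algebra_simps)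
qed simp

lemma rotation_int_multiple:
  assumes "\<And>s. \<alpha> (s + L) = plane_rot \<theta> *v \<alpha> s"
  shows "\<alpha> (s + of_int n * L) = plane_rot (of_int n * \<theta>) *v \<alpha> s"
proof (induction n rule: int_induct[of _ 0])
  case base
  show ?case by (simp add: plane_rot_0)
next
  case (step1 n)
  have "\<alpha> (s + of_int (n + 1) * L) = plane_rot \<theta> *v \<alpha> (s + of_int n * L)"
    using assms[of "s + of_int n * L"] by (simp add: algebra_simps)
  then show ?case unfolding step1.IH plane_rot_add[symmetric] by (simp add: algebra_simps)
next
  case (step2 n)
  have "plane_rot \<theta> *v \<alpha> (s + of_int (n - 1) * L) = plane_rot (of_int n * \<theta>) *v \<alpha> s"
    using assms[of "s + of_int (n - 1) * L"] step2.IH by (simp add: algebra_simps)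
  then have "plane_rot (- \<theta>) *v (plane_rot \<theta> *v \<alpha> (s + of_int (n - 1) * L))
      = plane_rot (- \<theta>) *v (plane_rot (of_int n * \<theta>) *v \<alpha> s)" by simp
  then show ?case unfolding plane_rot_add[symmetric] by (simp add: plane_rot_0 algebra_simps)
qed

section \<open>Profile curves and their lifts\<close>
text \<open>The tangent of the profile curve has the angle \<open>J (\<phi> s)\<close>, where \<open>J\<close> is any antiderivative of
  \<open>turn_rate\<close>; its constant of integration is the freedom of rotating the profile curve.\<close>
locale lifted_profile = twizzler_parameters +
  fixes \<alpha> :: "real \<Rightarrow> real^2" and \<phi> J :: "real \<Rightarrow> real"
  assumes d\<phi>: "\<And>s. (\<phi> has_real_derivative 2 / excess_root M w (\<phi> s)) (at s)"
    and dJ: "\<And>u. (J has_real_derivative turn_rate u) (at u)"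
    and \<alpha>: "\<And>s. \<alpha> s = plane_rot (J (\<phi> s)) *v vector [\<Xi>\<^sub>1 M w (\<phi> s), \<Xi>\<^sub>2 M w (\<phi> s)]"
    and sled: "\<And>s. treadmill_sled \<alpha> s = - vector [\<Xi>\<^sub>1 M w (\<phi> s), \<Xi>\<^sub>2 M w (\<phi> s)]"

text \<open>The tangent angle \<open>\<tau>\<close> and \<open>J \<circ> \<phi>\<close> both have the derivative \<open>\<kappa>\<close>, so that a suitable \<open>J\<close> makes
  them equal.\<close>
lemma twizzler_profile_lift:
  assumes par: "twizzler_parameters M w" and wv: "w = twizzler_w v" and prof: "twizzler_profile M v \<alpha>"
  obtains \<phi> J where "lifted_profile M w \<alpha> \<phi> J"
proof -
  interpret twizzler_parameters M w by (rule par)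
  obtain \<alpha>' \<alpha>'' where d: "\<And>s. (\<alpha> has_vector_derivative \<alpha>' s) (at s)"
      "\<And>s. (\<alpha>' has_vector_derivative \<alpha>'' s) (at s)" "continuous_on UNIV \<alpha>''"
    and unit: "\<And>s. norm (vector_derivative \<alpha> (at s)) = 1"
    and H: "\<And>s t. has_mean_curvature (twizzler_map w \<alpha>) s t 1"
    and sl: "\<And>s. treadmill_sled \<alpha> s \<in> uminus ` level_curve w M"
    using prof unfolding twizzler_profile_def wv[symmetric] by blast
  interpret arc_length_curve \<alpha> \<alpha>' \<alpha>''
    using d unit by unfold_locales (auto simp: vector_derivative_at[OF d(1)])
  have curv: "\<kappa> s = curv w (\<xi>\<^sub>1 s) (\<xi>\<^sub>2 s)" for s
    using H[of s 0] by (simp add: mean_curvature_1_iff)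
  have lev: "h w (\<xi>\<^sub>1 s) (\<xi>\<^sub>2 s) = M" for s
  proof -
    obtain p where "p \<in> level_curve w M" "- vector [\<xi>\<^sub>1 s, \<xi>\<^sub>2 s] = - p"
      using sl[of s] unfolding treadmill_sled by blast
    then have "vector [\<xi>\<^sub>1 s, \<xi>\<^sub>2 s] \<in> level_curve w M" by simp
    then show ?thesis by (simp add: level_curve_def)
  qed
  have d1: "(\<xi>\<^sub>1 has_real_derivative 1 * f\<^sub>1 w (\<xi>\<^sub>1 s) (\<xi>\<^sub>2 s)) (at s)" for s
    using DERIV_\<xi>\<^sub>1[of s] by (simp add: f\<^sub>1_curv curv)
  have d2: "(\<xi>\<^sub>2 has_real_derivative 1 * f\<^sub>2 w (\<xi>\<^sub>1 s) (\<xi>\<^sub>2 s)) (at s)" for s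
    using DERIV_\<xi>\<^sub>2[of s] by (simp add: f\<^sub>2_curv curv)
  from level_curve_lift[OF lev continuous_on_const d1 d2] obtain \<phi> where \<phi>:
    "\<And>s. \<xi>\<^sub>1 s = \<Xi>\<^sub>1 M w (\<phi> s)" "\<And>s. \<xi>\<^sub>2 s = \<Xi>\<^sub>2 M w (\<phi> s)"
    "\<And>s. (\<phi> has_real_derivative 2 * 1 / excess_root M w (\<phi> s)) (at s)" by blast
  have cont: "continuous_on UNIV \<kappa>"
    unfolding \<kappa>_def using d(3) has_vector_derivative_continuous[OF d(2)]
    by (intro continuous_intros) (auto intro!: continuous_at_imp_continuous_on)
  have t1: "((\<lambda>s. \<alpha>' s $ 1) has_real_derivative - \<alpha>' s $ 2 * \<kappa> s) (at s)"
    and t2: "((\<lambda>s. \<alpha>' s $ 2) has_real_derivative \<alpha>' s $ 1 * \<kappa> s) (at s)" for s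
    using DERIV_\<alpha>'[of 1 s] DERIV_\<alpha>'[of 2 s] by (simp_all add: frenet mult.commute)
  obtain \<tau> where \<tau>: "\<And>s. (\<tau> has_real_derivative \<kappa> s) (at s)" "\<And>s. \<alpha>' s $ 1 = cos (\<tau> s)"
    "\<And>s. \<alpha>' s $ 2 = sin (\<tau> s)"
    using angle_lift[OF t1 t2 cont unit_components] by blast
  obtain J0 where J0: "\<And>u. (J0 has_real_derivative turn_rate u) (at u)"
    using turn_rate_antiderivative by blast
  have J1: "((\<lambda>s. J0 (\<phi> s)) has_real_derivative \<kappa> s) (at s)" for s
  proof -
    have "((\<lambda>s. J0 (\<phi> s)) has_real_derivative turn_rate (\<phi> s) * (2 * 1 / excess_root M w (\<phi> s))) (at s)"
      by (rule DERIV_chain2[OF J0 \<phi>(3)])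
    then show ?thesis
      unfolding curv_\<Xi>[symmetric] curv \<phi>(1,2) using excess_root_pos[of M w "\<phi> s"] by simp
  qed
  define J where "J u = J0 u + (\<tau> 0 - J0 (\<phi> 0))" for u
  have J: "J (\<phi> s) = \<tau> s" for s
    using equal_derivatives_difference[OF J1 \<tau>(1), of s 0] by (simp add: J_def)
  have "lifted_profile M w \<alpha> \<phi> J"
  proof unfold_locales
    show "(\<phi> has_real_derivative 2 / excess_root M w (\<phi> s)) (at s)" for s using \<phi>(3)[of s] by simp
    show "(J has_real_derivative turn_rate u) (at u)" for u
      unfolding J_def[abs_def] by (auto intro!: derivative_eq_intros J0)
    show "treadmill_sled \<alpha> s = - vector [\<Xi>\<^sub>1 M w (\<phi> s), \<Xi>\<^sub>2 M w (\<phi> s)]" for s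
      unfolding treadmill_sled \<phi>(1,2) ..
    fix s
    define a b x z where "a = \<alpha>' s $ 1" "b = \<alpha>' s $ 2" "x = \<alpha> s $ 1" "z = \<alpha> s $ 2"
    note defs = this
    have n: "a\<^sup>2 + b\<^sup>2 = 1" using unit_components[of s] by (simp add: defs)
    have "a * (x * a + z * b) - b * (- x * b + z * a) = x * (a\<^sup>2 + b\<^sup>2)"
      "b * (x * a + z * b) + a * (- x * b + z * a) = z * (a\<^sup>2 + b\<^sup>2)"
      by (simp_all add: power2_eq_square algebra_simps)
    then show "\<alpha> s = plane_rot (J (\<phi> s)) *v vector [\<Xi>\<^sub>1 M w (\<phi> s), \<Xi>\<^sub>2 M w (\<phi> s)]"
      unfolding J \<phi>(1,2)[symmetric] n
      by (simp add: vec_eq_iff forall_2 plane_rot_nth \<tau>(2,3)[symmetric] \<xi>\<^sub>1_def \<xi>\<^sub>2_def defs)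
  qed
  then show thesis by (rule that)
qed

text \<open>The lift satisfies \<open>\<phi>' = 2 / excess_root M w \<phi>\<close>, which \<open>inverse_flow\<close> solves. Placing
  \<open>(\<Xi>\<^sub>1, \<Xi>\<^sub>2)\<close> in the moving frame with tangent angle \<open>J (\<phi> s)\<close> gives a curve with exactly this
  tangent.\<close>
lemma (in twizzler_parameters) twizzler_profile_exists:
  assumes v: "w = twizzler_w v"
  shows "\<exists>\<alpha>. twizzler_profile M v \<alpha>"
proof -
  have "continuous_on UNIV (\<lambda>u. excess_root M w u / 2)" by (intro continuous_intros) auto
  then obtain \<phi> where "\<And>t. (\<phi> has_real_derivative 1 / (excess_root M w (\<phi> t) / 2)) (at t)"
    using inverse_flow[of "\<lambda>u. excess_root M w u / 2" "1 / 2"] excess_root_ge_1[of M w] by auto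
  then have \<phi>: "(\<phi> has_real_derivative 2 / excess_root M w (\<phi> t)) (at t)" for t by simp
  obtain J where J: "\<And>u. (J has_real_derivative turn_rate u) (at u)"
    using turn_rate_antiderivative by blast
  define x y k \<tau> where "x s = \<Xi>\<^sub>1 M w (\<phi> s)" and "y s = \<Xi>\<^sub>2 M w (\<phi> s)"
    and "k s = turn_rate (\<phi> s) * (2 / excess_root M w (\<phi> s))" and "\<tau> s = J (\<phi> s)" for s
  have P: "excess_root M w u \<noteq> 0" for u using excess_root_pos[of M w u] by simp
  have k: "k s = curv w (x s) (y s)" for s
    unfolding k_def x_def y_def curv_\<Xi>[symmetric] using P[of "\<phi> s"] by simp
  have d\<tau>: "(\<tau> has_real_derivative k s) (at s)" for s
    unfolding \<tau>_def[abs_def] k_def by (rule DERIV_chain2[OF J \<phi>])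
  have dx: "(x has_real_derivative 1 + k s * y s) (at s)" for s
    using DERIV_chain2[OF DERIV_\<Xi>(1) \<phi>, of s] P[of "\<phi> s"]
    by (simp add: x_def[abs_def] f\<^sub>1_curv k y_def)
  have dy: "(y has_real_derivative - (k s * x s)) (at s)" for s
    using DERIV_chain2[OF DERIV_\<Xi>(2) \<phi>, of s] P[of "\<phi> s"]
    by (simp add: x_def y_def[abs_def] f\<^sub>2_curv k)
  define \<alpha> :: "real \<Rightarrow> real^2" where
    "\<alpha> s = vector [cos (\<tau> s) * x s - sin (\<tau> s) * y s, sin (\<tau> s) * x s + cos (\<tau> s) * y s]" for s
  define \<alpha>' :: "real \<Rightarrow> real^2" where "\<alpha>' s = vector [cos (\<tau> s), sin (\<tau> s)]" for s
  define \<alpha>'' :: "real \<Rightarrow> real^2" where "\<alpha>'' s = vector [- sin (\<tau> s) * k s, cos (\<tau> s) * k s]" for s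
  have d1: "(\<alpha> has_vector_derivative \<alpha>' s) (at s)" for s
    unfolding \<alpha>_def[abs_def] \<alpha>'_def
    by (rule has_vector_derivative_vector_2)
       (auto intro!: derivative_eq_intros d\<tau> dx dy simp: algebra_simps)
  have d2: "(\<alpha>' has_vector_derivative \<alpha>'' s) (at s)" for s
    unfolding \<alpha>'_def[abs_def] \<alpha>''_def
    by (rule has_vector_derivative_vector_2) (auto intro!: derivative_eq_intros d\<tau>)
  have unit: "norm (\<alpha>' s) = 1" for s
    by (simp add: \<alpha>'_def norm_eq_1 inner_vec_def sum_2 flip: power2_eq_square)
  interpret arc_length_curve \<alpha> \<alpha>' \<alpha>'' by unfold_locales (rule d1 d2 unit)+
  have \<xi>: "\<xi>\<^sub>1 s = x s" "\<xi>\<^sub>2 s = y s" and \<kappa>: "\<kappa> s = k s" for s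
  proof -
    define c d where "c = cos (\<tau> s)" "d = sin (\<tau> s)"
    have n: "c\<^sup>2 + d\<^sup>2 = 1" by (simp add: c_d_def)
    have "(c * x s - d * y s) * c + (d * x s + c * y s) * d = x s * (c\<^sup>2 + d\<^sup>2)"
      "- (c * x s - d * y s) * d + (d * x s + c * y s) * c = y s * (c\<^sup>2 + d\<^sup>2)"
      "c * (c * k s) - d * (- d * k s) = k s * (c\<^sup>2 + d\<^sup>2)"
      by (simp_all add: power2_eq_square algebra_simps)
    then show "\<xi>\<^sub>1 s = x s" "\<xi>\<^sub>2 s = y s" "\<kappa> s = k s"
      unfolding n by (simp_all add: \<xi>\<^sub>1_def \<xi>\<^sub>2_def \<kappa>_def \<alpha>_def \<alpha>'_def \<alpha>''_def c_d_def)
  qed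
  have cont: "continuous_on UNIV \<alpha>''"
  proof -
    have "continuous_on UNIV \<phi>" "continuous_on UNIV \<tau>"
      using \<phi>[THEN DERIV_isCont] d\<tau>[THEN DERIV_isCont]
      by (auto intro!: continuous_at_imp_continuous_on)
    then have "continuous_on UNIV (\<lambda>s. - sin (\<tau> s) * k s)" "continuous_on UNIV (\<lambda>s. cos (\<tau> s) * k s)"
      unfolding k_def turn_rate_def using P rsq_root_pos
      by (auto intro!: continuous_intros simp: less_imp_neq[THEN not_sym])
    moreover have "\<alpha>'' = (\<lambda>s. (- sin (\<tau> s) * k s) *\<^sub>R axis 1 1 + (cos (\<tau> s) * k s) *\<^sub>R axis 2 1)"
      by (rule ext) (simp add: \<alpha>''_def vec_eq_iff forall_2 axis_def)
    ultimately show ?thesis by (simp only:) (intro continuous_on_add continuous_on_scaleR continuous_on_const)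
  qed
  have "twizzler_profile M v \<alpha>"
    unfolding twizzler_profile_def v[symmetric]
  proof (intro conjI allI)
    show "\<exists>\<alpha>' \<alpha>''. (\<forall>s. (\<alpha> has_vector_derivative \<alpha>' s) (at s)) \<and>
        (\<forall>s. (\<alpha>' has_vector_derivative \<alpha>'' s) (at s)) \<and> continuous_on UNIV \<alpha>''"
      using d1 d2 cont by blast
    fix s t
    show "norm (vector_derivative \<alpha> (at s)) = 1"
      using unit by (simp add: vector_derivative_at[OF d1])
    show "has_mean_curvature (twizzler_map w \<alpha>) s t 1"
      by (simp add: mean_curvature_1_iff \<xi> \<kappa> k)
    show "treadmill_sled \<alpha> s \<in> uminus ` level_curve w M"
      unfolding treadmill_sled \<xi> by (rule imageI) (simp add: level_curve_def x_def y_def \<Xi>_level)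
  qed (rule twizzler_cross_nonzero)
  then show ?thesis by blast
qed

section \<open>Fundamental pieces and closing\<close>
context lifted_profile begin

lemma \<phi>_less: "\<phi> a < \<phi> b \<longleftrightarrow> a < b"
proof -
  have incr: "\<phi> a < \<phi> b" if "a < b" for a b
    using that
  proof (rule DERIV_pos_imp_increasing)
    show "\<exists>y. (\<phi> has_real_derivative y) (at u) \<and> 0 < y" for u
      using d\<phi>[of u] excess_root_pos[of M w "\<phi> u"] by (intro exI[of _ "2 / excess_root M w (\<phi> u)"]) simp
  qed
  show ?thesis
    using incr[of a b] incr[of b a] by (cases a b rule: linorder_cases) auto
qed

lemma \<phi>_inj: "\<phi> a = \<phi> b \<longleftrightarrow> a = b"
  using \<phi>_less[of a b] \<phi>_less[of b a] by (cases a b rule: linorder_cases) auto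

lemma norm_\<alpha>: "(\<alpha> s $ 1)\<^sup>2 + (\<alpha> s $ 2)\<^sup>2 = rsq M (\<phi> s)"
proof -
  define c d x y where "c = cos (J (\<phi> s))" "d = sin (J (\<phi> s))" "x = \<Xi>\<^sub>1 M w (\<phi> s)" "y = \<Xi>\<^sub>2 M w (\<phi> s)"
  note defs = this
  have "c\<^sup>2 + d\<^sup>2 = 1" by (simp add: defs)
  moreover have "(c * x - d * y)\<^sup>2 + (d * x + c * y)\<^sup>2 = (c\<^sup>2 + d\<^sup>2) * (x\<^sup>2 + y\<^sup>2)"
    by (simp add: power2_eq_square algebra_simps)
  ultimately have "(c * x - d * y)\<^sup>2 + (d * x + c * y)\<^sup>2 = x\<^sup>2 + y\<^sup>2" by simp
  then show ?thesis unfolding \<Xi>_norm[symmetric] by (simp add: \<alpha> plane_rot_nth defs)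
qed

text \<open>In terms of the arc length \<open>A\<close> as a function of \<open>\<phi>\<close>, the lift is \<open>A (\<phi> s) = s + const\<close>. Since the
  derivative of \<open>A\<close> is periodic, a full turn of \<open>\<phi>\<close> always takes the same length \<open>L\<close>.\<close>
lemma period_exists:
  obtains L where "0 < L" "\<And>s n. \<phi> (s + of_int n * L) = \<phi> s + of_int n * (2 * pi)"
proof -
  have "continuous_on UNIV (\<lambda>u. excess_root M w u / 2)" by (intro continuous_intros) auto
  then obtain A where A: "\<And>u. (A has_real_derivative excess_root M w u / 2) (at u)"
    using global_antiderivative by blast
  define L where "L = A (2 * pi) - A 0"
  have mono: "A a < A b" if "a < b" for a b
    using that by (rule DERIV_pos_imp_increasing) (use A excess_root_pos[of M w] in \<open>meson half_gt_zero\<close>)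
  have inj: "a = b" if "A a = A b" for a b
    using mono[of a b] mono[of b a] that by (cases a b rule: linorder_cases) auto
  have per: "A (u + 2 * pi) = A u + L" for u
    unfolding L_def by (rule antiderivative_shift_period[OF A]) (simp add: excess_root_def excess_periodic)
  have "((\<lambda>s. A (\<phi> s)) has_real_derivative 1) (at s)" for s
    using DERIV_chain2[OF A d\<phi>, of s] excess_root_pos[of M w "\<phi> s"] by simp
  from equal_derivatives_difference[OF this DERIV_ident]
  have A\<phi>: "A (\<phi> s) - A (\<phi> t) = s - t" for s t .
  have "\<phi> (s + L) = \<phi> s + 2 * pi" for s
    by (rule inj) (use A\<phi>[of "s + L" s] in \<open>simp add: per\<close>)
  note shift_int_multiple[of \<phi> L "2 * pi", OF this]
  moreover have "0 < L" using mono[of 0 "2 * pi"] by (simp add: L_def)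
  ultimately show thesis using that by blast
qed

definition period :: real where
  "period = (SOME L. 0 < L \<and> (\<forall>s n. \<phi> (s + of_int n * L) = \<phi> s + of_int n * (2 * pi)))"

lemma period_pos: "0 < period"
  and \<phi>_period: "\<phi> (s + of_int n * period) = \<phi> s + of_int n * (2 * pi)"
proof -
  have "\<exists>L. 0 < L \<and> (\<forall>s n. \<phi> (s + of_int n * L) = \<phi> s + of_int n * (2 * pi))"
    using period_exists by metis
  then have "0 < period \<and> (\<forall>s n. \<phi> (s + of_int n * period) = \<phi> s + of_int n * (2 * pi))"
    unfolding period_def by (rule someI_ex)
  then show "0 < period" "\<phi> (s + of_int n * period) = \<phi> s + of_int n * (2 * pi)" by auto
qed

lemma \<phi>_surj: obtains s where "\<phi> s = y"
proof -
  define n where "n = \<lceil>\<bar>y - \<phi> 0\<bar> / (2 * pi)\<rceil>"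
  have "\<bar>y - \<phi> 0\<bar> / (2 * pi) \<le> of_int n" by (simp add: n_def)
  then have "\<bar>y - \<phi> 0\<bar> \<le> of_int n * (2 * pi)" by (simp add: field_simps)
  moreover from this have "0 \<le> of_int n * (2 * pi)" by linarith
  then have "0 \<le> real_of_int n" using pi_gt_zero by (simp add: zero_le_mult_iff)
  ultimately have "\<phi> (0 + of_int (- n) * period) \<le> y" "y \<le> \<phi> (0 + of_int n * period)"
    "0 + of_int (- n) * period \<le> 0 + of_int n * period"
    unfolding \<phi>_period using period_pos by (auto simp: mult_nonneg_nonneg)
  then have "\<exists>s\<ge>0 + of_int (- n) * period. s \<le> 0 + of_int n * period \<and> \<phi> s = y"
    by (intro IVT) (auto intro: DERIV_isCont[OF d\<phi>])
  then show thesis using that by blast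
qed

lemma sled_eq_iff: "treadmill_sled \<alpha> s = treadmill_sled \<alpha> t \<longleftrightarrow> (\<exists>n::int. s = t + of_int n * period)"
proof -
  have "treadmill_sled \<alpha> s = treadmill_sled \<alpha> t \<longleftrightarrow> (\<exists>n::int. \<phi> s = \<phi> t + 2 * pi * n)"
    unfolding \<Xi>_eq_iff[symmetric] sled by (auto simp: vec_eq_iff forall_2)
  also have "\<dots> \<longleftrightarrow> (\<exists>n::int. \<phi> s = \<phi> (t + of_int n * period))"
    unfolding \<phi>_period by (simp add: mult.commute)
  finally show ?thesis unfolding \<phi>_inj .
qed

lemma fundamental_piece_iff: "fundamental_piece w M \<alpha> a b \<longleftrightarrow> b = a + period"
proof
  assume F: "fundamental_piece w M \<alpha> a b"
  then have ab: "a < b" and inj: "inj_on (treadmill_sled \<alpha>) {a..<b}"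
    and e: "treadmill_sled \<alpha> b = treadmill_sled \<alpha> a"
    unfolding fundamental_piece_def bij_betw_def by blast+
  from e obtain n :: int where n: "b = a + of_int n * period" unfolding sled_eq_iff by blast
  with ab have "0 < of_int n * period" by simp
  then have "0 < n" using period_pos by (simp add: zero_less_mult_iff)
  moreover have "\<not> 1 < n"
  proof
    assume "1 < n"
    then have "1 * period < of_int n * period" using period_pos by (intro mult_strict_right_mono) auto
    then have "a + period \<in> {a..<b}" "a \<in> {a..<b}" using n period_pos by auto
    moreover have "treadmill_sled \<alpha> (a + period) = treadmill_sled \<alpha> a"
      unfolding sled_eq_iff by (rule exI[of _ 1]) simp
    ultimately have "a + period = a" using inj by (meson inj_onD)
    then show False using period_pos by simp
  qed
  ultimately have "n = 1" by simp
  with n show "b = a + period" by simp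
next
  assume b: "b = a + period"
  have "inj_on (treadmill_sled \<alpha>) {a..<b}"
  proof (rule inj_onI)
    fix s t assume st: "s \<in> {a..<b}" "t \<in> {a..<b}" and "treadmill_sled \<alpha> s = treadmill_sled \<alpha> t"
    then obtain n :: int where n: "s = t + of_int n * period" unfolding sled_eq_iff by blast
    then have "\<bar>of_int n * period\<bar> < 1 * period" using st b by auto
    then have "\<bar>real_of_int n\<bar> < 1" using period_pos by (simp add: abs_mult)
    then have "n = 0" by linarith
    then show "s = t" using n by simp
  qed
  moreover have "treadmill_sled \<alpha> ` {a..<b} = uminus ` level_curve w M"
  proof
    show "treadmill_sled \<alpha> ` {a..<b} \<subseteq> uminus ` level_curve w M"
    proof (rule image_subsetI)
      fix s show "treadmill_sled \<alpha> s \<in> uminus ` level_curve w M"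
        unfolding sled by (rule imageI) (simp add: level_curve_def \<Xi>_level)
    qed
    show "uminus ` level_curve w M \<subseteq> treadmill_sled \<alpha> ` {a..<b}"
    proof
      fix q assume "q \<in> uminus ` level_curve w M"
      then obtain p where q: "q = - p" and "h w (p $ 1) (p $ 2) = M"
        unfolding level_curve_def by blast
      from level_surj[OF this(2)] obtain u where u: "p $ 1 = \<Xi>\<^sub>1 M w u" "p $ 2 = \<Xi>\<^sub>2 M w u" by blast
      obtain s where s: "\<phi> s = u" using \<phi>_surj by blast
      define n where "n = \<lfloor>(s - a) / period\<rfloor>"
      define t where "t = s + of_int (- n) * period"
      have "of_int n \<le> (s - a) / period" "(s - a) / period < of_int n + 1"
        by (simp_all add: n_def)
      then have "of_int n * period \<le> s - a" "s - a < (of_int n + 1) * period"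
        using period_pos by (simp_all add: pos_le_divide_eq pos_divide_less_eq)
      then have "t \<in> {a..<b}"
        unfolding t_def b by (simp add: algebra_simps)
      moreover have "treadmill_sled \<alpha> t = q"
      proof -
        have "treadmill_sled \<alpha> t = treadmill_sled \<alpha> s" unfolding sled_eq_iff t_def by blast
        then show ?thesis unfolding sled s q by (simp add: vec_eq_iff forall_2 u)
      qed
      ultimately show "q \<in> treadmill_sled \<alpha> ` {a..<b}" by blast
    qed
  qed
  moreover have "treadmill_sled \<alpha> b = treadmill_sled \<alpha> a"
    unfolding sled_eq_iff b by (rule exI[of _ 1]) simp
  ultimately show "fundamental_piece w M \<alpha> a b"
    using period_pos b unfolding fundamental_piece_def bij_betw_def by simp
qed

lemma fundamental_length: "fundamental_length w M \<alpha> = period"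
  unfolding fundamental_length_def fundamental_piece_iff by simp

lemma \<alpha>_shift: "\<alpha> (s + period) = plane_rot (turning M w) *v \<alpha> s"
proof -
  have e: "\<phi> (s + period) = \<phi> s + 2 * pi" using \<phi>_period[of s 1] by simp
  have "J (\<phi> s + 2 * pi) = turning M w + J (\<phi> s)"
    using turning_eq[OF dJ, of "\<phi> s"] by simp
  then show ?thesis
    unfolding \<alpha>[of "s + period"] \<alpha>[of s] e \<Xi>_periodic by (simp only: plane_rot_add)
qed

lemma \<alpha>_nonzero: obtains s where "\<alpha> s \<noteq> 0"
proof -
  obtain s where s: "\<phi> s = pi / 2" using \<phi>_surj by blast
  define a where "a = sqrt (1 + 4 * M)"
  have "0 < a" unfolding a_def by (rule amplitude_pos)
  then have "0 < rsq M (pi / 2)"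
    unfolding rsq_def excess_def a_def[symmetric] sin_pi_half using M by linarith
  then have "\<alpha> s \<noteq> 0" using norm_\<alpha>[of s] s by auto
  then show thesis by (rule that)
qed

text \<open>A rotation that fixes a nonzero point of the curve is the identity.\<close>
lemma closes_iff:
  "(\<forall>s. \<alpha> (s + of_nat c * period) = \<alpha> s) \<longleftrightarrow> (\<exists>k::int. of_nat c * turning M w = 2 * pi * k)"
proof -
  have sh: "\<alpha> (s + of_nat c * period) = plane_rot (of_nat c * turning M w) *v \<alpha> s" for s
    using rotation_int_multiple[where \<alpha>=\<alpha> and L=period and \<theta>="turning M w", OF \<alpha>_shift, of s "int c"] by simp
  show ?thesis
  proof
    assume c: "\<forall>s. \<alpha> (s + of_nat c * period) = \<alpha> s"
    obtain s where s: "\<alpha> s \<noteq> 0" using \<alpha>_nonzero .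
    have "plane_rot (of_nat c * turning M w) *v \<alpha> s = \<alpha> s" using c sh by metis
    then show "\<exists>k::int. of_nat c * turning M w = 2 * pi * k"
      using plane_rot_fixes[OF _ s] by metis
  next
    assume "\<exists>k::int. of_nat c * turning M w = 2 * pi * k"
    then obtain k :: int where "of_nat c * turning M w = 0 + 2 * pi * k" by auto
    then have "plane_rot (of_nat c * turning M w) = plane_rot 0" unfolding plane_rot_eq_iff by blast
    then show "\<forall>s. \<alpha> (s + of_nat c * period) = \<alpha> s" unfolding sh by (simp add: plane_rot_0)
  qed
qed

lemma properly_immersed_if_closes:
  assumes "0 < c" "\<forall>s. \<alpha> (s + of_nat c * period) = \<alpha> s"
  shows "properly_immersed \<alpha>"
  unfolding properly_immersed_def using assms period_pos
  by (intro exI[of _ "of_nat c * period"]) auto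

text \<open>The least \<open>b\<close> with \<open>b * turning M w\<close> in \<open>2 \<pi> \<int>\<close> is the denominator of \<open>turning M w / (2 \<pi>)\<close> in lowest
  terms. The numerator is positive by \<open>turning_pos\<close>.\<close>
lemma pieces_iff:
  "properly_immersed \<alpha> \<and> consists_of_pieces period \<alpha> b \<longleftrightarrow>
     (\<exists>a::nat. 0 < a \<and> 0 < b \<and> coprime a b \<and> turning M w = 2 * pi * (real a / real b))"
proof
  assume "properly_immersed \<alpha> \<and> consists_of_pieces period \<alpha> b"
  then have b: "0 < b" "\<exists>k::int. of_nat b * turning M w = 2 * pi * k"
    and least: "\<And>c. 0 < c \<Longrightarrow> c < b \<Longrightarrow> \<not> (\<exists>k::int. of_nat c * turning M w = 2 * pi * k)"
    unfolding consists_of_pieces_def closes_iff by auto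
  from b(2) obtain k :: int where k: "of_nat b * turning M w = 2 * pi * k" by blast
  have "0 < of_nat b * turning M w" using b(1) turning_pos[OF M w] by simp
  then have "0 < k" unfolding k by (simp add: zero_less_mult_iff)
  define a where "a = nat k"
  have a: "0 < a" "real_of_int k = real a" using \<open>0 < k\<close> by (auto simp: a_def)
  have turn: "turning M w = 2 * pi * (real a / real b)"
    using k b(1) by (simp add: a field_simps)
  have "coprime a b"
  proof (rule ccontr)
    assume nc: "\<not> coprime a b"
    define d where "d = gcd a b"
    have d: "d \<noteq> 1" "0 < d" using nc a(1) by (auto simp: d_def coprime_iff_gcd_eq_1)
    obtain a' b' where ab: "a = d * a'" "b = d * b'" unfolding d_def by (metis gcd_dvd1 gcd_dvd2 dvdE)
    have "0 < b'" "b' < b" using b(1) d ab by auto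
    moreover have "of_nat b' * turning M w = 2 * pi * of_int (int a')"
      unfolding turn ab using d \<open>0 < b'\<close> by (simp add: field_simps)
    ultimately show False using least by blast
  qed
  with a(1) b(1) turn
  show "\<exists>a::nat. 0 < a \<and> 0 < b \<and> coprime a b \<and> turning M w = 2 * pi * (real a / real b)" by blast
next
  assume "\<exists>a::nat. 0 < a \<and> 0 < b \<and> coprime a b \<and> turning M w = 2 * pi * (real a / real b)"
  then obtain a :: nat where a: "0 < a" "0 < b" "coprime a b" "turning M w = 2 * pi * (real a / real b)"
    by blast
  have "of_nat b * turning M w = 2 * pi * of_int (int a)" using a by simp
  then have cl: "\<forall>s. \<alpha> (s + of_nat b * period) = \<alpha> s" unfolding closes_iff by blast
  moreover have "\<not> (\<forall>s. \<alpha> (s + of_nat c * period) = \<alpha> s)" if c: "0 < c" "c < b" for c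
  proof
    assume "\<forall>s. \<alpha> (s + of_nat c * period) = \<alpha> s"
    then obtain k :: int where "of_nat c * turning M w = 2 * pi * k" unfolding closes_iff by blast
    then have "real c * real a = of_int k * real b"
      unfolding a(4) using a(2) by (simp add: field_simps)
    then have "real_of_int (int c * int a) = real_of_int (k * int b)" by simp
    then have "int c * int a = k * int b" by (simp only: of_int_eq_iff)
    then have "int b dvd int c * int a" by simp
    then have "b dvd c * a" by (metis int_dvd_int_iff of_nat_mult)
    then have "b dvd c" using a(3) by (simp add: coprime_commute coprime_dvd_mult_left_iff)
    then show False using c by (auto dest: dvd_imp_le)
  qed
  ultimately show "properly_immersed \<alpha> \<and> consists_of_pieces period \<alpha> b"
    using properly_immersed_if_closes[OF a(2)] a(2) unfolding consists_of_pieces_def by blast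
qed

end

section \<open>Density of the orbit of a point\<close>

lemma twizzler_map_rot:
  "twizzler_map w \<alpha> s t = vector [(plane_rot (- (w * t)) *v \<alpha> s) $ 1, t, (plane_rot (- (w * t)) *v \<alpha> s) $ 2]"
  by (simp add: twizzler_map_def vec_eq_iff forall_3 plane_rot_nth)

lemma axis_rot_twizzler_map:
  assumes "\<alpha> s' = plane_rot \<theta> *v \<alpha> s"
  shows "axis_rot \<theta> (twizzler_map w \<alpha> s t) = twizzler_map w \<alpha> s' t"
  unfolding twizzler_map_def assms axis_rot_def
  by (simp add: vec_eq_iff forall_3 plane_rot_nth algebra_simps)

lemma axis_dist_twizzler_map: "axis_dist (twizzler_map w \<alpha> s t) = sqrt ((\<alpha> s $ 1)\<^sup>2 + (\<alpha> s $ 2)\<^sup>2)"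
proof -
  define c d x y where "c = cos (w * t)" "d = sin (w * t)" "x = \<alpha> s $ 1" "y = \<alpha> s $ 2"
  note defs = this
  have "c\<^sup>2 + d\<^sup>2 = 1" by (simp add: defs)
  moreover have "(x * c + y * d)\<^sup>2 + (- x * d + y * c)\<^sup>2 = (c\<^sup>2 + d\<^sup>2) * (x\<^sup>2 + y\<^sup>2)"
    by (simp add: power2_eq_square algebra_simps)
  ultimately have "(x * c + y * d)\<^sup>2 + (- x * d + y * c)\<^sup>2 = x\<^sup>2 + y\<^sup>2" by simp
  then show ?thesis by (simp add: axis_dist_def twizzler_map_def defs)
qed

text \<open>Kronecker's theorem makes the angles \<open>a + k \<theta>\<close> dense modulo \<open>2 \<pi>\<close>, and the point depends
  continuously on the angle.\<close>
lemma rotation_orbit_dense: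
  fixes p :: "real^2" and y :: real
  assumes irr: "\<theta> / (2 * pi) \<notin> \<rat>" and e: "0 < e"
  obtains k :: int where
    "dist (vector [(plane_rot (a + of_int k * \<theta>) *v p) $ 1, y, (plane_rot (a + of_int k * \<theta>) *v p) $ 2] :: real^3)
       (vector [(plane_rot b *v p) $ 1, y, (plane_rot b *v p) $ 2]) < e"
proof -
  define F :: "real \<Rightarrow> real^3" where "F c = vector [(plane_rot c *v p) $ 1, y, (plane_rot c *v p) $ 2]" for c
  have "isCont F b"
  proof -
    have "(F has_vector_derivative vector [- sin b * p $ 1 - cos b * p $ 2, 0, cos b * p $ 1 - sin b * p $ 2]) (at b)"
      unfolding F_def[abs_def] plane_rot_nth
      by (rule has_vector_derivative_vector_3) (auto intro!: derivative_eq_intros)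
    then show ?thesis by (rule has_vector_derivative_continuous)
  qed
  then obtain d where d: "0 < d" "\<And>c. \<bar>c - b\<bar> < d \<Longrightarrow> dist (F c) (F b) < e"
    using e unfolding continuous_at_eps_delta by (auto simp: dist_real_def)
  have "0 < d / (2 * pi)" using d by simp
  from sequence_of_fractional_parts_is_dense[OF irr this, where \<alpha>="(b - a) / (2 * pi)"]
  obtain h k :: int where hk: "\<bar>of_int k * (\<theta> / (2 * pi)) - of_int h - (b - a) / (2 * pi)\<bar> < d / (2 * pi)" by metis
  define c where "c = a + of_int k * \<theta> + 2 * pi * of_int (- h)"
  have "c - b = 2 * pi * (of_int k * (\<theta> / (2 * pi)) - of_int h - (b - a) / (2 * pi))"
    by (simp add: c_def field_simps)
  then have "\<bar>c - b\<bar> = 2 * pi * \<bar>of_int k * (\<theta> / (2 * pi)) - of_int h - (b - a) / (2 * pi)\<bar>"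
    by (simp add: abs_mult)
  also have "\<dots> < 2 * pi * (d / (2 * pi))" using hk by (intro mult_strict_left_mono) auto
  finally have "dist (F c) (F b) < e" by (intro d(2)) simp
  moreover have "plane_rot c = plane_rot (a + of_int k * \<theta>)"
    unfolding plane_rot_eq_iff c_def by blast
  ultimately show thesis using that[of k] by (simp add: F_def)
qed

lemma rational_multiple_of_2pi_rotation:
  assumes "\<theta> / (2 * pi) \<in> \<rat>"
  obtains m :: int where "m \<noteq> 1" "plane_rot (of_int m * \<theta>) = plane_rot \<theta>"
proof -
  obtain a b :: int where ab: "0 < b" "\<theta> / (2 * pi) = of_int a / of_int b"
    using assms by (metis Rats_cases')
  then have "of_int b * \<theta> = 2 * pi * of_int a" by (simp add: field_simps)
  then have "of_int (b + 1) * \<theta> = \<theta> + 2 * pi * of_int a" by (simp add: algebra_simps)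
  then have "plane_rot (of_int (b + 1) * \<theta>) = plane_rot \<theta>" unfolding plane_rot_eq_iff by blast
  then show thesis using that[of "b + 1"] ab(1) by simp
qed

text \<open>The range of the squared distance of the profile curve from the axis.\<close>
lemma rsq_bounds:
  assumes "- 1 / 4 < M"
  shows "((sqrt (1 + 4 * M) - 1) / 2)\<^sup>2 \<le> rsq M u" "rsq M u \<le> ((sqrt (1 + 4 * M) + 1) / 2)\<^sup>2"
    and "\<And>R. ((sqrt (1 + 4 * M) - 1) / 2)\<^sup>2 \<le> R \<Longrightarrow> R \<le> ((sqrt (1 + 4 * M) + 1) / 2)\<^sup>2 \<Longrightarrow> \<exists>u. rsq M u = R"
proof -
  define m where "m = sqrt (1 + 4 * M)"
  have m: "0 < m" "m\<^sup>2 = 1 + 4 * M" using assms by (auto simp: m_def)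
  have R: "rsq M u = (m\<^sup>2 + 1) / 4 + m / 2 * sin u" for u
    unfolding rsq_def excess_def m_def[symmetric] m(2) by (simp add: field_simps)
  have lo: "((m - 1) / 2)\<^sup>2 = (m\<^sup>2 + 1) / 4 - m / 2" and hi: "((m + 1) / 2)\<^sup>2 = (m\<^sup>2 + 1) / 4 + m / 2"
    by (simp_all add: power2_eq_square field_simps)
  have "m / 2 * - 1 \<le> m / 2 * sin u" "m / 2 * sin u \<le> m / 2 * 1"
    using m(1) by (intro mult_left_mono; simp)+
  then show "((sqrt (1 + 4 * M) - 1) / 2)\<^sup>2 \<le> rsq M u" "rsq M u \<le> ((sqrt (1 + 4 * M) + 1) / 2)\<^sup>2"
    unfolding m_def[symmetric] lo hi R by simp_all
  fix S assume "((sqrt (1 + 4 * M) - 1) / 2)\<^sup>2 \<le> S" "S \<le> ((sqrt (1 + 4 * M) + 1) / 2)\<^sup>2"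
  then have S: "(m\<^sup>2 + 1) / 4 - m / 2 \<le> S" "S \<le> (m\<^sup>2 + 1) / 4 + m / 2"
    unfolding m_def[symmetric] lo hi .
  define z where "z = (S - (m\<^sup>2 + 1) / 4) / (m / 2)"
  have "- 1 \<le> z" "z \<le> 1" using S m(1) by (simp_all add: z_def field_simps)
  then have "rsq M (arcsin z) = S"
    unfolding R using m(1) by (simp add: z_def field_simps)
  then show "\<exists>u. rsq M u = S" ..
qed

section \<open>The surface: symmetry and density\<close>
context lifted_profile begin

lemma axis_dist_surface: "axis_dist (twizzler_map w \<alpha> s t) = sqrt (rsq M (\<phi> s))"
  by (simp add: axis_dist_twizzler_map norm_\<alpha>)

text \<open>Approximating points can be found on the same cylinder around the axis. This matters for density
  in a region that is bounded by cylinders, where nearby points outside do not count.\<close>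
lemma surface_point_near:
  assumes sh: "\<And>s. \<alpha> (s + period) = plane_rot \<theta> *v \<alpha> s"
    and irr: "\<theta> / (2 * pi) \<notin> \<rat>" and e: "0 < e"
    and R: "\<bar>(sqrt (1 + 4 * M) - 1) / 2\<bar> \<le> axis_dist p" "axis_dist p \<le> (sqrt (1 + 4 * M) + 1) / 2"
  obtains q where "q \<in> twizzler_surface w \<alpha>" "axis_dist q = axis_dist p" "dist q p < e"
proof -
  define r where "r = axis_dist p"
  have r: "0 \<le> r" "r\<^sup>2 = (p $ 1)\<^sup>2 + (p $ 3)\<^sup>2" by (simp_all add: r_def axis_dist_def)
  have "((sqrt (1 + 4 * M) - 1) / 2)\<^sup>2 \<le> r\<^sup>2"
    using power_mono[OF R(1) abs_ge_zero, of 2] by (simp only: r_def power2_abs)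
  moreover have "r\<^sup>2 \<le> ((sqrt (1 + 4 * M) + 1) / 2)\<^sup>2"
    using power_mono[OF R(2), of 2] r(1) by (simp add: r_def)
  ultimately obtain u where u: "rsq M u = r\<^sup>2" using rsq_bounds(3)[OF M] by blast
  obtain s where s: "\<phi> s = u" using \<phi>_surj by blast
  have "(\<alpha> s $ 1)\<^sup>2 + (\<alpha> s $ 2)\<^sup>2 = (vector [p $ 1, p $ 3] $ 1)\<^sup>2 + (vector [p $ 1, p $ 3] $ (2::2))\<^sup>2"
    using norm_\<alpha>[of s] by (simp add: s u r)
  then obtain b where b: "(vector [p $ 1, p $ 3] :: real^2) = plane_rot b *v \<alpha> s"
    by (rule plane_rot_exists)
  then have p: "p = vector [(plane_rot b *v \<alpha> s) $ 1, p $ 2, (plane_rot b *v \<alpha> s) $ 2]"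
    unfolding b[symmetric] by (simp add: vec_eq_iff forall_3)
  obtain k :: int where k:
    "dist (vector [(plane_rot (- (w * p $ 2) + of_int k * \<theta>) *v \<alpha> s) $ 1, p $ 2,
                   (plane_rot (- (w * p $ 2) + of_int k * \<theta>) *v \<alpha> s) $ 2])
       (vector [(plane_rot b *v \<alpha> s) $ 1, p $ 2, (plane_rot b *v \<alpha> s) $ 2] :: real^3) < e"
    using rotation_orbit_dense[OF irr e] by blast
  define q where "q = twizzler_map w \<alpha> (s + of_int k * period) (p $ 2)"
  have q: "q = vector [(plane_rot (- (w * p $ 2) + of_int k * \<theta>) *v \<alpha> s) $ 1, p $ 2,
                   (plane_rot (- (w * p $ 2) + of_int k * \<theta>) *v \<alpha> s) $ 2]"
    unfolding q_def twizzler_map_rot plane_rot_add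
      rotation_int_multiple[where \<alpha>=\<alpha> and L=period and \<theta>=\<theta>, OF sh] ..
  show thesis
  proof (rule that)
    show "q \<in> twizzler_surface w \<alpha>" unfolding q_def twizzler_surface_def by blast
    have "\<phi> (s + of_int k * period) = u + of_int k * (2 * pi)" by (simp add: \<phi>_period s)
    then have "rsq M (\<phi> (s + of_int k * period)) = rsq M u"
      using shift_int_multiple[of "rsq M" "2 * pi" 0 u k] by (simp add: rsq_periodic)
    then show "axis_dist q = axis_dist p"
      unfolding q_def axis_dist_surface using r(1) by (simp add: u r_def)
    show "dist q p < e" using k unfolding q p[symmetric] .
  qed
qed

lemma surface_dense:
  assumes sh: "\<And>s. \<alpha> (s + period) = plane_rot \<theta> *v \<alpha> s"
    and irr: "\<not> (\<exists>m::int. m \<noteq> 1 \<and> plane_rot (of_int m * \<theta>) = plane_rot \<theta>)"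
  shows "M = 0 \<Longrightarrow> dense_in (twizzler_surface w \<alpha>) {p. axis_dist p < 1}"
    and "M \<noteq> 0 \<Longrightarrow> dense_in (twizzler_surface w \<alpha>)
           {p. \<bar>(sqrt (1 + 4 * M) - 1) / 2\<bar> \<le> axis_dist p \<and> axis_dist p \<le> (sqrt (1 + 4 * M) + 1) / 2}"
proof -
  let ?S = "twizzler_surface w \<alpha>"
  let ?D = "{p. \<bar>(sqrt (1 + 4 * M) - 1) / 2\<bar> \<le> axis_dist p \<and> axis_dist p \<le> (sqrt (1 + 4 * M) + 1) / 2}"
  have irr: "\<theta> / (2 * pi) \<notin> \<rat>" using irr rational_multiple_of_2pi_rotation by metis
  have dense: "p \<in> closure (?S \<inter> {q. axis_dist q = axis_dist p})" if "p \<in> ?D" for p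
    unfolding closure_approachable
  proof (intro allI impI)
    fix e :: real assume "0 < e"
    with that obtain q where "q \<in> ?S" "axis_dist q = axis_dist p" "dist q p < e"
      using surface_point_near[OF sh irr, of e p] by blast
    then show "\<exists>q\<in>?S \<inter> {q. axis_dist q = axis_dist p}. dist q p < e" by blast
  qed
  have sub: "q \<in> ?D" if "q \<in> ?S" for q
  proof -
    obtain s t where q: "q = twizzler_map w \<alpha> s t" using \<open>q \<in> ?S\<close> unfolding twizzler_surface_def by blast
    define m where "m = sqrt (1 + 4 * M)"
    have m: "0 < m" unfolding m_def by (rule amplitude_pos)
    have "\<bar>(m - 1) / 2\<bar> \<le> sqrt (rsq M (\<phi> s))"
      using rsq_bounds(1)[OF M, of "\<phi> s"] unfolding m_def by (intro real_le_rsqrt) (simp only: power2_abs)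
    moreover have "sqrt (rsq M (\<phi> s)) \<le> (m + 1) / 2"
      using rsq_bounds(2)[OF M, of "\<phi> s"] m unfolding m_def by (intro real_le_lsqrt) auto
    ultimately show ?thesis unfolding q m_def axis_dist_surface mem_Collect_eq by blast
  qed
  show "dense_in ?S ?D" if "M \<noteq> 0"
    unfolding dense_in_def
  proof
    show "?S \<subseteq> closure ?D" using sub closure_subset by blast
    show "?D \<subseteq> closure (?S \<inter> ?D)"
    proof
      fix p assume p: "p \<in> ?D"
      have "?S \<inter> {q. axis_dist q = axis_dist p} \<subseteq> ?S \<inter> ?D" using p by auto
      then show "p \<in> closure (?S \<inter> ?D)" using dense[OF p] closure_mono by blast
    qed
  qed
  show "dense_in ?S {p. axis_dist p < 1}" if M0: "M = 0"
    unfolding dense_in_def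
  proof
    show "?S \<subseteq> closure {p. axis_dist p < 1}"
    proof
      fix q assume "q \<in> ?S"
      then have q: "axis_dist q \<le> 1" using sub[of q] M0 by simp
      show "q \<in> closure {p. axis_dist p < 1}"
        unfolding closure_approachable
      proof (intro allI impI)
        fix e :: real assume e: "0 < e"
        \<comment> \<open>points of the boundary cylinder are limits of their contractions towards the origin\<close>
        define c where "c = max 0 (1 - e / (2 * (norm q + 1)))"
        have nq: "0 < norm q + 1" by (simp add: add_nonneg_pos)
        have c: "0 \<le> c" "c < 1" "1 - c \<le> e / (2 * (norm q + 1))"
          using e nq by (auto simp: c_def)
        have "axis_dist (c *\<^sub>R q) = c * axis_dist q"
          using c(1) by (simp add: axis_dist_def power_mult_distrib distrib_left[symmetric] real_sqrt_mult)
        also have "\<dots> \<le> c * 1" using q c(1) by (rule mult_left_mono)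
        finally have "axis_dist (c *\<^sub>R q) < 1" using c(2) by simp
        moreover have "dist (c *\<^sub>R q) q < e"
        proof -
          have "c *\<^sub>R q - q = (c - 1) *\<^sub>R q" by (simp add: algebra_simps)
          then have "dist (c *\<^sub>R q) q = (1 - c) * norm q" using c(2) by (simp add: dist_norm)
          also have "\<dots> \<le> e / (2 * (norm q + 1)) * (norm q + 1)"
            using c nq e by (intro mult_mono) auto
          also have "\<dots> = e / 2" using nq by (simp add: field_simps)
          also have "\<dots> < e" using e by simp
          finally show ?thesis .
        qed
        ultimately show "\<exists>p\<in>{p. axis_dist p < 1}. dist p q < e" by blast
      qed
    qed
    show "{p. axis_dist p < 1} \<subseteq> closure (?S \<inter> {p. axis_dist p < 1})"
    proof
      fix p assume p: "p \<in> {p. axis_dist p < 1}"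
      then have "p \<in> ?D" by (auto simp: M0 axis_dist_def)
      moreover have "?S \<inter> {q. axis_dist q = axis_dist p} \<subseteq> ?S \<inter> {p. axis_dist p < 1}" using p by auto
      ultimately show "p \<in> closure (?S \<inter> {p. axis_dist p < 1})" using dense closure_mono by blast
    qed
  qed
qed

lemma surface_invariant:
  assumes sh: "\<And>s. \<alpha> (s + period) = plane_rot \<theta> *v \<alpha> s"
  shows "axis_rot (of_int n * \<theta>) ` twizzler_surface w \<alpha> = twizzler_surface w \<alpha>"
proof -
  have e: "axis_rot (of_int n * \<theta>) (twizzler_map w \<alpha> s t) = twizzler_map w \<alpha> (s + of_int n * period) t" for s t
    by (rule axis_rot_twizzler_map) (rule rotation_int_multiple[where \<alpha>=\<alpha> and L=period, OF sh])
  show ?thesis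
  proof
    show "axis_rot (of_int n * \<theta>) ` twizzler_surface w \<alpha> \<subseteq> twizzler_surface w \<alpha>"
      unfolding twizzler_surface_def using e by blast
    show "twizzler_surface w \<alpha> \<subseteq> axis_rot (of_int n * \<theta>) ` twizzler_surface w \<alpha>"
    proof
      fix q assume "q \<in> twizzler_surface w \<alpha>"
      then obtain s t where q: "q = twizzler_map w \<alpha> s t" unfolding twizzler_surface_def by blast
      have "axis_rot (of_int n * \<theta>) (twizzler_map w \<alpha> (s - of_int n * period) t) = q"
        unfolding e q by simp
      moreover have "twizzler_map w \<alpha> (s - of_int n * period) t \<in> twizzler_surface w \<alpha>"
        unfolding twizzler_surface_def by blast
      ultimately show "q \<in> axis_rot (of_int n * \<theta>) ` twizzler_surface w \<alpha>" by (metis imageI)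
    qed
  qed
qed

lemma properly_immersed_if_finite_order:
  fixes m :: int
  assumes sh: "\<And>s. \<alpha> (s + period) = plane_rot \<theta> *v \<alpha> s"
    and m: "m \<noteq> 1" "plane_rot (of_int m * \<theta>) = plane_rot \<theta>"
  shows "properly_immersed \<alpha>"
proof -
  obtain k :: int where k: "of_int m * \<theta> = \<theta> + 2 * pi * k"
    using m(2) unfolding plane_rot_eq_iff by blast
  define n where "n = \<bar>m - 1\<bar>"
  have "0 < n" using m(1) by (simp add: n_def)
  have "of_int n * \<theta> = of_int (sgn (m - 1)) * (of_int (m - 1) * \<theta>)"
    unfolding n_def by (simp add: abs_sgn mult.commute mult.left_commute)
  also have "of_int (m - 1) * \<theta> = 2 * pi * k" using k by (simp add: algebra_simps)
  also have "of_int (sgn (m - 1)) * (2 * pi * k) = 0 + 2 * pi * of_int (sgn (m - 1) * k)"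
    by (simp add: mult.commute mult.left_commute)
  finally have "plane_rot (of_int n * \<theta>) = plane_rot 0" unfolding plane_rot_eq_iff by blast
  then have "\<alpha> (s + of_int n * period) = \<alpha> s" for s
    using rotation_int_multiple[where \<alpha>=\<alpha> and L=period, OF sh, of s n] by (simp add: plane_rot_0)
  moreover have "0 < of_int n * period" using \<open>0 < n\<close> period_pos by simp
  ultimately show ?thesis unfolding properly_immersed_def by blast
qed

end

section \<open>Parameters of properly immersed Twizzlers\<close>
lemma twizzler_w_pos: "0 < v \<Longrightarrow> v < 1 \<Longrightarrow> 0 < twizzler_w v"
  by (simp add: twizzler_w_def)

lemma twizzler_w_less: "0 < u \<Longrightarrow> u < v \<Longrightarrow> v < 1 \<Longrightarrow> twizzler_w v < twizzler_w u"
  by (simp add: twizzler_w_def field_simps)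

lemma continuous_on_twizzler_w: "0 < u \<Longrightarrow> continuous_on {u..v} twizzler_w"
  unfolding twizzler_w_def[abs_def] by (intro continuous_intros) auto

definition immersed_parameters :: "(real \<times> real) set" where
  "immersed_parameters = {(M, v). -1/4 < M \<and> 0 < v \<and> v < 1 \<and>
                     (\<exists>\<alpha>. twizzler_profile M v \<alpha> \<and> properly_immersed \<alpha>)}"

text \<open>For fixed \<open>M\<close> the turning is continuous and strictly monotone in the second parameter, so that on
  every interval it takes a value in \<open>2 \<pi> \<rat>\<close>.\<close>
lemma immersed_parameter_between:
  assumes M: "- 1 / 4 < M" and uv: "0 < u" "u < v" "v < 1"
  obtains z where "u \<le> z" "z \<le> v" "(M, z) \<in> immersed_parameters"
proof -
  let ?f = "\<lambda>z. turning M (twizzler_w z)"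
  have wv: "0 < twizzler_w v" using uv by (intro twizzler_w_pos) auto
  have "?f v < ?f u"
    using turning_strict_mono[OF M, of "twizzler_w v" "twizzler_w u"] twizzler_w_less[OF uv] wv by simp
  then have "?f v / (2 * pi) < ?f u / (2 * pi)" by (simp add: divide_strict_right_mono)
  then obtain q :: rat where q: "?f v / (2 * pi) < of_rat q" "of_rat q < ?f u / (2 * pi)"
    using of_rat_dense by blast
  then have q': "?f v \<le> 2 * pi * of_rat q" "2 * pi * of_rat q \<le> ?f u"
    by (simp_all add: field_simps less_imp_le)
  have "continuous_on {u..v} ?f"
    using continuous_on_compose2[OF continuous_on_turning[OF M] continuous_on_twizzler_w[OF uv(1)]] by simp
  then obtain z where z: "u \<le> z" "z \<le> v" "?f z = 2 * pi * of_rat q"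
    using IVT2'[of ?f v "2 * pi * of_rat q" u] q' uv by auto
  have z01: "0 < z" "z < 1" using z uv by auto
  interpret twizzler_parameters M "twizzler_w z"
    using M twizzler_w_pos[OF z01] by unfold_locales
  obtain \<alpha> where prof: "twizzler_profile M z \<alpha>" using twizzler_profile_exists by blast
  obtain \<phi> J where "lifted_profile M (twizzler_w z) \<alpha> \<phi> J"
    using twizzler_profile_lift[OF twizzler_parameters_axioms refl prof] .
  then interpret lifted_profile M "twizzler_w z" \<alpha> \<phi> J .
  obtain a b :: int where ab: "0 < b" "q = of_int a / of_int b"
    by (metis quotient_of_div quotient_of_denom_pos surj_pair)
  have "of_nat (nat b) * turning M (twizzler_w z) = 2 * pi * of_int a"
    unfolding z(3) using ab by (simp add: of_rat_divide)
  then have "properly_immersed \<alpha>"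
    using properly_immersed_if_closes[of "nat b"] closes_iff[of "nat b"] ab(1) by auto
  then show thesis
    using that[OF z(1,2)] M z01 prof unfolding immersed_parameters_def by blast
qed

lemma immersed_parameters_dense: "{-1/4<..} \<times> {0<..<1} \<subseteq> closure immersed_parameters"
proof
  fix x :: "real \<times> real" assume "x \<in> {-1/4<..} \<times> {0<..<(1::real)}"
  then obtain M v :: real where x: "x = (M, v)" "- 1 / 4 < M" "0 < v" "v < 1" by auto
  show "x \<in> closure immersed_parameters"
    unfolding closure_approachable
  proof (intro allI impI)
    fix e :: real assume "0 < e"
    define d where "d = min (e / 2) ((1 - v) / 2)"
    have d: "0 < d" "d < e" "v + d < 1" using \<open>0 < e\<close> x by (auto simp: d_def min_def field_simps)
    obtain z where z: "v \<le> z" "z \<le> v + d" "(M, z) \<in> immersed_parameters"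
      using immersed_parameter_between[of M v "v + d"] x d by auto
    have "dist (M, z) x = \<bar>z - v\<bar>" unfolding x(1) dist_Pair_Pair by (simp add: dist_real_def)
    then have "dist (M, z) x < e" using z d by simp
    with z(3) show "\<exists>y\<in>immersed_parameters. dist y x < e" by blast
  qed
qed

text \<open>Already the projection to the first parameter is uncountable.\<close>
lemma immersed_parameters_uncountable: "uncountable immersed_parameters"
proof
  assume "countable immersed_parameters"
  then have "countable (fst ` immersed_parameters)" by simp
  moreover have "{0<..<1} \<subseteq> fst ` immersed_parameters"
  proof
    fix M :: real assume "M \<in> {0<..<1}"
    then obtain z where "(M, z) \<in> immersed_parameters"
      using immersed_parameter_between[of M "1 / 3" "1 / 2"] by auto
    then show "M \<in> fst ` immersed_parameters" by force
  qed
  ultimately have "countable {0<..<(1::real)}" by (rule countable_subset[rotated])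
  then show False using uncountable_open_interval[of 0 "1::real"] by simp
qed

theorem theorem1p8:
  shows "(\<forall>M v w L (\<alpha> :: real \<Rightarrow> real^2).
     -1/4 < M \<and> 0 < v \<and> v < 1 \<and> w = sqrt ((1 - v) / v) \<and>
     twizzler_profile M v \<alpha> \<and> L = fundamental_length w M \<alpha> \<longrightarrow>
       (\<exists>\<theta>. \<forall>s. \<alpha> (s + L) = plane_rot \<theta> *v \<alpha> s) \<and>
       (\<forall>\<theta>. (\<forall>s. \<alpha> (s + L) = plane_rot \<theta> *v \<alpha> s) \<longrightarrow>
          (\<forall>n::int. axis_rot (of_int n * \<theta>) ` twizzler_surface w \<alpha> = twizzler_surface w \<alpha>) \<and>
          ((\<exists>m::int. m \<noteq> 1 \<and> plane_rot (of_int m * \<theta>) = plane_rot \<theta>) \<longrightarrow>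
             properly_immersed \<alpha>) \<and>
          (\<not> (\<exists>m::int. m \<noteq> 1 \<and> plane_rot (of_int m * \<theta>) = plane_rot \<theta>) \<longrightarrow>
             (M = 0 \<longrightarrow> dense_in (twizzler_surface w \<alpha>) {p. axis_dist p < 1}) \<and>
             (M \<noteq> 0 \<longrightarrow> dense_in (twizzler_surface w \<alpha>)
                {p. \<bar>(sqrt (1 + 4 * M) - 1) / 2\<bar> \<le> axis_dist p \<and>
                    axis_dist p \<le> (sqrt (1 + 4 * M) + 1) / 2}))) \<and>
       (\<forall>b::nat. properly_immersed \<alpha> \<and> consists_of_pieces L \<alpha> b \<longleftrightarrow>
          (\<exists>a::nat. 0 < a \<and> 0 < b \<and> coprime a b \<and>
             integral {0..2 * pi} (\<psi> M w) = 2 * pi * (real a / real b)))) \<and>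
   (let P = {(M, v). -1/4 < M \<and> 0 < v \<and> v < 1 \<and>
                     (\<exists>\<alpha>. twizzler_profile M v \<alpha> \<and> properly_immersed \<alpha>)}
    in uncountable P \<and> {-1/4<..} \<times> {0<..<1} \<subseteq> closure P)"
proof (intro conjI allI impI)
  fix M v w L :: real and \<alpha> :: "real \<Rightarrow> real^2"
  assume "-1/4 < M \<and> 0 < v \<and> v < 1 \<and> w = sqrt ((1 - v) / v) \<and>
     twizzler_profile M v \<alpha> \<and> L = fundamental_length w M \<alpha>"
  then have a: "- 1 / 4 < M" "0 < v" "v < 1" "w = twizzler_w v" "twizzler_profile M v \<alpha>"
    and L: "L = fundamental_length w M \<alpha>"
    by (auto simp: twizzler_w_def)
  interpret twizzler_parameters M w
    using a twizzler_w_pos by unfold_locales auto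
  obtain \<phi> J where "lifted_profile M w \<alpha> \<phi> J"
    using twizzler_profile_lift[OF twizzler_parameters_axioms a(4,5)] .
  then interpret lifted_profile M w \<alpha> \<phi> J .
  have L: "L = period" unfolding L by (rule fundamental_length)
  show "\<exists>\<theta>. \<forall>s. \<alpha> (s + L) = plane_rot \<theta> *v \<alpha> s"
    unfolding L using \<alpha>_shift by blast
  show "(properly_immersed \<alpha> \<and> consists_of_pieces L \<alpha> b) = (\<exists>a::nat. 0 < a \<and> 0 < b \<and> coprime a b \<and>
             integral {0..2 * pi} (\<psi> M w) = 2 * pi * (real a / real b))" for b
    unfolding L integral_\<psi> by (rule pieces_iff)
  fix \<theta> assume "\<forall>s. \<alpha> (s + L) = plane_rot \<theta> *v \<alpha> s"
  then have sh: "\<And>s. \<alpha> (s + period) = plane_rot \<theta> *v \<alpha> s" unfolding L by blast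
  show "axis_rot (of_int n * \<theta>) ` twizzler_surface w \<alpha> = twizzler_surface w \<alpha>" for n :: int
    using sh by (rule surface_invariant)
  show "properly_immersed \<alpha>" if "\<exists>m::int. m \<noteq> 1 \<and> plane_rot (of_int m * \<theta>) = plane_rot \<theta>"
    using that properly_immersed_if_finite_order[OF sh] by blast
  assume irr: "\<not> (\<exists>m::int. m \<noteq> 1 \<and> plane_rot (of_int m * \<theta>) = plane_rot \<theta>)"
  show "dense_in (twizzler_surface w \<alpha>) {p. axis_dist p < 1}" if "M = 0"
    using surface_dense(1)[OF sh irr that] .
  show "dense_in (twizzler_surface w \<alpha>)
                {p. \<bar>(sqrt (1 + 4 * M) - 1) / 2\<bar> \<le> axis_dist p \<and>
                    axis_dist p \<le> (sqrt (1 + 4 * M) + 1) / 2}" if "M \<noteq> 0"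
    using surface_dense(2)[OF sh irr that] .
next
  show "let P = {(M, v). -1/4 < M \<and> 0 < v \<and> v < 1 \<and>
                     (\<exists>\<alpha>. twizzler_profile M v \<alpha> \<and> properly_immersed \<alpha>)}
    in uncountable P \<and> {-1/4<..} \<times> {0<..<1} \<subseteq> closure P"
    unfolding Let_def immersed_parameters_def[symmetric]
    using immersed_parameters_uncountable immersed_parameters_dense by blast
qed

end
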